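(* Let $N\ge 2$, $s\in(0,1)$, let $\Omega\subset\mathbb{R}^N$ be a bounded $C^2$ domain containing the origin, and let $\mu\ge0$. Let $Q\in C^\beta_{loc}(\mathbb{R}^N\setminus\{0\})$ for some $\beta\in(0,1)$ be a positive function such that $\liminf_{|x|\to0^+}Q(x)|x|^{-\theta}>0$ for some $\theta<-\tau_+-N$. Let $q^\#_{\mu,\theta}=\frac{N+\theta}{-\tau_+}-1$ if $\mu\ne0$ and $q^\#_{\mu,\theta}=+\infty$ if $\mu=0$. Then for $0<p\le q^\#_{\mu,\theta}$ (with $p$ a real number) the problem $$\mathcal{L}_\mu^s u\ge Q u^p\ \text{ in }\Omega\setminus\{0\},\qquad u\ge 0\ \text{ in }\mathbb{R}^N\setminus\Omega$$ has no positive solution.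
   Context: $\mu_0=-2^{2s}\frac{\Gamma^2(\frac{N+2s}{4})}{\Gamma^2(\frac{N-2s}{4})}$. The fractional Laplacian is $(-\Delta)^s u(x)=\lim_{\varepsilon\to0^+}C_{N,s}\int_{\mathbb{R}^N\setminus B_\varepsilon(x)}\frac{u(x)-u(z)}{|x-z|^{N+2s}}dz$, $C_{N,s}=2^{2s}\pi^{-N/2}s\frac{\Gamma(\frac{N+2s}{2})}{\Gamma(1-s)}$, where $B_\varepsilon(x)$ is the ball of radius $\varepsilon$ centred at $x$, and $\mathcal{L}^s_\mu=(-\Delta)^s+\frac{\mu}{|x|^{2s}}$. For $\tau\in(-N,2s)$ let $c_s(\tau)=2^{2s}\frac{\Gamma(\frac{N+\tau}{2})\Gamma(\frac{2s-\tau}{2})}{\Gamma(-\frac{\tau}{2})\Gamma(\frac{N-2s+\tau}{2})}$ (with $1/\Gamma=0$ at poles of $\Gamma$); $c_s$ is strictly concave with maximum $-\mu_0$ attained at $\frac{2s-N}{2}$. For $\mu>\mu_0$, $\tau_-=\tau_-(s,\mu)<\tau_+=\tau_+(s,\mu)$ are the two zeros in $(-N,2s)$ of $c_s(\tau)+\mu$; $\tau_-+\tau_+=2s-N$, $\tau_+=0$ if $\mu=0$ and $\tau_+>0$ if $\mu>0$. $L^1_s(\mathbb{R}^N)=\{w\in L^1_{loc}(\mathbb{R}^N):\int_{\mathbb{R}^N}\frac{|w(x)|}{1+|x|^{N+2s}}dx<\infty\}$. A positive solution is a classical solution, i.e. a function $u\in L^1_s(\mathbb{R}^N)\cap C(\Omega\setminus\{0\})$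 satisfying the inequality pointwise in $\Omega\setminus\{0\}$ and $u\ge0$ in $\mathbb{R}^N\setminus\Omega$, such that $u>0$ a.e. in $\Omega\setminus\{0\}$. *)

theory Defs
  imports "HOL-Analysis.Analysis"
begin

text \<open>Throughout, the Euclidean space R^N is a type \<open>'a\<close> of class \<open>euclidean_space\<close>, and
  N = \<open>DIM('a)\<close>. Functions on R^N minus the origin are total functions whose value at \<open>0\<close> is
  never constrained.\<close>

definition frac_const :: "nat \<Rightarrow> real \<Rightarrow> real" where
  "frac_const N s =
     2 powr (2 * s) * pi powr (- real N / 2) * s * (Gamma ((real N + 2 * s) / 2) / Gamma (1 - s))"

text \<open>If \<open>u \<in> L1s s\<close> (defined below), the integrand is integrable for every \<open>\<epsilon> > 0\<close>, so the
  convention that the integral of a non-integrable function is 0 plays no role.\<close>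

definition truncated_frac_laplacian ::
    "real \<Rightarrow> ('a::euclidean_space \<Rightarrow> real) \<Rightarrow> 'a \<Rightarrow> real \<Rightarrow> real" where
  "truncated_frac_laplacian s u x \<epsilon> =
     frac_const DIM('a) s *
       (LINT z : - ball x \<epsilon> | lebesgue. (u x - u z) / norm (x - z) powr (real DIM('a) + 2 * s))"

definition frac_laplacian_exists :: "real \<Rightarrow> ('a::euclidean_space \<Rightarrow> real) \<Rightarrow> 'a \<Rightarrow> bool" where
  "frac_laplacian_exists s u x \<longleftrightarrow>
     (\<exists>L. (truncated_frac_laplacian s u x \<longlongrightarrow> L) (at_right 0))"

text \<open>Only meaningful together with \<open>frac_laplacian_exists s u x\<close>.\<close>

definition frac_laplacian :: "real \<Rightarrow> ('a::euclidean_space \<Rightarrow> real) \<Rightarrow> 'a \<Rightarrow> real" where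
  "frac_laplacian s u x = Lim (at_right 0) (truncated_frac_laplacian s u x)"

definition hardy_operator ::
    "real \<Rightarrow> real \<Rightarrow> ('a::euclidean_space \<Rightarrow> real) \<Rightarrow> 'a \<Rightarrow> real" where
  "hardy_operator s \<mu> u x = frac_laplacian s u x + \<mu> / norm x powr (2 * s) * u x"

text \<open>\<open>rGamma\<close> is the entire function 1/Gamma, which vanishes at the poles of Gamma.\<close>

definition c_s :: "nat \<Rightarrow> real \<Rightarrow> real \<Rightarrow> real" where
  "c_s N s \<tau> =
     2 powr (2 * s) * Gamma ((real N + \<tau>) / 2) * Gamma ((2 * s - \<tau>) / 2)
       * rGamma (- \<tau> / 2) * rGamma ((real N - 2 * s + \<tau>) / 2)"

text \<open>The larger of the two zeros of \<open>\<tau> \<mapsto> c_s N s \<tau> + \<mu>\<close> in \<open>(-N, 2s)\<close>.\<close>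

definition tau_plus :: "nat \<Rightarrow> real \<Rightarrow> real \<Rightarrow> real" where
  "tau_plus N s \<mu> = (GREATEST \<tau>. \<tau> \<in> {- real N <..< 2 * s} \<and> c_s N s \<tau> + \<mu> = 0)"

definition q_sharp :: "nat \<Rightarrow> real \<Rightarrow> real \<Rightarrow> real \<Rightarrow> ereal" where
  "q_sharp N s \<mu> \<theta> =
     (if \<mu> \<noteq> 0 then ereal ((real N + \<theta>) / (- tau_plus N s \<mu>) - 1) else \<infinity>)"

definition L1_loc :: "('a::euclidean_space \<Rightarrow> real) set" where
  "L1_loc = {w. \<forall>K. compact K \<longrightarrow> set_integrable lebesgue K w}"

definition L1s :: "real \<Rightarrow> ('a::euclidean_space \<Rightarrow> real) set" where
  "L1s s = {w \<in> L1_loc. integrable lebesgue (\<lambda>x. \<bar>w x\<bar> / (1 + norm x powr (real DIM('a) + 2 * s)))}"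

text \<open>\<open>g\<close> is the gradient of \<open>f\<close> and \<open>H x\<close> its Hessian at \<open>x\<close>, as a linear map.\<close>

definition C2_function :: "('a::euclidean_space \<Rightarrow> real) \<Rightarrow> bool" where
  "C2_function f \<longleftrightarrow>
     (\<exists>(g :: 'a \<Rightarrow> 'a) (H :: 'a \<Rightarrow> 'a \<Rightarrow>\<^sub>L 'a).
        (\<forall>x. GDERIV f x :> g x) \<and>
        (\<forall>x. (g has_derivative blinfun_apply (H x)) (at x)) \<and>
        continuous_on UNIV H)"

text \<open>Near each boundary point the set is, in suitable orthonormal coordinates with last
  coordinate \<open>x \<bullet> e\<close>, the region strictly above the graph of a C^2 function of the
  remaining N-1 coordinates. The latter are represented by the orthogonal projection
  \<open>x - (x \<bullet> e) *\<^sub>R e\<close>, so only the values of \<open>\<gamma>\<close> on the hyperplane orthogonal to \<open>e\<close>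
  matter.\<close>

definition C2_boundary :: "'a::euclidean_space set \<Rightarrow> bool" where
  "C2_boundary \<Omega> \<longleftrightarrow>
     (\<forall>x0 \<in> frontier \<Omega>. \<exists>r > 0. \<exists>e \<gamma>. norm e = 1 \<and> C2_function \<gamma> \<and>
        \<Omega> \<inter> ball x0 r = {x \<in> ball x0 r. x \<bullet> e > \<gamma> (x - (x \<bullet> e) *\<^sub>R e)})"

definition bounded_C2_domain :: "'a::euclidean_space set \<Rightarrow> bool" where
  "bounded_C2_domain \<Omega> \<longleftrightarrow> open \<Omega> \<and> connected \<Omega> \<and> bounded \<Omega> \<and> C2_boundary \<Omega>"

definition locally_holder_on :: "'a::euclidean_space set \<Rightarrow> real \<Rightarrow> ('a \<Rightarrow> real) \<Rightarrow> bool" where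
  "locally_holder_on U \<beta> f \<longleftrightarrow>
     (\<forall>K. compact K \<and> K \<subseteq> U \<longrightarrow>
        (\<exists>C. \<forall>x \<in> K. \<forall>y \<in> K. \<bar>f x - f y\<bar> \<le> C * norm (x - y) powr \<beta>))"

text \<open>A classical solution has, at each point of \<open>\<Omega> - {0}\<close>, a fractional Laplacian in the sense
  of a finite limit.\<close>

definition classical_solution ::
    "real \<Rightarrow> real \<Rightarrow> ('a::euclidean_space \<Rightarrow> real) \<Rightarrow> real \<Rightarrow> 'a set \<Rightarrow> ('a \<Rightarrow> real) \<Rightarrow> bool" where
  "classical_solution s \<mu> Q p \<Omega> u \<longleftrightarrow>
     u \<in> L1s s \<and> continuous_on (\<Omega> - {0}) u \<and>
     (\<forall>x \<in> \<Omega> - {0}. frac_laplacian_exists s u x \<and> hardy_operator s \<mu> u x \<ge> Q x * u x powr p) \<and>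
     (\<forall>x \<in> - \<Omega>. u x \<ge> 0)"

text \<open>By continuity, \<open>u \<ge> 0\<close> on all of \<open>\<Omega> - {0}\<close>, so \<open>u x powr p\<close> is the usual power
  there (with \<open>0 powr p = 0\<close> for \<open>p > 0\<close>).\<close>

definition positive_solution ::
    "real \<Rightarrow> real \<Rightarrow> ('a::euclidean_space \<Rightarrow> real) \<Rightarrow> real \<Rightarrow> 'a set \<Rightarrow> ('a \<Rightarrow> real) \<Rightarrow> bool" where
  "positive_solution s \<mu> Q p \<Omega> u \<longleftrightarrow>
     classical_solution s \<mu> Q p \<Omega> u \<and> (AE x in lebesgue. x \<in> \<Omega> - {0} \<longrightarrow> u x > 0)"

end

theory Submission
  imports Defs "HOL-Probability.Distributions"
begin

text \<open>Near the origin a positive solution u satisfies L u \<ge> c |x|^\<theta> u^p, where L is the Hardy operator.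
  All barriers are combinations of powers: L |x|^\<sigma> = (c_s(\<sigma>) + \<mu>) |x|^(\<sigma> - 2s) for -N < \<sigma> < 2s, and
  c_s + \<mu> is negative on (\<tau>_+, 2s) and, by the symmetry \<sigma> \<mapsto> 2s - N - \<sigma>, on (-N, \<tau>_-) with
  \<tau>_- = 2s - N - \<tau>_+. The comparison principle on annuli gives u \<ge> c |x|^\<sigma> near 0 for every \<sigma> > \<tau>_+.
  Touching u from below by paraboloids at scale |x| shows that u \<ge> c |x|^\<sigma> implies
  u \<ge> c' |x|^(p \<sigma> + \<theta> + 2s). The hypotheses on \<theta> and p imply that this lowers every exponent in
  [\<tau>_-, \<tau>_+] by a fixed amount, so after finitely many steps u \<ge> c |x|^\<sigma> with some \<sigma> < \<tau>_-. Such a u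
  dominates k (|x|^\<alpha> - r^\<alpha>) for \<sigma> < \<alpha> < \<tau>_- and every k > 0, which is absurd.\<close>

section \<open>Gaussian integrals\<close>

text \<open>The formula for powers is the analytic core. The principal value is symmetrised to the
  second difference of |x|^\<tau>, which is absolutely integrable against |y|^(-N-2s). Kernel and
  power are then written as superpositions of Gaussians, so the integral over R^N becomes Gaussian
  and only Beta integrals in one variable remain; they produce the Gamma factors of
  \<open>c_s\<close>. A classical solution offers only continuity and a convergent limit at each
  point. So at a minimum point the truncated integrals of u are compared with those of a function
  touching it from below, and then the truncation radius tends to 0. The value of u at the origin is
  arbitrary, hence pointwise bounds are stated for \<open>z \<noteq> 0\<close> and used almost
  everywhere.\<close>

text \<open>Read from right to left, it represents \<open>R powr (- a)\<close> as a superposition of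
  exponentials, hence of Gaussians when \<open>R\<close> is a squared norm. The nonnegative integral
  lets Tonelli be applied without integrability checks.\<close>

lemma nn_integral_powr_exp:
  fixes a R :: real
  assumes a: "a > 0" and R: "R > 0"
  shows "(\<integral>\<^sup>+t. ennreal (indicator {0<..} t * (t powr (a - 1) * exp (- R * t))) \<partial>lborel)
    = ennreal (Gamma a * R powr (- a))"
proof -
  have "(\<integral>\<^sup>+t. ennreal (indicator {0<..} t * (t powr (a - 1) * exp (- R * t))) \<partial>lborel)
    = (\<integral>\<^sup>+t. ennreal (R powr (1 - a)) * ennreal (indicator {0..} (R * t) * (R * t) powr (a - 1) / exp (R * t)) \<partial>lborel)"
  proof (rule nn_integral_cong)
    fix t :: real
    show "ennreal (indicator {0<..} t * (t powr (a - 1) * exp (- R * t)))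
      = ennreal (R powr (1 - a)) * ennreal (indicator {0..} (R * t) * (R * t) powr (a - 1) / exp (R * t))"
    proof (cases "t > 0")
      case True
      have "R powr (1 - a) * (R * t) powr (a - 1) = t powr (a - 1)"
        using True R by (simp add: powr_mult powr_add[symmetric] flip: mult.assoc)
      then show ?thesis
        using True R by (simp add: ennreal_mult'[symmetric] exp_minus divide_inverse flip: mult.assoc)
    next
      case False
      then show ?thesis using R by (cases "t = 0") (auto simp: indicator_def zero_le_mult_iff)
    qed
  qed
  also have "\<dots> = ennreal (R powr (1 - a)) * (\<integral>\<^sup>+t. ennreal (indicator {0..} (R * t) * (R * t) powr (a - 1) / exp (R * t)) \<partial>lborel)"
    by (rule nn_integral_cmult) measurable
  also have "(\<integral>\<^sup>+t. ennreal (indicator {0..} (R * t) * (R * t) powr (a - 1) / exp (R * t)) \<partial>lborel)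
    = ennreal (1 / R) * ennreal (Gamma a)"
  proof -
    have "ennreal (Gamma a) = ennreal R * (\<integral>\<^sup>+t. ennreal (indicator {0..} (R * t) * (R * t) powr (a - 1) / exp (R * t)) \<partial>lborel)"
      using R a by (subst Gamma_conv_nn_integral_real[OF a], subst nn_integral_real_affine[where c = R and t = 0]) auto
    then show ?thesis
      using R by (simp add: mult.assoc[symmetric] ennreal_mult'[symmetric])
  qed
  also have "ennreal (R powr (1 - a)) * (ennreal (1 / R) * ennreal (Gamma a)) = ennreal (Gamma a * R powr (- a))"
    using R a by (simp add: ennreal_mult'[symmetric] powr_diff powr_minus field_simps)
  finally show ?thesis .
qed

text \<open>Up to the factor sqrt(pi / k) the exponential is the normal density with mean m and
  variance 1 / (2 k). Expanding z^2 about m reduces the second integral to central moments.\<close>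

lemma nn_integral_gaussian_1d:
  fixes k m :: real
  assumes k: "k > 0"
  shows "(\<integral>\<^sup>+z. ennreal (exp (- k * (z - m)\<^sup>2)) \<partial>lborel) = ennreal (sqrt (pi / k))" (is ?A)
    and "(\<integral>\<^sup>+z. ennreal (z\<^sup>2 * exp (- k * (z - m)\<^sup>2)) \<partial>lborel) = ennreal (sqrt (pi / k) * (1 / (2 * k) + m\<^sup>2))" (is ?B)
proof -
  define \<sigma> where "\<sigma> = sqrt (1 / (2 * k))"
  have \<sigma>: "\<sigma>\<^sup>2 = 1 / (2 * k)" using k by (simp add: \<sigma>_def)
  have \<sigma>0: "\<sigma> > 0" using k by (simp add: \<sigma>_def)
  have e: "exp (- k * (z - m)\<^sup>2) = sqrt (pi / k) * normal_density m \<sigma> z" for z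
    using k by (simp add: normal_density_def \<sigma> real_sqrt_divide)
  have 0: "has_bochner_integral lborel (normal_density m \<sigma>) 1"
    using normal_moment_even[OF \<sigma>0, of m 0] by simp
  have 1: "has_bochner_integral lborel (\<lambda>x. normal_density m \<sigma> x * (x - m)) 0"
    using normal_moment_odd[OF \<sigma>0, of m 0] by simp
  have 2: "has_bochner_integral lborel (\<lambda>x. normal_density m \<sigma> x * (x - m)\<^sup>2) (1 / (2 * k))"
    using normal_moment_even[OF \<sigma>0, of m 1] k by (simp add: \<sigma>)
  have "has_bochner_integral lborel (\<lambda>z. sqrt (pi / k) * normal_density m \<sigma> z) (sqrt (pi / k) * 1)"
    by (intro has_bochner_integral_mult_right 0)
  then have "has_bochner_integral lborel (\<lambda>z. exp (- k * (z - m)\<^sup>2)) (sqrt (pi / k))"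
    by (simp only: e mult_1_right)
  then show ?A
    by (subst nn_integral_eq_integral) (auto simp: has_bochner_integral_iff)
  have "has_bochner_integral lborel
      (\<lambda>z. sqrt (pi / k) * (normal_density m \<sigma> z * (z - m)\<^sup>2 + (2 * m) * (normal_density m \<sigma> z * (z - m)) + m\<^sup>2 * normal_density m \<sigma> z))
      (sqrt (pi / k) * (1 / (2 * k) + 2 * m * 0 + m\<^sup>2 * 1))"
    by (intro has_bochner_integral_mult_right has_bochner_integral_add 0 1 2)
  moreover have "sqrt (pi / k) * (normal_density m \<sigma> z * (z - m)\<^sup>2 + (2 * m) * (normal_density m \<sigma> z * (z - m)) + m\<^sup>2 * normal_density m \<sigma> z)
      = z\<^sup>2 * exp (- k * (z - m)\<^sup>2)" for z
    unfolding e by (simp add: power2_eq_square algebra_simps)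
  ultimately have "has_bochner_integral lborel (\<lambda>z. z\<^sup>2 * exp (- k * (z - m)\<^sup>2)) (sqrt (pi / k) * (1 / (2 * k) + m\<^sup>2))"
    by simp
  then show ?B
    by (subst nn_integral_eq_integral) (auto simp: has_bochner_integral_iff)
qed

lemma nn_integral_gaussian:
  fixes m :: "'a::euclidean_space" and k :: real
  assumes k: "k > 0"
  shows "(\<integral>\<^sup>+z. ennreal (exp (- k * (norm (z - m))\<^sup>2)) \<partial>lborel) = ennreal ((pi / k) powr (DIM('a) / 2))" (is ?A)
    and "(\<integral>\<^sup>+z. ennreal ((norm z)\<^sup>2 * exp (- k * (norm (z - m))\<^sup>2)) \<partial>lborel)
      = ennreal ((pi / k) powr (DIM('a) / 2) * (DIM('a) / (2 * k) + (norm m)\<^sup>2))" (is ?B)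
proof -
  have s: "sqrt (pi / k) ^ DIM('a) = (pi / k) powr (DIM('a) / 2)"
    using k by (simp add: powr_half_sqrt[symmetric] powr_power)
  have nrm: "(norm (z - m))\<^sup>2 = (\<Sum>b\<in>Basis. (z \<bullet> b - m \<bullet> b)\<^sup>2)" for z
    unfolding power2_norm_eq_inner by (subst euclidean_inner) (simp add: inner_diff_left power2_eq_square)
  have ex: "exp (- k * (norm (z - m))\<^sup>2) = (\<Prod>b\<in>Basis. exp (- k * (z \<bullet> b - m \<bullet> b)\<^sup>2))" for z
    by (simp add: nrm sum_distrib_left exp_sum flip: sum_negf)
  show ?A
    unfolding ex
    by (subst prod_ennreal[symmetric], simp, subst nn_integral_lborel_prod)
       (use k in \<open>auto simp: nn_integral_gaussian_1d[OF k, simplified] s[symmetric] ennreal_power\<close>)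
  have nz: "(norm z)\<^sup>2 = (\<Sum>b\<in>Basis. (z \<bullet> b)\<^sup>2)" for z :: 'a
    unfolding power2_norm_eq_inner by (subst euclidean_inner) (simp add: power2_eq_square)
  \<comment> \<open>|z|^2 times a Gaussian does not factor over the coordinates, but it is a sum
    over i of products in which only factor i carries the square.\<close>
  have "(\<integral>\<^sup>+z. ennreal ((norm z)\<^sup>2 * exp (- k * (norm (z - m))\<^sup>2)) \<partial>lborel)
    = (\<integral>\<^sup>+z. (\<Sum>i\<in>Basis. (\<Prod>b\<in>Basis. ennreal ((if b = i then (z \<bullet> b)\<^sup>2 else 1) * exp (- k * (z \<bullet> b - m \<bullet> b)\<^sup>2)))) \<partial>lborel)"
  proof (rule nn_integral_cong)
    fix z :: 'a
    have "(norm z)\<^sup>2 * exp (- k * (norm (z - m))\<^sup>2)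
      = (\<Sum>i\<in>Basis. (\<Prod>b\<in>Basis. (if b = i then (z \<bullet> b)\<^sup>2 else 1) * exp (- k * (z \<bullet> b - m \<bullet> b)\<^sup>2)))"
      unfolding ex nz[of z] sum_distrib_right by (simp add: prod.distrib prod.delta)
    then show "ennreal ((norm z)\<^sup>2 * exp (- k * (norm (z - m))\<^sup>2))
      = (\<Sum>i\<in>Basis. (\<Prod>b\<in>Basis. ennreal ((if b = i then (z \<bullet> b)\<^sup>2 else 1) * exp (- k * (z \<bullet> b - m \<bullet> b)\<^sup>2))))"
      by (simp add: prod_ennreal sum_ennreal prod_nonneg)
  qed
  also have "\<dots> = (\<Sum>i\<in>Basis. \<integral>\<^sup>+z. (\<Prod>b\<in>Basis. ennreal ((if b = i then (z \<bullet> b)\<^sup>2 else 1) * exp (- k * (z \<bullet> b - m \<bullet> b)\<^sup>2))) \<partial>lborel)"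
    by (rule nn_integral_sum) measurable
  also have "\<dots> = (\<Sum>i\<in>Basis. (\<Prod>b\<in>Basis. ennreal (sqrt (pi / k) * (if b = i then 1 / (2 * k) + (m \<bullet> i)\<^sup>2 else 1))))"
  proof (rule sum.cong[OF refl])
    fix i :: 'a assume i: "i \<in> Basis"
    have "(\<integral>\<^sup>+z. (\<Prod>b\<in>Basis. ennreal ((if b = i then (z \<bullet> b)\<^sup>2 else 1) * exp (- k * (z \<bullet> b - m \<bullet> b)\<^sup>2))) \<partial>lborel)
      = (\<Prod>b\<in>Basis. \<integral>\<^sup>+z. ennreal ((if b = i then z\<^sup>2 else 1) * exp (- k * (z - m \<bullet> b)\<^sup>2)) \<partial>lborel)"
      by (rule nn_integral_lborel_prod[where f = "\<lambda>b z. ennreal ((if b = i then z\<^sup>2 else 1) * exp (- k * (z - m \<bullet> b)\<^sup>2))"]) auto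
    also have "\<dots> = (\<Prod>b\<in>Basis. ennreal (sqrt (pi / k) * (if b = i then 1 / (2 * k) + (m \<bullet> i)\<^sup>2 else 1)))"
      by (rule prod.cong[OF refl]) (use nn_integral_gaussian_1d[OF k] in \<open>simp split: if_splits\<close>)
    finally show "(\<integral>\<^sup>+z. (\<Prod>b\<in>Basis. ennreal ((if b = i then (z \<bullet> b)\<^sup>2 else 1) * exp (- k * (z \<bullet> b - m \<bullet> b)\<^sup>2))) \<partial>lborel)
      = (\<Prod>b\<in>Basis. ennreal (sqrt (pi / k) * (if b = i then 1 / (2 * k) + (m \<bullet> i)\<^sup>2 else 1)))" .
  qed
  also have "\<dots> = (\<Sum>i\<in>Basis. ennreal ((pi / k) powr (DIM('a) / 2) * (1 / (2 * k) + (m \<bullet> i)\<^sup>2)))"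
    using k by (intro sum.cong refl) (simp add: prod_ennreal prod.distrib prod.delta s)
  also have "\<dots> = ennreal ((pi / k) powr (DIM('a) / 2) * (DIM('a) / (2 * k) + (norm m)\<^sup>2))"
    using k by (simp add: sum_ennreal nz sum.distrib sum_distrib_left[symmetric])
  finally show ?B .
qed

text \<open>Completing the square turns the two Gaussians into one of rate l + t centred at (t / (l
  + t)) x, times a factor free of z; the remaining integral is a second moment.\<close>

lemma nn_integral_gaussian_product:
  fixes x :: "'a::euclidean_space" and l t :: real
  assumes l: "l > 0" and t: "t > 0"
  shows "(\<integral>\<^sup>+z. ennreal ((norm z)\<^sup>2 * exp (- l * (norm z)\<^sup>2) * exp (- t * (norm (z - x))\<^sup>2)) \<partial>lborel)
    = ennreal ((pi / (l + t)) powr (DIM('a) / 2) * exp (- (l * t / (l + t)) * (norm x)\<^sup>2)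
        * (DIM('a) / (2 * (l + t)) + t\<^sup>2 / (l + t)\<^sup>2 * (norm x)\<^sup>2))"
proof -
  define k where "k = l + t"
  define m where "m = (t / k) *\<^sub>R x"
  have k: "k > 0" using l t by (simp add: k_def)
  have *: "l * (norm z)\<^sup>2 + t * (norm (z - x))\<^sup>2 = k * (norm (z - m))\<^sup>2 + (l * t / k) * (norm x)\<^sup>2" for z
  proof -
    have 1: "(norm (z - x))\<^sup>2 = (norm z)\<^sup>2 - 2 * (z \<bullet> x) + (norm x)\<^sup>2"
      by (simp add: power2_norm_eq_inner algebra_simps inner_commute)
    have 2: "(norm (z - m))\<^sup>2 = (norm z)\<^sup>2 - 2 * (t / k) * (z \<bullet> x) + (t / k)\<^sup>2 * (norm x)\<^sup>2"
      unfolding m_def power2_norm_eq_inner by (simp add: inner_diff_left inner_diff_right inner_commute power2_eq_square)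
    have "k * (t / k)\<^sup>2 + l * t / k = t * k / k"
    proof -
      have "k * (t / k)\<^sup>2 = t * t / k" using k by (simp add: power2_eq_square)
      moreover have "t * t / k + l * t / k = t * k / k"
        unfolding add_divide_distrib[symmetric] by (simp add: k_def algebra_simps)
      ultimately show ?thesis by simp
    qed
    then have 3: "k * (t / k) = t" "k * (t / k)\<^sup>2 + l * t / k = t"
      using k by auto
    have "k * (norm (z - m))\<^sup>2 + (l * t / k) * (norm x)\<^sup>2
      = k * (norm z)\<^sup>2 - 2 * (k * (t / k)) * (z \<bullet> x) + (k * (t / k)\<^sup>2 + l * t / k) * (norm x)\<^sup>2"
      unfolding 2 by (simp add: algebra_simps)
    also have "\<dots> = l * (norm z)\<^sup>2 + t * (norm (z - x))\<^sup>2"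
      unfolding 3 1 by (simp add: k_def algebra_simps)
    finally show ?thesis by simp
  qed
  have "exp (- l * (norm z)\<^sup>2) * exp (- t * (norm (z - x))\<^sup>2)
      = exp (- (l * t / k) * (norm x)\<^sup>2) * exp (- k * (norm (z - m))\<^sup>2)" for z
    using *[of z] by (simp flip: exp_add)
  then have "(norm z)\<^sup>2 * exp (- l * (norm z)\<^sup>2) * exp (- t * (norm (z - x))\<^sup>2)
      = exp (- (l * t / k) * (norm x)\<^sup>2) * ((norm z)\<^sup>2 * exp (- k * (norm (z - m))\<^sup>2))" for z
    by (simp add: mult.assoc mult.left_commute)
  then have "(\<integral>\<^sup>+z. ennreal ((norm z)\<^sup>2 * exp (- l * (norm z)\<^sup>2) * exp (- t * (norm (z - x))\<^sup>2)) \<partial>lborel)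
    = (\<integral>\<^sup>+z. ennreal (exp (- (l * t / k) * (norm x)\<^sup>2)) * ennreal ((norm z)\<^sup>2 * exp (- k * (norm (z - m))\<^sup>2)) \<partial>lborel)"
    by (simp only: ennreal_mult'[OF exp_ge_zero])
  also have "\<dots> = ennreal (exp (- (l * t / k) * (norm x)\<^sup>2)) * ennreal ((pi / k) powr (DIM('a) / 2) * (DIM('a) / (2 * k) + (norm m)\<^sup>2))"
    by (subst nn_integral_cmult) (simp_all add: nn_integral_gaussian(2)[OF k, simplified])
  also have "\<dots> = ennreal ((pi / k) powr (DIM('a) / 2) * exp (- (l * t / k) * (norm x)\<^sup>2) * (DIM('a) / (2 * k) + t\<^sup>2 / k\<^sup>2 * (norm x)\<^sup>2))"
    using k by (simp add: ennreal_mult'[symmetric] m_def power_mult_distrib power_divide mult_ac)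
  finally show ?thesis by (simp add: k_def)
qed

section \<open>Integrability of power kernels\<close>

lemma nn_integral_gaussian_kernel:
  fixes y :: "'a::euclidean_space" and q :: real
  assumes q: "q > 0" and y: "y \<noteq> 0"
  shows "(\<integral>\<^sup>+t. ennreal (indicator {0<..} t * (t powr (q - 1) * exp (- t * (norm y)\<^sup>2))) \<partial>lborel)
    = ennreal (Gamma q * norm y powr (- 2 * q))"
proof -
  have "((norm y)\<^sup>2) powr (- q) = norm y powr (- 2 * q)"
    using y by (simp add: powr_powr flip: powr_numeral)
  then show ?thesis
    using nn_integral_powr_exp[OF q, of "(norm y)\<^sup>2"] y by (simp add: mult.commute)
qed

text \<open>After the kernel is written as a superposition of Gaussians and the integrals are
  swapped, the integral over y is at most the smaller of the zeroth and the second moment. What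
  remains in t behaves like t^(a-1) near 0 and t^(a-2) at infinity, and 0 < a < 1 makes both ends
  converge.\<close>

lemma integrable_truncated_kernel:
  fixes a :: real
  assumes a: "0 < a" "a < 1"
  shows "integrable lborel (\<lambda>y::'a::euclidean_space. min 1 ((norm y)\<^sup>2) * norm y powr (- (DIM('a) + 2 * a)))"
proof (rule integrableI_nonneg)
  let ?N = "real DIM('a)"
  define q where "q = ?N / 2 + a"
  have q: "q > 0" using a by (simp add: q_def add_nonneg_pos)
  define h where "h = (\<lambda>t::real. t powr (q - 1) * ((pi / t) powr (?N / 2) * min 1 (?N / (2 * t))))"
  have "(\<integral>\<^sup>+y. ennreal (min 1 ((norm (y::'a))\<^sup>2) * norm y powr (- (?N + 2 * a))) \<partial>lborel)
    = (\<integral>\<^sup>+y. ennreal (min 1 ((norm (y::'a))\<^sup>2) / Gamma q) * (\<integral>\<^sup>+t. ennreal (indicator {0<..} t * (t powr (q - 1) * exp (- t * (norm y)\<^sup>2))) \<partial>lborel) \<partial>lborel)"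
  proof (rule nn_integral_cong)
    fix y :: 'a
    show "ennreal (min 1 ((norm y)\<^sup>2) * norm y powr (- (?N + 2 * a))) = ennreal (min 1 ((norm y)\<^sup>2) / Gamma q) * (\<integral>\<^sup>+t. ennreal (indicator {0<..} t * (t powr (q - 1) * exp (- t * (norm y)\<^sup>2))) \<partial>lborel)"
    proof (cases "y = 0")
      case False
      have "- 2 * q = - (?N + 2 * a)" by (simp add: q_def)
      then show ?thesis
        using Gamma_real_pos[OF q] unfolding nn_integral_gaussian_kernel[OF q False]
        by (simp add: ennreal_mult'[symmetric])
    qed simp
  qed
  also have "\<dots> = (\<integral>\<^sup>+y. \<integral>\<^sup>+t. ennreal (min 1 ((norm (y::'a))\<^sup>2) / Gamma q) * ennreal (indicator {0<..} t * (t powr (q - 1) * exp (- t * (norm y)\<^sup>2))) \<partial>lborel \<partial>lborel)"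
    by (intro nn_integral_cong nn_integral_cmult[symmetric]) measurable
  also have "\<dots> = (\<integral>\<^sup>+t. \<integral>\<^sup>+y. ennreal (min 1 ((norm (y::'a))\<^sup>2) / Gamma q) * ennreal (indicator {0<..} t * (t powr (q - 1) * exp (- t * (norm y)\<^sup>2))) \<partial>lborel \<partial>lborel)"
    by (intro lborel_pair.Fubini') measurable
  also have "\<dots> \<le> (\<integral>\<^sup>+t. ennreal (indicator {0<..} t * (h t / Gamma q)) \<partial>lborel)"
  proof (rule nn_integral_mono)
    fix t :: real
    show "(\<integral>\<^sup>+y. ennreal (min 1 ((norm (y::'a))\<^sup>2) / Gamma q) * ennreal (indicator {0<..} t * (t powr (q - 1) * exp (- t * (norm y)\<^sup>2))) \<partial>lborel) \<le> ennreal (indicator {0<..} t * (h t / Gamma q))"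
    proof (cases "t > 0")
      case True
      have G: "Gamma q > 0" using q by (rule Gamma_real_pos)
      define I where "I = (\<integral>\<^sup>+y. ennreal (min 1 ((norm (y::'a))\<^sup>2) * exp (- t * (norm y)\<^sup>2)) \<partial>lborel)"
      have "(\<integral>\<^sup>+y. ennreal (min 1 ((norm (y::'a))\<^sup>2) / Gamma q) * ennreal (indicator {0<..} t * (t powr (q - 1) * exp (- t * (norm y)\<^sup>2))) \<partial>lborel)
        = (\<integral>\<^sup>+y. ennreal (t powr (q - 1) / Gamma q) * ennreal (min 1 ((norm (y::'a))\<^sup>2) * exp (- t * (norm y)\<^sup>2)) \<partial>lborel)"
        using True G by (intro nn_integral_cong) (simp add: ennreal_mult'[symmetric] mult_ac)
      also have "\<dots> = ennreal (t powr (q - 1) / Gamma q) * I"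
        unfolding I_def by (rule nn_integral_cmult) measurable
      also have "I \<le> ennreal ((pi / t) powr (?N / 2) * min 1 (?N / (2 * t)))"
      proof -
        have "I \<le> (\<integral>\<^sup>+y. ennreal (exp (- t * (norm ((y::'a) - 0))\<^sup>2)) \<partial>lborel)"
          unfolding I_def by (intro nn_integral_mono ennreal_leI) simp
        then have 1: "I \<le> ennreal ((pi / t) powr (?N / 2))"
          unfolding nn_integral_gaussian(1)[OF True] .
        have "I \<le> (\<integral>\<^sup>+y. ennreal ((norm (y::'a))\<^sup>2 * exp (- t * (norm (y - 0))\<^sup>2)) \<partial>lborel)"
          unfolding I_def by (intro nn_integral_mono ennreal_leI) simp
        then have 2: "I \<le> ennreal ((pi / t) powr (?N / 2) * (?N / (2 * t)))"
          unfolding nn_integral_gaussian(2)[OF True] by simp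
        show ?thesis using 1 2 by (simp add: min_def)
      qed
      finally show ?thesis
        using True G by (simp add: h_def ennreal_mult'[symmetric] mult_left_mono)
    qed simp
  qed
  also have "\<dots> < \<infinity>"
  proof -
    define C where "C = pi powr (?N / 2) * ?N / Gamma q"
    have G: "Gamma q > 0" using q by (rule Gamma_real_pos)
    have C: "C \<ge> 0" using G by (simp add: C_def)
    have hpow: "t powr (q - 1) * (pi / t) powr (?N / 2) = pi powr (?N / 2) * t powr (a - 1)" if "t > 0" for t
    proof -
      have "t powr (q - 1) / t powr (?N / 2) = t powr (a - 1)"
        by (simp add: powr_diff[symmetric] q_def)
      moreover have "t powr (q - 1) * (pi powr (?N / 2) / t powr (?N / 2)) = pi powr (?N / 2) * (t powr (q - 1) / t powr (?N / 2))"
        by simp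
      ultimately show ?thesis using that by (simp add: powr_divide)
    qed
    \<comment> \<open>On (0, 1] the factor exp (1 - t) \<ge> 1 is inserted so that the bound becomes
      a Gamma integrand.\<close>
    have ht: "h t / Gamma q \<le> C * (exp 1 * (t powr (a - 1) * exp (- 1 * t)))" if "t > 0" "t \<le> 1" for t
    proof -
      have "h t = pi powr (?N/2) * t powr (a - 1) * min 1 (?N / (2 * t))"
        using hpow[of t] that by (simp add: h_def)
      also have "\<dots> \<le> pi powr (?N/2) * t powr (a - 1) * 1"
        by (intro mult_left_mono) auto
      also have "\<dots> \<le> pi powr (?N/2) * t powr (a - 1) * (?N * exp (1 - t))"
      proof (intro mult_left_mono)
        have "1 * 1 \<le> ?N * exp (1 - t)" using that by (intro mult_mono) (auto simp: Suc_le_eq)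
        then show "1 \<le> ?N * exp (1 - t)" by simp
      qed auto
      finally have "h t / Gamma q \<le> (pi powr (?N/2) * t powr (a - 1) * (?N * exp (1 - t))) / Gamma q"
        using G by (intro divide_right_mono) auto
      then show ?thesis by (simp add: C_def exp_diff exp_minus field_simps)
    qed
    have ht2: "h t / Gamma q \<le> C * t powr (a - 2)" if "t \<ge> 1" for t
    proof -
      have "h t = pi powr (?N/2) * t powr (a - 1) * min 1 (?N / (2 * t))"
        using hpow[of t] that by (simp add: h_def)
      also have "\<dots> \<le> pi powr (?N/2) * t powr (a - 1) * (?N / t)"
        using that by (intro mult_left_mono) (auto simp: min_le_iff_disj intro!: divide_left_mono)
      also have "\<dots> = pi powr (?N/2) * ?N * t powr (a - 2)"
      proof -
        have "t powr (a - 1) / t = t powr (a - 2)"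
          using that powr_diff[of t "a - 1" 1] by simp
        moreover have "pi powr (?N/2) * t powr (a - 1) * (?N / t) = pi powr (?N/2) * ?N * (t powr (a - 1) / t)"
          by simp
        ultimately show ?thesis by simp
      qed
      finally show ?thesis using G by (simp add: C_def divide_right_mono)
    qed
    have "(\<integral>\<^sup>+t. ennreal (indicator {0<..} t * (h t / Gamma q)) \<partial>lborel)
      \<le> (\<integral>\<^sup>+t. ennreal (C * exp 1) * ennreal (indicator {0<..} t * (t powr (a - 1) * exp (- 1 * t))) + ennreal C * ennreal (indicator {1..} t * t powr (a - 2)) \<partial>lborel)"
    proof (rule nn_integral_mono)
      fix t :: real
      consider "t \<le> 0" | "0 < t" "t < 1" | "t \<ge> 1" by linarith
      then show "ennreal (indicator {0<..} t * (h t / Gamma q)) \<le> ennreal (C * exp 1) * ennreal (indicator {0<..} t * (t powr (a - 1) * exp (- 1 * t))) + ennreal C * ennreal (indicator {1..} t * t powr (a - 2))"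
      proof cases
        case 2
        then show ?thesis using ht[of t] C by (simp add: ennreal_mult'[symmetric] mult_ac)
      next
        case 3
        have "ennreal (h t / Gamma q) \<le> ennreal C * ennreal (t powr (a - 2))"
          using ht2[OF 3] C by (simp add: ennreal_mult'[symmetric] ennreal_leI)
        then show ?thesis using 3 by (simp add: add_increasing)
      qed simp
    qed
    also have "\<dots> = ennreal (C * exp 1) * (\<integral>\<^sup>+t. ennreal (indicator {0<..} t * (t powr (a - 1) * exp (- 1 * t))) \<partial>lborel) + ennreal C * (\<integral>\<^sup>+t. ennreal (indicator {1..} t * t powr (a - 2)) \<partial>lborel)"
      by (simp add: nn_integral_add nn_integral_cmult)
    also have "\<dots> < \<infinity>"
    proof -
      have "((\<lambda>t. t powr (a - 2)) has_integral - (1 powr (a - 2 + 1)) / (a - 2 + 1)) {1..}"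
        using a by (intro has_integral_powr_to_inf) auto
      then have "(\<integral>\<^sup>+t. ennreal (indicator {1..} t * t powr (a - 2)) \<partial>lborel) = ennreal (- (1 powr (a - 2 + 1)) / (a - 2 + 1))"
        by (rule nn_integral_has_integral_lebesgue[rotated]) simp
      then show ?thesis using nn_integral_powr_exp[OF a(1), of 1]
        by (simp add: ennreal_mult_less_top)
    qed
    finally show ?thesis .
  qed
  finally show "(\<integral>\<^sup>+y. ennreal (min 1 ((norm (y::'a))\<^sup>2) * norm y powr (- (?N + 2 * a))) \<partial>lborel) < \<infinity>" .
qed auto

lemma integrable_kernel_tail:
  fixes a r :: real
  assumes a: "0 < a" and r: "r > 0"
  shows "integrable lborel (\<lambda>y::'a::euclidean_space. indicator {y. r \<le> norm y} y * norm y powr (- (DIM('a) + 2 * a)))"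
proof -
  \<comment> \<open>\<open>integrable_truncated_kernel\<close> requires an exponent below 1. Since
    |y| \<ge> r, lowering a to b costs only the factor r^(2b-2a), and min 1 (r^2) bounds the
    truncation factor from below.\<close>
  define b where "b = min a (1/2)"
  define C where "C = r powr (2 * b - 2 * a) / min 1 (r\<^sup>2)"
  have b: "0 < b" "b < 1" "b \<le> a" using a by (auto simp: b_def)
  show ?thesis
  proof (rule Bochner_Integration.integrable_bound)
    show "integrable lborel (\<lambda>y::'a. C * (min 1 ((norm y)\<^sup>2) * norm y powr (- (DIM('a) + 2 * b))))"
      by (intro integrable_mult_right integrable_truncated_kernel b)
    have "norm y powr (- (DIM('a) + 2 * a)) \<le> C * (min 1 ((norm y)\<^sup>2) * norm y powr (- (DIM('a) + 2 * b)))"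
      if "r \<le> norm y" for y :: 'a
    proof -
      have "norm y powr (- (DIM('a) + 2 * a)) = norm y powr (2 * b - 2 * a) * norm y powr (- (DIM('a) + 2 * b))"
        by (simp add: powr_add[symmetric] algebra_simps)
      also have "\<dots> \<le> r powr (2 * b - 2 * a) * norm y powr (- (DIM('a) + 2 * b))"
        using that r b by (intro mult_right_mono powr_mono2') auto
      also have "\<dots> = C * (min 1 (r\<^sup>2) * norm y powr (- (DIM('a) + 2 * b)))"
        using r by (simp add: C_def min_def)
      also have "\<dots> \<le> C * (min 1 ((norm y)\<^sup>2) * norm y powr (- (DIM('a) + 2 * b)))"
      proof -
        have "r\<^sup>2 \<le> (norm y)\<^sup>2" using that r by (intro power_mono) auto
        then show ?thesis using r by (intro mult_left_mono mult_right_mono) (auto simp: C_def min_le_iff_disj)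
      qed
      finally show ?thesis .
    qed
    moreover have "0 \<le> C" using r by (simp add: C_def)
    ultimately show "AE y::'a in lborel. norm (indicator {y. r \<le> norm y} y * norm y powr (- (DIM('a) + 2 * a))) \<le> norm (C * (min 1 ((norm y)\<^sup>2) * norm y powr (- (DIM('a) + 2 * b))))"
      by (intro AE_I2) (auto simp: indicator_def)
  qed auto
qed

lemma integrable_powr_weight:
  fixes s \<tau> :: real
  assumes \<tau>: "- real DIM('a) < \<tau>" "\<tau> < 2 * s"
  shows "integrable lborel (\<lambda>z::'a::euclidean_space. norm z powr \<tau> / (1 + norm z powr (DIM('a) + 2 * s)))"
proof -
  let ?N = "real DIM('a)"
  \<comment> \<open>Near 0 the power |z|^\<tau> has to be bounded by |z|^(2-N-2a), which asks for 2
    - N - 2a \<le> \<tau>; this is compatible with a < 1 exactly because \<tau> > -N.\<close>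
  define a where "a = max (1/2) ((2 - ?N - \<tau>) / 2)"
  have a: "0 < a" "a < 1" "2 - ?N - 2 * a \<le> \<tau>" using \<tau> by (auto simp: a_def max_def field_simps)
  show ?thesis
  proof (rule Bochner_Integration.integrable_bound)
    show "integrable lborel (\<lambda>z::'a. min 1 ((norm z)\<^sup>2) * norm z powr (- (?N + 2 * a)) + indicator {y. 1 \<le> norm y} z * norm z powr (- (?N + 2 * (s - \<tau> / 2))))"
      using \<tau> by (intro Bochner_Integration.integrable_add integrable_truncated_kernel integrable_kernel_tail a) auto
    have "norm z powr \<tau> / (1 + norm z powr (?N + 2 * s)) \<le> min 1 ((norm z)\<^sup>2) * norm z powr (- (?N + 2 * a)) + indicator {y. 1 \<le> norm y} z * norm z powr (- (?N + 2 * (s - \<tau> / 2)))"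
      for z :: 'a
    proof -
      consider "z = 0" | "z \<noteq> 0" "norm z < 1" | "1 \<le> norm z" by fastforce
      then show ?thesis
      proof cases
        case 2
        have "norm z powr \<tau> / (1 + norm z powr (?N + 2 * s)) \<le> norm z powr \<tau> / 1"
          by (intro divide_left_mono) (auto intro!: add_pos_nonneg)
        also have "\<dots> \<le> norm z powr (2 - ?N - 2 * a)"
          using 2 a by (simp add: powr_mono')
        also have "\<dots> = (norm z)\<^sup>2 * norm z powr (- (?N + 2 * a))"
          using 2 by (simp add: powr_add[symmetric] algebra_simps flip: powr_numeral)
        finally have "norm z powr \<tau> / (1 + norm z powr (?N + 2 * s)) \<le> (norm z)\<^sup>2 * norm z powr (- (?N + 2 * a))" .
        moreover have "min 1 ((norm z)\<^sup>2) = (norm z)\<^sup>2" using 2 by (simp add: min_absorb2 power_le_one)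
        ultimately show ?thesis using 2 by simp
      next
        case 3
        have "norm z powr \<tau> / (1 + norm z powr (?N + 2 * s)) \<le> norm z powr \<tau> / norm z powr (?N + 2 * s)"
          using 3 by (intro divide_left_mono) (auto intro!: mult_pos_pos add_pos_nonneg)
        also have "\<dots> = norm z powr (- (?N + 2 * (s - \<tau> / 2)))"
          by (simp add: powr_diff[symmetric] algebra_simps)
        finally show ?thesis using 3 by (simp add: add_increasing)
      qed simp
    qed
    then show "AE z::'a in lborel. norm (norm z powr \<tau> / (1 + norm z powr (?N + 2 * s))) \<le> norm (min 1 ((norm z)\<^sup>2) * norm z powr (- (?N + 2 * a)) + indicator {y. 1 \<le> norm y} z * norm z powr (- (?N + 2 * (s - \<tau> / 2))))"
      by (intro AE_I2) (auto simp: abs_of_nonneg add_nonneg_nonneg)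
  qed auto
qed

section \<open>The truncated fractional Laplacian on weighted integrable functions\<close>

text \<open>The weighted integral only sees the absolute value of u. Measurability of u itself comes
  from integrability on compact sets, through its restrictions to growing balls.\<close>

lemma L1s_borel_measurable:
  fixes s :: real
  assumes "u \<in> L1s s"
  shows "u \<in> borel_measurable lebesgue"
proof (rule borel_measurable_LIMSEQ_metric)
  fix n :: nat
  have "set_integrable lebesgue (cball 0 (real n)) u"
    using assms by (simp add: L1s_def L1_loc_def)
  then show "(\<lambda>x. indicator (cball 0 (real n)) x *\<^sub>R u x) \<in> borel_measurable lebesgue"
    unfolding set_integrable_def by (rule borel_measurable_integrable)
next
  fix x :: 'a
  have "\<forall>\<^sub>F n in sequentially. norm x \<le> real n"
    using filterlim_real_sequentially by (simp add: filterlim_at_top)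
  then have "\<forall>\<^sub>F n in sequentially. indicator (cball 0 (real n)) x *\<^sub>R u x = u x"
    by eventually_elim simp
  then show "(\<lambda>n. indicator (cball 0 (real n)) x *\<^sub>R u x) \<longlonglongrightarrow> u x"
    by (rule tendsto_eventually)
qed

text \<open>Away from x the kernel centred at x is controlled by the weight of \<open>L1s\<close>,
  which is centred at the origin, because |z| \<le> (|x| / \<epsilon> + 1) |x - z| as soon as |x -
  z| \<ge> \<epsilon>.\<close>

lemma one_plus_norm_powr_le:
  fixes x z :: "'a::real_normed_vector" and q \<epsilon> :: real
  assumes "q > 0" "\<epsilon> > 0" "\<epsilon> \<le> norm (x - z)"
  shows "1 + norm z powr q \<le> (\<epsilon> powr (- q) + (norm x / \<epsilon> + 1) powr q) * norm (x - z) powr q"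
proof -
  have "norm z \<le> norm x + norm (x - z)"
    by (metis norm_triangle_sub norm_minus_commute)
  also have "norm x \<le> norm x / \<epsilon> * norm (x - z)"
    using assms mult_left_mono[of \<epsilon> "norm (x - z)" "norm x / \<epsilon>"] by simp
  finally have "norm z \<le> (norm x / \<epsilon> + 1) * norm (x - z)"
    by (simp add: distrib_right)
  then have "norm z powr q \<le> ((norm x / \<epsilon> + 1) * norm (x - z)) powr q"
    using assms by (intro powr_mono2) auto
  also have "\<dots> = (norm x / \<epsilon> + 1) powr q * norm (x - z) powr q"
    using assms by (intro powr_mult)
  finally have "norm z powr q \<le> (norm x / \<epsilon> + 1) powr q * norm (x - z) powr q" .
  moreover have "1 = \<epsilon> powr (- q) * \<epsilon> powr q"
    using assms by (simp add: powr_minus)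
  moreover have "\<epsilon> powr (- q) * \<epsilon> powr q \<le> \<epsilon> powr (- q) * norm (x - z) powr q"
    using assms by (intro mult_left_mono powr_mono2) auto
  ultimately show ?thesis
    using assms by (simp add: distrib_right)
qed

lemma L1s_set_integrable_tail:
  fixes u :: "'a::euclidean_space \<Rightarrow> real" and s \<epsilon> c :: real
  assumes u: "u \<in> L1s s" and s: "s > 0" and e: "\<epsilon> > 0"
  shows "set_integrable lebesgue (- ball x \<epsilon>) (\<lambda>z. u z / norm (x - z) powr (DIM('a) + 2 * s))"
proof -
  let ?q = "real DIM('a) + 2 * s"
  define C where "C = \<epsilon> powr (- ?q) + (norm x / \<epsilon> + 1) powr ?q"
  have C: "C \<ge> 0" by (simp add: C_def)
  note L1s_borel_measurable[OF u, measurable]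
  show ?thesis
    unfolding set_integrable_def
  proof (rule Bochner_Integration.integrable_bound)
    show "integrable lebesgue (\<lambda>z. C * (\<bar>u z\<bar> / (1 + norm z powr ?q)))"
      using u by (intro integrable_mult_right) (simp add: L1s_def)
    show "AE z in lebesgue. norm (indicator (- ball x \<epsilon>) z *\<^sub>R (u z / norm (x - z) powr ?q))
      \<le> norm (C * (\<bar>u z\<bar> / (1 + norm z powr ?q)))"
    proof (rule AE_I2)
      fix z :: 'a
      show "norm (indicator (- ball x \<epsilon>) z *\<^sub>R (u z / norm (x - z) powr ?q))
        \<le> norm (C * (\<bar>u z\<bar> / (1 + norm z powr ?q)))"
      proof (cases "z \<in> ball x \<epsilon>")
        case False
        then have z: "\<epsilon> \<le> norm (x - z)" by (simp add: dist_norm)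
        have 1: "1 + norm z powr ?q \<le> C * norm (x - z) powr ?q"
          unfolding C_def using s e z by (intro one_plus_norm_powr_le) (auto intro: add_nonneg_pos)
        have 2: "0 < norm (x - z) powr ?q" using e z by auto
        have 3: "0 < 1 + norm z powr ?q" by (auto intro!: add_pos_nonneg)
        have "\<bar>u z\<bar> / norm (x - z) powr ?q \<le> C * (\<bar>u z\<bar> / (1 + norm z powr ?q))"
          using mult_left_mono[OF 1, of "\<bar>u z\<bar>"] 2 3 by (simp add: field_simps)
        then show ?thesis using False C 3 by (simp add: abs_mult)
      qed (use C in simp)
    qed
    have [measurable]: "(\<lambda>z. norm (x - z) powr ?q) \<in> borel_measurable lebesgue"
      by (rule measurable_completion) measurable
    have [measurable]: "ball x \<epsilon> \<in> sets lebesgue" by simp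
    show "(\<lambda>z. indicator (- ball x \<epsilon>) z *\<^sub>R (u z / norm (x - z) powr ?q)) \<in> borel_measurable lebesgue"
      by measurable
  qed
qed

lemma powr_L1s:
  fixes s \<tau> :: real
  assumes \<tau>: "- real DIM('a::euclidean_space) < \<tau>" "\<tau> < 2 * s" and s: "s > 0"
  shows "(\<lambda>z::'a. norm z powr \<tau>) \<in> L1s s"
proof -
  let ?q = "real DIM('a) + 2 * s"
  have 1: "integrable lebesgue (\<lambda>z::'a. \<bar>norm z powr \<tau>\<bar> / (1 + norm z powr ?q))"
    using integrable_powr_weight[OF \<tau>] by (subst integrable_completion) auto
  have "set_integrable lebesgue K (\<lambda>z::'a. norm z powr \<tau>)" if K: "compact K" for K
  proof -
    obtain B where B: "\<And>z. z \<in> K \<Longrightarrow> norm z \<le> B" and B0: "B > 0"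
      using compact_imp_bounded[OF K] by (auto simp: bounded_pos)
    have [measurable]: "K \<in> sets lebesgue" using K by (intro lmeasurable_compact fmeasurableD)
    show ?thesis
      unfolding set_integrable_def
    proof (rule Bochner_Integration.integrable_bound)
      show "integrable lebesgue (\<lambda>z::'a. (1 + B powr ?q) * (\<bar>norm z powr \<tau>\<bar> / (1 + norm z powr ?q)))"
        by (intro integrable_mult_right 1)
      have "norm z powr \<tau> \<le> (1 + B powr ?q) * (\<bar>norm z powr \<tau>\<bar> / (1 + norm z powr ?q))" if "z \<in> K" for z
      proof -
        have "norm z powr ?q \<le> B powr ?q"
          using B[OF that] s by (intro powr_mono2) auto
        then have "norm z powr \<tau> * (1 + norm z powr ?q) \<le> norm z powr \<tau> * (1 + B powr ?q)"
          by (intro mult_left_mono) auto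
        moreover have "0 < 1 + norm z powr ?q" by (auto intro!: add_pos_nonneg)
        ultimately show ?thesis by (simp add: field_simps)
      qed
      then show "AE z::'a in lebesgue. norm (indicator K z *\<^sub>R norm z powr \<tau>) \<le> norm ((1 + B powr ?q) * (\<bar>norm z powr \<tau>\<bar> / (1 + norm z powr ?q)))"
        by (intro AE_I2) (auto simp: indicator_def abs_mult abs_of_nonneg add_nonneg_nonneg)
      have "(\<lambda>z::'a. norm z powr \<tau>) \<in> borel_measurable lebesgue"
        by (rule measurable_completion) measurable
      then show "(\<lambda>z::'a. indicator K z *\<^sub>R norm z powr \<tau>) \<in> borel_measurable lebesgue"
        by measurable
    qed
  qed
  then show ?thesis using 1 by (simp add: L1s_def L1_loc_def)
qed

lemma const_L1s:
  fixes s c :: real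
  assumes "s > 0"
  shows "(\<lambda>z::'a::euclidean_space. c) \<in> L1s s"
proof -
  \<comment> \<open>\<open>norm z powr 0\<close> is 1 except at the origin, where
    \<open>powr\<close> gives 0, so it represents the constant only almost everywhere.\<close>
  have p: "(\<lambda>z::'a. norm z powr 0) \<in> L1s s" using assms by (intro powr_L1s) auto
  have ae: "AE z::'a in lebesgue. z \<noteq> 0"
    using AE_lborel_singleton by (rule AE_completion)
  have 1: "integrable lebesgue (\<lambda>z::'a. \<bar>c\<bar> / (1 + norm z powr (DIM('a) + 2 * s)))"
  proof -
    have "integrable lebesgue (\<lambda>z::'a. \<bar>c\<bar> * (\<bar>norm z powr 0\<bar> / (1 + norm z powr (DIM('a) + 2 * s))))"
      using p by (intro integrable_mult_right) (simp add: L1s_def)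
    then show ?thesis
    proof (rule integrable_cong_AE_imp)
      show "(\<lambda>z::'a. \<bar>c\<bar> / (1 + norm z powr (DIM('a) + 2 * s))) \<in> borel_measurable lebesgue"
        by (rule measurable_completion) measurable
      show "AE z::'a in lebesgue. \<bar>c\<bar> * (\<bar>norm z powr 0\<bar> / (1 + norm z powr (DIM('a) + 2 * s))) = \<bar>c\<bar> / (1 + norm z powr (DIM('a) + 2 * s))"
        using ae by eventually_elim simp
    qed
  qed
  have "set_integrable lebesgue K (\<lambda>z::'a. c)" if "compact K" for K
    using lmeasurable_compact[OF that]
    unfolding set_integrable_def by (intro integrable_scaleR_left integrable_real_indicator) (auto simp: fmeasurable_def)
  then show ?thesis using 1 by (simp add: L1s_def L1_loc_def)
qed

lemma L1s_cmult:
  fixes s c :: real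
  assumes "u \<in> L1s s"
  shows "(\<lambda>z. c * u z) \<in> L1s s"
proof -
  have "integrable lebesgue (\<lambda>x. \<bar>c\<bar> * (\<bar>u x\<bar> / (1 + norm x powr (DIM('a) + 2 * s))))"
    using assms by (intro integrable_mult_right) (simp add: L1s_def)
  then show ?thesis
    using assms by (auto simp: L1s_def L1_loc_def abs_mult intro!: set_integrable_mult_right)
qed

lemma L1s_add:
  fixes u v :: "'a::euclidean_space \<Rightarrow> real" and s \<epsilon> a b d :: real
  assumes u: "u \<in> L1s s" and v: "v \<in> L1s s"
  shows "(\<lambda>z. u z + v z) \<in> L1s s"
proof -
  note L1s_borel_measurable[OF u, measurable] L1s_borel_measurable[OF v, measurable]
  have "integrable lebesgue (\<lambda>x. \<bar>u x + v x\<bar> / (1 + norm x powr (DIM('a) + 2 * s)))"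
  proof (rule Bochner_Integration.integrable_bound)
    show "integrable lebesgue (\<lambda>x. \<bar>u x\<bar> / (1 + norm x powr (DIM('a) + 2 * s)) + \<bar>v x\<bar> / (1 + norm x powr (DIM('a) + 2 * s)))"
      using u v by (intro Bochner_Integration.integrable_add) (auto simp: L1s_def)
    show "AE x in lebesgue. norm (\<bar>u x + v x\<bar> / (1 + norm x powr (DIM('a) + 2 * s)))
      \<le> norm (\<bar>u x\<bar> / (1 + norm x powr (DIM('a) + 2 * s)) + \<bar>v x\<bar> / (1 + norm x powr (DIM('a) + 2 * s)))"
    proof (rule AE_I2)
      fix x :: 'a
      have "0 < 1 + norm x powr (DIM('a) + 2 * s)" by (auto intro!: add_pos_nonneg)
      then show "norm (\<bar>u x + v x\<bar> / (1 + norm x powr (DIM('a) + 2 * s)))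
        \<le> norm (\<bar>u x\<bar> / (1 + norm x powr (DIM('a) + 2 * s)) + \<bar>v x\<bar> / (1 + norm x powr (DIM('a) + 2 * s)))"
        by (simp add: add_divide_distrib[symmetric] divide_right_mono)
    qed
    have "(\<lambda>x::'a. norm x powr (DIM('a) + 2 * s)) \<in> borel_measurable lebesgue"
      by (rule measurable_completion) measurable
    then show "(\<lambda>x. \<bar>u x + v x\<bar> / (1 + norm x powr (DIM('a) + 2 * s))) \<in> borel_measurable lebesgue"
      by measurable
  qed
  moreover have "set_integrable lebesgue K (\<lambda>z. u z + v z)" if "compact K" for K
    using u v that by (intro set_integral_add) (auto simp: L1s_def L1_loc_def)
  ultimately show ?thesis by (simp add: L1s_def L1_loc_def)
qed

lemma frac_const_pos:
  fixes s :: real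
  assumes "0 < s" "s < 1"
  shows "frac_const N s > 0"
  using assms by (auto simp: frac_const_def intro!: mult_pos_pos divide_pos_pos Gamma_real_pos add_nonneg_pos)

lemma set_integrable_frac_quotient:
  fixes u :: "'a::euclidean_space \<Rightarrow> real" and s \<epsilon> c :: real
  assumes u: "u \<in> L1s s" and s: "s > 0" and e: "\<epsilon> > 0"
  shows "set_integrable lebesgue (- ball x \<epsilon>) (\<lambda>z. (c - u z) / norm (x - z) powr (DIM('a) + 2 * s))"
  unfolding diff_divide_distrib
  by (intro set_integral_diff L1s_set_integrable_tail const_L1s assms)

text \<open>Touching from below enlarges every difference quotient at x. The order is asked only
  almost everywhere because nothing is known about values at the origin.\<close>

lemma truncated_frac_laplacian_mono:
  fixes u \<phi> :: "'a::euclidean_space \<Rightarrow> real" and s \<epsilon> :: real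
  assumes s: "0 < s" "s < 1" and e: "\<epsilon> > 0"
    and u: "u \<in> L1s s" and \<phi>: "\<phi> \<in> L1s s"
    and le: "AE z in lebesgue. \<phi> z \<le> u z" and eq: "\<phi> x = u x"
  shows "truncated_frac_laplacian s u x \<epsilon> \<le> truncated_frac_laplacian s \<phi> x \<epsilon>"
  unfolding truncated_frac_laplacian_def
proof (intro mult_left_mono set_integral_mono_AE)
  show "AE z\<in>- ball x \<epsilon> in lebesgue. (u x - u z) / norm (x - z) powr (DIM('a) + 2 * s)
    \<le> (\<phi> x - \<phi> z) / norm (x - z) powr (DIM('a) + 2 * s)"
    using le by eventually_elim (auto simp: eq intro!: divide_right_mono)
qed (use frac_const_pos[OF s] in \<open>auto simp: less_imp_le intro!: set_integrable_frac_quotient u \<phi> s e\<close>)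

lemma truncated_frac_laplacian_linear:
  fixes u v :: "'a::euclidean_space \<Rightarrow> real" and s \<epsilon> a b d :: real
  assumes s: "0 < s" and e: "\<epsilon> > 0" and u: "u \<in> L1s s" and v: "v \<in> L1s s"
  shows "truncated_frac_laplacian s (\<lambda>z. a * u z + b * v z + d) x \<epsilon>
    = a * truncated_frac_laplacian s u x \<epsilon> + b * truncated_frac_laplacian s v x \<epsilon>"
proof -
  let ?q = "real DIM('a) + 2 * s"
  have "(LINT z:- ball x \<epsilon>|lebesgue. (a * u x + b * v x + d - (a * u z + b * v z + d)) / norm (x - z) powr ?q)
    = (LINT z:- ball x \<epsilon>|lebesgue. a * ((u x - u z) / norm (x - z) powr ?q) + b * ((v x - v z) / norm (x - z) powr ?q))"
    by (intro arg_cong[where f = "\<lambda>f. set_lebesgue_integral lebesgue (- ball x \<epsilon>) f"] ext)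
       (simp add: add_divide_distrib[symmetric] algebra_simps)
  also have "\<dots> = a * (LINT z:- ball x \<epsilon>|lebesgue. (u x - u z) / norm (x - z) powr ?q) + b * (LINT z:- ball x \<epsilon>|lebesgue. (v x - v z) / norm (x - z) powr ?q)"
    by (subst set_integral_add(2)[OF set_integrable_mult_right[OF set_integrable_frac_quotient[OF u s e]] set_integrable_mult_right[OF set_integrable_frac_quotient[OF v s e]]])
       (simp only: set_integral_mult_right)
  finally show ?thesis by (simp add: truncated_frac_laplacian_def algebra_simps)
qed

section \<open>The fractional Laplacian of a power\<close>

text \<open>An increment written as the integral of its derivative, so that the regularised Beta
  integral below can be integrated by parts through Tonelli. Beyond 1 the integrand vanishes since
  \<open>0 powr (c - 1)\<close> is 0, so only min v 1 counts.\<close>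

lemma nn_integral_one_minus_powr:
  fixes c v :: real
  assumes c: "c > 0" and v: "v > 0"
  shows "(\<integral>\<^sup>+y. ennreal (indicator {0<..<v} y * (c * max 0 (1 - y) powr (c - 1))) \<partial>lborel)
    = ennreal (1 - max 0 (1 - v) powr c)"
proof -
  define m where "m = min v 1"
  have m: "0 < m" "m \<le> 1" "max 0 (1 - v) = 1 - m" using v by (auto simp: m_def)
  have "((\<lambda>y. c * (1 - y) powr (c - 1)) has_integral (- ((1 - m) powr c)) - (- ((1 - 0) powr c))) {0..m}"
  proof (rule fundamental_theorem_of_calculus_interior)
    show "continuous_on {0..m} (\<lambda>y. - ((1 - y) powr c))"
      using c m by (intro continuous_intros continuous_on_powr') auto
    fix y assume "y \<in> {0<..<m}"
    then have "y < 1" using m by auto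
    then have "((\<lambda>y. - ((1 - y) powr c)) has_real_derivative c * (1 - y) powr (c - 1)) (at y)"
      by (auto intro!: derivative_eq_intros simp: powr_diff field_simps)
    then show "((\<lambda>y. - ((1 - y) powr c)) has_vector_derivative c * (1 - y) powr (c - 1)) (at y)"
      by (simp add: has_real_derivative_iff_has_vector_derivative)
  qed (use m in auto)
  then have "((\<lambda>y. c * (1 - y) powr (c - 1)) has_integral 1 - (1 - m) powr c) {0<..<m}"
    by (simp add: has_integral_Icc_iff_Ioo)
  then have "(\<integral>\<^sup>+y. ennreal (indicator {0<..<m} y * (c * (1 - y) powr (c - 1))) \<partial>lborel) = ennreal (1 - (1 - m) powr c)"
    by (rule nn_integral_has_integral_lebesgue[rotated]) (use c in simp)
  moreover have "indicator {0<..<v} y * (c * max 0 (1 - y) powr (c - 1)) = indicator {0<..<m} y * (c * (1 - y) powr (c - 1))" for y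
    by (auto simp: indicator_def m_def max_def)
  ultimately show ?thesis by (simp only: m)
qed

lemma nn_integral_beta:
  fixes a c :: real
  assumes "a > 0" "c > 0"
  shows "(\<integral>\<^sup>+v. ennreal (indicator {0<..} v * (v powr (a - 1) * max 0 (1 - v) powr (c - 1))) \<partial>lborel) = ennreal (Beta a c)"
proof -
  have "(\<integral>\<^sup>+v. ennreal (indicator {0..1} v * (v powr (a - 1) * (1 - v) powr (c - 1))) \<partial>lborel) = ennreal (Beta a c)"
    by (rule nn_integral_has_integral_lebesgue[OF _ has_integral_Beta_real[OF assms]]) simp
  moreover have "indicator {0..1} v * (v powr (a - 1) * (1 - v) powr (c - 1)) = indicator {0<..} v * (v powr (a - 1) * max 0 (1 - v) powr (c - 1))" for v :: real
    by (auto simp: indicator_def max_def)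
  ultimately show ?thesis by simp
qed

text \<open>v^(-s-1) is not integrable at 0, and subtracting from 1 supplies the missing factor of
  order v. Swapping the integrals over 0 < y < v leaves y^(-s) / s from the integration in v, hence
  an ordinary Beta integral. The value is minus the analytic continuation of Beta at (-s, c +
  1).\<close>

lemma nn_integral_beta_regularised:
  fixes s c :: real
  assumes s: "0 < s" "s < 1" and c: "c > 0"
  shows "(\<integral>\<^sup>+v. ennreal (indicator {0<..} v * (v powr (- s - 1) * (1 - max 0 (1 - v) powr c))) \<partial>lborel)
    = ennreal (c / s * Beta (1 - s) c)"
proof -
  have "(\<integral>\<^sup>+v. ennreal (indicator {0<..} v * (v powr (- s - 1) * (1 - max 0 (1 - v) powr c))) \<partial>lborel)
    = (\<integral>\<^sup>+v. \<integral>\<^sup>+y. ennreal (indicator {0<..} v * v powr (- s - 1)) * ennreal (indicator {0<..<v} y * (c * max 0 (1 - y) powr (c - 1))) \<partial>lborel \<partial>lborel)"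
  proof (rule nn_integral_cong)
    fix v :: real
    show "ennreal (indicator {0<..} v * (v powr (- s - 1) * (1 - max 0 (1 - v) powr c)))
      = (\<integral>\<^sup>+y. ennreal (indicator {0<..} v * v powr (- s - 1)) * ennreal (indicator {0<..<v} y * (c * max 0 (1 - y) powr (c - 1))) \<partial>lborel)"
    proof (cases "v > 0")
      case True
      have "(\<integral>\<^sup>+y. ennreal (indicator {0<..} v * v powr (- s - 1)) * ennreal (indicator {0<..<v} y * (c * max 0 (1 - y) powr (c - 1))) \<partial>lborel)
        = ennreal (indicator {0<..} v * v powr (- s - 1)) * ennreal (1 - max 0 (1 - v) powr c)"
        unfolding nn_integral_one_minus_powr[OF c True, symmetric] by (rule nn_integral_cmult) measurable
      then show ?thesis using True by (simp add: ennreal_mult')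
    qed simp
  qed
  also have "\<dots> = (\<integral>\<^sup>+y. \<integral>\<^sup>+v. ennreal (indicator {0<..} v * v powr (- s - 1)) * ennreal (indicator {0<..<v} y * (c * max 0 (1 - y) powr (c - 1))) \<partial>lborel \<partial>lborel)"
    unfolding indicator_def of_bool_def greaterThanLessThan_iff by (intro lborel_pair.Fubini') measurable
  also have "\<dots> = (\<integral>\<^sup>+y. ennreal (c / s) * ennreal (indicator {0<..} y * (y powr ((1 - s) - 1) * max 0 (1 - y) powr (c - 1))) \<partial>lborel)"
  proof (rule nn_integral_cong)
    fix y :: real
    show "(\<integral>\<^sup>+v. ennreal (indicator {0<..} v * v powr (- s - 1)) * ennreal (indicator {0<..<v} y * (c * max 0 (1 - y) powr (c - 1))) \<partial>lborel)
      = ennreal (c / s) * ennreal (indicator {0<..} y * (y powr ((1 - s) - 1) * max 0 (1 - y) powr (c - 1)))"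
    proof (cases "y > 0")
      case True
      have "((\<lambda>v. v powr (- s - 1)) has_integral - (y powr (- s - 1 + 1)) / (- s - 1 + 1)) {y..}"
        using s True by (intro has_integral_powr_to_inf) auto
      then have "((\<lambda>v. v powr (- s - 1)) has_integral y powr (- s) / s) {y..}"
        by simp
      then have I: "(\<integral>\<^sup>+v. ennreal (indicator {y..} v * v powr (- s - 1)) \<partial>lborel) = ennreal (y powr (- s) / s)"
        by (rule nn_integral_has_integral_lebesgue[rotated]) simp
      have "(\<integral>\<^sup>+v. ennreal (indicator {0<..} v * v powr (- s - 1)) * ennreal (indicator {0<..<v} y * (c * max 0 (1 - y) powr (c - 1))) \<partial>lborel)
        = (\<integral>\<^sup>+v. ennreal (c * max 0 (1 - y) powr (c - 1)) * ennreal (indicator {y..} v * v powr (- s - 1)) \<partial>lborel)"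
      proof (rule nn_integral_cong_AE)
        show "AE v in lborel. ennreal (indicator {0<..} v * v powr (- s - 1)) * ennreal (indicator {0<..<v} y * (c * max 0 (1 - y) powr (c - 1)))
          = ennreal (c * max 0 (1 - y) powr (c - 1)) * ennreal (indicator {y..} v * v powr (- s - 1))"
          using AE_lborel_singleton[of y] by eventually_elim (use True in \<open>auto simp: indicator_def mult.commute\<close>)
      qed
      also have "\<dots> = ennreal (c * max 0 (1 - y) powr (c - 1)) * ennreal (y powr (- s) / s)"
        unfolding I[symmetric] by (rule nn_integral_cmult) measurable
      finally show ?thesis
        using True c s by (simp add: ennreal_mult'[symmetric] mult_ac)
    qed (simp add: indicator_def)
  qed
  also have "\<dots> = ennreal (c / s) * ennreal (Beta (1 - s) c)"
    unfolding nn_integral_beta[OF _ c, of "1 - s", symmetric, simplified diff_gt_0_iff_gt, OF s(2)] by (rule nn_integral_cmult) measurable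
  finally show ?thesis using s c by (simp add: ennreal_mult'[symmetric])
qed

section \<open>Gaussian averages of a power\<close>

text \<open>Writing |z|^\<tau> = |z|^2 |z|^(\<tau> - 2) and only the second factor as a superposition of Gaussians keeps
  every integrand nonnegative, uniformly in the sign of \<tau>.\<close>

lemma nn_integral_gaussian_powr:
  fixes x :: "'a::euclidean_space" and \<tau> t :: real
  assumes \<tau>: "- real DIM('a) < \<tau>" "\<tau> < 2" and t: "t > 0"
  defines "q \<equiv> real DIM('a) / 2" and "R \<equiv> (norm x)\<^sup>2"
  shows "(\<integral>\<^sup>+z. ennreal (norm z powr \<tau> * exp (- t * (norm (z - x))\<^sup>2)) \<partial>lborel)
    = ennreal (1 / Gamma (1 - \<tau> / 2)) * (\<integral>\<^sup>+l. ennreal (indicator {0<..} l * (l powr (- \<tau> / 2)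
       * ((pi / (l + t)) powr q * exp (- (l * t / (l + t)) * R) * (q / (l + t) + t\<^sup>2 / (l + t)\<^sup>2 * R)))) \<partial>lborel)"
proof -
  define g where "g = Gamma (1 - \<tau> / 2)"
  have g: "g > 0" unfolding g_def using \<tau> by (intro Gamma_real_pos) auto
  have "(\<integral>\<^sup>+z. ennreal (norm z powr \<tau> * exp (- t * (norm (z - x))\<^sup>2)) \<partial>lborel)
    = (\<integral>\<^sup>+z. \<integral>\<^sup>+l. ennreal ((norm z)\<^sup>2 * exp (- t * (norm (z - x))\<^sup>2) / g) * ennreal (indicator {0<..} l * (l powr (1 - \<tau> / 2 - 1) * exp (- (norm z)\<^sup>2 * l))) \<partial>lborel \<partial>lborel)"
  proof (rule nn_integral_cong)
    fix z :: 'a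
    have "(\<integral>\<^sup>+l. ennreal ((norm z)\<^sup>2 * exp (- t * (norm (z - x))\<^sup>2) / g) * ennreal (indicator {0<..} l * (l powr (1 - \<tau> / 2 - 1) * exp (- (norm z)\<^sup>2 * l))) \<partial>lborel)
      = ennreal ((norm z)\<^sup>2 * exp (- t * (norm (z - x))\<^sup>2) / g) * (\<integral>\<^sup>+l. ennreal (indicator {0<..} l * (l powr (1 - \<tau> / 2 - 1) * exp (- (norm z)\<^sup>2 * l))) \<partial>lborel)"
      by (rule nn_integral_cmult) measurable
    also have "\<dots> = ennreal (norm z powr \<tau> * exp (- t * (norm (z - x))\<^sup>2))"
    proof (cases "z = 0")
      case False
      have "(norm z)\<^sup>2 * ((norm z)\<^sup>2) powr (- (1 - \<tau> / 2)) = norm z powr \<tau>"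
        using False by (simp add: powr_powr powr_add[symmetric] flip: powr_numeral)
      then have "(norm z)\<^sup>2 * exp (- t * (norm (z - x))\<^sup>2) / g * (g * ((norm z)\<^sup>2) powr (- (1 - \<tau> / 2))) = norm z powr \<tau> * exp (- t * (norm (z - x))\<^sup>2)"
        using g by (simp add: field_simps)
      then show ?thesis
        using \<tau> False g nn_integral_powr_exp[of "1 - \<tau> / 2" "(norm z)\<^sup>2"] by (simp add: g_def ennreal_mult'[symmetric])
    qed simp
    finally show "ennreal (norm z powr \<tau> * exp (- t * (norm (z - x))\<^sup>2)) = (\<integral>\<^sup>+l. ennreal ((norm z)\<^sup>2 * exp (- t * (norm (z - x))\<^sup>2) / g) * ennreal (indicator {0<..} l * (l powr (1 - \<tau> / 2 - 1) * exp (- (norm z)\<^sup>2 * l))) \<partial>lborel)" ..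
  qed
  also have "\<dots> = (\<integral>\<^sup>+l. \<integral>\<^sup>+z. ennreal ((norm z)\<^sup>2 * exp (- t * (norm (z - x))\<^sup>2) / g) * ennreal (indicator {0<..} l * (l powr (1 - \<tau> / 2 - 1) * exp (- (norm z)\<^sup>2 * l))) \<partial>lborel \<partial>lborel)"
    by (intro lborel_pair.Fubini') measurable
  also have "\<dots> = (\<integral>\<^sup>+l. ennreal (1 / g) * ennreal (indicator {0<..} l * (l powr (- \<tau> / 2)
       * ((pi / (l + t)) powr q * exp (- (l * t / (l + t)) * R) * (q / (l + t) + t\<^sup>2 / (l + t)\<^sup>2 * R)))) \<partial>lborel)"
  proof (rule nn_integral_cong)
    fix l :: real
    show "(\<integral>\<^sup>+z. ennreal ((norm z)\<^sup>2 * exp (- t * (norm (z - x))\<^sup>2) / g) * ennreal (indicator {0<..} l * (l powr (1 - \<tau> / 2 - 1) * exp (- (norm z)\<^sup>2 * l))) \<partial>lborel)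
      = ennreal (1 / g) * ennreal (indicator {0<..} l * (l powr (- \<tau> / 2)
       * ((pi / (l + t)) powr q * exp (- (l * t / (l + t)) * R) * (q / (l + t) + t\<^sup>2 / (l + t)\<^sup>2 * R))))"
    proof (cases "l > 0")
      case True
      have "(\<integral>\<^sup>+z. ennreal ((norm z)\<^sup>2 * exp (- t * (norm (z - x))\<^sup>2) / g) * ennreal (indicator {0<..} l * (l powr (1 - \<tau> / 2 - 1) * exp (- (norm z)\<^sup>2 * l))) \<partial>lborel)
        = (\<integral>\<^sup>+z. ennreal (1 / g * l powr (- \<tau> / 2)) * ennreal ((norm z)\<^sup>2 * exp (- l * (norm z)\<^sup>2) * exp (- t * (norm (z - x))\<^sup>2)) \<partial>lborel)"
        using True g by (intro nn_integral_cong) (simp add: ennreal_mult'[symmetric] mult_ac)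
      also have "\<dots> = ennreal (1 / g * l powr (- \<tau> / 2)) * (\<integral>\<^sup>+z. ennreal ((norm z)\<^sup>2 * exp (- l * (norm z)\<^sup>2) * exp (- t * (norm (z - x))\<^sup>2)) \<partial>lborel)"
        by (rule nn_integral_cmult) measurable
      also have "\<dots> = ennreal (1 / g * l powr (- \<tau> / 2) * ((pi / (l + t)) powr q * exp (- (l * t / (l + t)) * R) * (q / (l + t) + t\<^sup>2 / (l + t)\<^sup>2 * R)))"
        unfolding nn_integral_gaussian_product[OF True t]
        using g by (subst ennreal_mult'[symmetric]) (simp_all add: q_def R_def)
      finally show ?thesis
        using True g by (simp add: ennreal_mult'[symmetric])
    qed simp
  qed
  also have "\<dots> = ennreal (1 / g) * (\<integral>\<^sup>+l. ennreal (indicator {0<..} l * (l powr (- \<tau> / 2)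
       * ((pi / (l + t)) powr q * exp (- (l * t / (l + t)) * R) * (q / (l + t) + t\<^sup>2 / (l + t)\<^sup>2 * R)))) \<partial>lborel)"
    by (rule nn_integral_cmult) measurable
  finally show ?thesis unfolding g_def .
qed

text \<open>The map v to t v / (1 - v) is a bijection of (0, 1) onto the half-line with inverse l /
  (l + t). The change of variables is carried out for absolutely integrable functions, and
  nonnegativity of f turns both sides into nonnegative integrals.\<close>

lemma nn_integral_subst_ratio:
  fixes f :: "real \<Rightarrow> real" and t :: real
  assumes t: "t > 0" and f: "\<And>l. l > 0 \<Longrightarrow> f l \<ge> 0"
    and int: "(\<lambda>v. t / (1 - v)\<^sup>2 * f (t * v / (1 - v))) absolutely_integrable_on {0<..<1}"
  shows "(\<integral>\<^sup>+l. ennreal (indicator {0<..} l * f l) \<partial>lborel)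
    = (\<integral>\<^sup>+v. ennreal (indicator {0<..<1} v * (t / (1 - v)\<^sup>2 * f (t * v / (1 - v)))) \<partial>lborel)"
proof -
  define g where "g = (\<lambda>v::real. t * v / (1 - v))"
  define b where "b = integral {0<..<1} (\<lambda>v. t / (1 - v)\<^sup>2 * f (g v))"
  have der: "(g has_field_derivative t / (1 - v)\<^sup>2) (at v within {0<..<1})" if "v \<in> {0<..<1}" for v
    unfolding g_def using that by (auto intro!: derivative_eq_intros simp: field_simps power2_eq_square)
  have inj: "inj_on g {0<..<1}"
  proof (rule inj_onI)
    fix v w assume "v \<in> {0<..<1::real}" "w \<in> {0<..<1}" "g v = g w"
    then have "v * (1 - w) = w * (1 - v)" using t by (simp add: g_def field_simps)
    then show "v = w" by (simp add: algebra_simps)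
  qed
  have img: "g ` {0<..<1} = {0<..}"
  proof (intro equalityI subsetI)
    fix l :: real assume "l \<in> {0<..}"
    then have l: "l > 0" by simp
    have "1 - l / (l + t) = t / (l + t)" using l t by (simp add: field_simps)
    then have "l = g (l / (l + t))" using l t by (simp add: g_def)
    moreover have "l / (l + t) \<in> {0<..<1}" using l t by simp
    ultimately show "l \<in> g ` {0<..<1}" by blast
  qed (use t in \<open>auto simp: g_def\<close>)
  have eq: "\<bar>t / (1 - v)\<^sup>2\<bar> * f (g v) = t / (1 - v)\<^sup>2 * f (g v)" for v
    using t by simp
  have "f absolutely_integrable_on g ` {0<..<1} \<and> integral (g ` {0<..<1}) f = b"
  proof (rule has_absolute_integral_change_of_variables_1'[OF _ der inj, THEN iffD1])
    show "(\<lambda>v. \<bar>t / (1 - v)\<^sup>2\<bar> * f (g v)) absolutely_integrable_on {0<..<1}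
        \<and> integral {0<..<1} (\<lambda>v. \<bar>t / (1 - v)\<^sup>2\<bar> * f (g v)) = b"
      unfolding eq using int by (simp add: b_def g_def)
  qed auto
  then have 1: "(f has_integral b) {0<..}"
    unfolding img by (auto dest: set_lebesgue_integral_eq_integral(1) simp: has_integral_iff)
  have 2: "((\<lambda>v. t / (1 - v)\<^sup>2 * f (g v)) has_integral b) {0<..<1}"
    using int unfolding b_def g_def by (auto dest: set_lebesgue_integral_eq_integral(1))
  have "(\<integral>\<^sup>+l. ennreal (indicator {0<..} l * f l) \<partial>lborel) = ennreal b"
    by (rule nn_integral_has_integral_lebesgue[OF _ 1]) (use f in auto)
  moreover have "(\<integral>\<^sup>+v. ennreal (indicator {0<..<1} v * (t / (1 - v)\<^sup>2 * f (g v))) \<partial>lborel) = ennreal b"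
    by (rule nn_integral_has_integral_lebesgue[OF _ 2]) (use f t in \<open>auto simp: g_def\<close>)
  ultimately show ?thesis by (simp add: g_def)
qed

lemma integrable_beta_exp:
  fixes a c p :: real
  assumes "a > 0" "c > 0" "p \<ge> 0"
  shows "integrable lborel (\<lambda>v. indicator {0<..} v * (v powr (a - 1) * exp (- p * v) * max 0 (1 - v) powr (c - 1)))"
proof (rule Bochner_Integration.integrable_bound)
  show "integrable lborel (\<lambda>v. indicator {0<..} v * (v powr (a - 1) * max 0 (1 - v) powr (c - 1)))"
    using nn_integral_beta[OF assms(1,2)] by (intro integrableI_nonneg) auto
  show "AE v in lborel. norm (indicator {0<..} v * (v powr (a - 1) * exp (- p * v) * max 0 (1 - v) powr (c - 1)))
    \<le> norm (indicator {0<..} v * (v powr (a - 1) * max 0 (1 - v) powr (c - 1)))"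
  proof (rule AE_I2)
    fix v :: real
    have "exp (- p * v) \<le> 1" if "v > 0" using that assms by simp
    then show "norm (indicator {0<..} v * (v powr (a - 1) * exp (- p * v) * max 0 (1 - v) powr (c - 1)))
      \<le> norm (indicator {0<..} v * (v powr (a - 1) * max 0 (1 - v) powr (c - 1)))"
      by (cases "v > 0") (auto simp: abs_mult intro!: mult_right_mono mult_left_le mult_left_le_one_le)
  qed
qed measurable

text \<open>The substitution l = t v / (1 - v) turns l t / (l + t) into t v.\<close>

lemma nn_integral_gaussian_powr_beta:
  fixes x :: "'a::euclidean_space" and \<tau> t :: real
  assumes \<tau>: "- real DIM('a) < \<tau>" "\<tau> < 2" and t: "t > 0"
  defines "q \<equiv> real DIM('a) / 2" and "R \<equiv> (norm x)\<^sup>2" and "c \<equiv> (real DIM('a) + \<tau>) / 2"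
  shows "(\<integral>\<^sup>+z. ennreal (norm z powr \<tau> * exp (- t * (norm (z - x))\<^sup>2)) \<partial>lborel)
    = ennreal (pi powr q / Gamma (1 - \<tau> / 2) * t powr (- c)) * (\<integral>\<^sup>+v. ennreal (indicator {0<..} v * (v powr (- \<tau> / 2) * exp (- (R * t) * v)
         * (q * max 0 (1 - v) powr (c - 1) + R * t * max 0 (1 - v) powr c))) \<partial>lborel)"
proof -
  define g where "g = Gamma (1 - \<tau> / 2)"
  have g: "g > 0" unfolding g_def using \<tau> by (intro Gamma_real_pos) auto
  have c: "c > 0" using \<tau> by (simp add: c_def)
  have R: "R \<ge> 0" and q: "q \<ge> 0" by (simp_all add: R_def q_def)
  define H where "H = (\<lambda>v. indicator {0<..} v * (v powr (- \<tau> / 2) * exp (- (R * t) * v)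
         * (q * max 0 (1 - v) powr (c - 1) + R * t * max 0 (1 - v) powr c)))"
  have H: "integrable lborel H"
  proof -
    have "integrable lborel (\<lambda>v. q * (indicator {0<..} v * (v powr ((1 - \<tau> / 2) - 1) * exp (- (R * t) * v) * max 0 (1 - v) powr (c - 1)))
       + (R * t) * (indicator {0<..} v * (v powr ((1 - \<tau> / 2) - 1) * exp (- (R * t) * v) * max 0 (1 - v) powr ((c + 1) - 1))))"
      using \<tau> c R t by (intro Bochner_Integration.integrable_add integrable_mult_right integrable_beta_exp) auto
    then show ?thesis unfolding H_def by (rule Bochner_Integration.integrable_cong[THEN iffD1, rotated -1]) (auto simp: algebra_simps)
  qed
  define K where "K = pi powr q * t powr (- c)"
  have K: "K > 0" using t by (simp add: K_def)
  define f where "f = (\<lambda>l. l powr (- \<tau> / 2) * ((pi / (l + t)) powr q * exp (- (l * t / (l + t)) * R) * (q / (l + t) + t\<^sup>2 / (l + t)\<^sup>2 * R)))"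
  \<comment> \<open>With w = 1 - v and c = q + \<tau> / 2, the Jacobian t / w^2 meets w^c from the
    powers and q w / t + w^2 R from the second moment. This leaves q w^(c-1) + R t w^c, and the
    powers of t collect to t^(-c).\<close>
  have fH: "t / (1 - v)\<^sup>2 * f (t * v / (1 - v)) = K * H v" if v: "0 < v" "v < 1" for v
  proof -
    define w where "w = 1 - v"
    have w: "w > 0" "max 0 (1 - v) = w" using v by (auto simp: w_def)
    have 1: "t * v / w + t = t / w" using w by (simp add: w_def field_simps)
    have 2: "t * v / w * t / (t / w) = t * v" using w t by simp
    have e1: "(t * v / w) powr (- \<tau> / 2) = t powr (- \<tau> / 2) * v powr (- \<tau> / 2) * w powr (\<tau> / 2)"
      using w t v by (simp add: powr_divide powr_mult powr_minus field_simps)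
    have e2: "(pi / (t / w)) powr q = pi powr q * w powr q * t powr (- q)"
      using w t by (simp add: powr_divide powr_mult powr_minus field_simps)
    have e3: "w powr (\<tau> / 2) * w powr q = w * w * w powr (c - 1) / w"
      using w by (simp add: powr_add[symmetric] powr_mult_base c_def q_def field_simps)
    have e4: "w powr c = w * w powr (c - 1)" using w by (simp add: powr_mult_base)
    have "- \<tau> / 2 + - q = - c" by (simp add: c_def q_def field_simps)
    then have e5: "t powr (- \<tau> / 2) * t powr (- q) = t powr (- c)"
      by (simp only: powr_add[symmetric])
    have "t / w\<^sup>2 * f (t * v / w) = t / w\<^sup>2 * ((t * v / w) powr (- \<tau> / 2) * ((pi / (t / w)) powr q * exp (- (t * v) * R) * (q / (t / w) + t\<^sup>2 / (t / w)\<^sup>2 * R)))"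
      unfolding f_def 1 2 ..
    also have "\<dots> = (t / w\<^sup>2) * (pi powr q * (t powr (- \<tau> / 2) * t powr (- q)) * v powr (- \<tau> / 2) * (w powr (\<tau> / 2) * w powr q) * exp (- (t * v) * R)) * (q * w / t + w\<^sup>2 * R)"
      unfolding e1 e2 using w t by (simp add: field_simps power2_eq_square)
    also have "\<dots> = K * (v powr (- \<tau> / 2) * exp (- (t * v) * R) * (q * w powr (c - 1) + R * t * (w * w powr (c - 1))))"
      unfolding e3 e5 K_def using w t by (simp add: field_simps power2_eq_square)
    also have "\<dots> = K * H v"
      unfolding H_def w e4[symmetric] using v by (simp add: mult_ac)
    finally show ?thesis unfolding w_def .
  qed
  have fnn: "f l \<ge> 0" if "l > 0" for l
    unfolding f_def using that t R q by (intro mult_nonneg_nonneg add_nonneg_nonneg) auto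
  \<comment> \<open>From v = 1 on \<open>H\<close> vanishes because both powers have base 0, so the
    half-line and the unit interval give the same integral.\<close>
  have ind: "indicator {0<..<1} v * H v = H v" for v
    using c by (auto simp: H_def indicator_def max_def)
  have "set_integrable lebesgue {0<..<1} (\<lambda>v. K * H v)"
  proof -
    have "indicator {0<..<1} v *\<^sub>R (K * H v) = K * H v" for v
      using ind[of v] by (simp only: real_scaleR_def mult.left_commute[of _ K])
    moreover have "integrable lebesgue (\<lambda>v. K * H v)"
      using H by (subst integrable_completion) (auto simp: H_def)
    ultimately show ?thesis unfolding set_integrable_def by (simp only:)
  qed
  then have "(\<lambda>v. t / (1 - v)\<^sup>2 * f (t * v / (1 - v))) absolutely_integrable_on {0<..<1}"
    by (rule set_integrable_cong[THEN iffD1, rotated -1]) (use fH in \<open>auto simp del: times_divide_eq_left\<close>)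
  then have "(\<integral>\<^sup>+l. ennreal (indicator {0<..} l * f l) \<partial>lborel) = (\<integral>\<^sup>+v. ennreal (indicator {0<..<1} v * (t / (1 - v)\<^sup>2 * f (t * v / (1 - v)))) \<partial>lborel)"
    by (intro nn_integral_subst_ratio t fnn)
  also have "\<dots> = (\<integral>\<^sup>+v. ennreal K * ennreal (H v) \<partial>lborel)"
  proof (rule nn_integral_cong)
    fix v :: real
    show "ennreal (indicator {0<..<1} v * (t / (1 - v)\<^sup>2 * f (t * v / (1 - v)))) = ennreal K * ennreal (H v)"
      using fH[of v] ind[of v] K by (auto simp: ennreal_mult'[symmetric] indicator_def split: if_splits)
  qed
  also have "\<dots> = ennreal K * (\<integral>\<^sup>+v. ennreal (H v) \<partial>lborel)"
    by (rule nn_integral_cmult) (simp add: H_def)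
  finally have "(\<integral>\<^sup>+l. ennreal (indicator {0<..} l * f l) \<partial>lborel) = ennreal K * (\<integral>\<^sup>+v. ennreal (H v) \<partial>lborel)" .
  then have "(\<integral>\<^sup>+z. ennreal (norm z powr \<tau> * exp (- t * (norm (z - x))\<^sup>2)) \<partial>lborel) = ennreal (1 / g) * (ennreal K * (\<integral>\<^sup>+v. ennreal (H v) \<partial>lborel))"
    using nn_integral_gaussian_powr[OF \<tau> t, of x] unfolding f_def g_def q_def R_def by simp
  also have "\<dots> = ennreal (pi powr q / g * t powr (- c)) * (\<integral>\<^sup>+v. ennreal (H v) \<partial>lborel)"
    using g by (simp add: mult.assoc[symmetric] ennreal_mult'[symmetric] K_def)
  finally show ?thesis unfolding H_def g_def .
qed

text \<open>The Gaussian integral of the constant \<open>norm x powr \<tau>\<close> is put under the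
  same v-integral: up to the common prefactor it equals the integral of R t v^(-\<tau>/2) exp(-R t
  v) over the half-line, a Gamma integral. Subtraction then creates the factor 1 - (1 - v)^c, which
  vanishes at v = 0.\<close>

lemma gaussian_powr_difference:
  fixes x :: "'a::euclidean_space" and \<tau> t :: real
  assumes \<tau>: "- real DIM('a) < \<tau>" "\<tau> < 2" and t: "t > 0" and x: "x \<noteq> 0"
  defines "q \<equiv> real DIM('a) / 2" and "R \<equiv> (norm x)\<^sup>2" and "c \<equiv> (real DIM('a) + \<tau>) / 2"
  shows "has_bochner_integral lborel (\<lambda>z. (norm z powr \<tau> - norm x powr \<tau>) * exp (- t * (norm (z - x))\<^sup>2))
     (pi powr q / Gamma (1 - \<tau> / 2) * t powr (- c) * (\<integral>v. (indicator {0<..} v * (v powr (- \<tau> / 2) * exp (- (R * t) * v) * q * max 0 (1 - v) powr (c - 1)))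
         - (indicator {0<..} v * (v powr (- \<tau> / 2) * exp (- (R * t) * v) * (R * t) * (1 - max 0 (1 - v) powr c))) \<partial>lborel))"
proof -
  define K where "K = pi powr q / Gamma (1 - \<tau> / 2) * t powr (- c)"
  have g: "Gamma (1 - \<tau> / 2) > 0" using \<tau> by (intro Gamma_real_pos) auto
  have K: "K \<ge> 0" using g by (simp add: K_def)
  have c: "c > 0" using \<tau> by (simp add: c_def)
  have R: "R > 0" and q: "q \<ge> 0" using x by (simp_all add: R_def q_def)
  define H where "H = (\<lambda>v. indicator {0<..} v * (v powr (- \<tau> / 2) * exp (- (R * t) * v)
         * (q * max 0 (1 - v) powr (c - 1) + R * t * max 0 (1 - v) powr c)))"
  define B where "B = (\<lambda>v. (R * t) * (indicator {0<..} v * (v powr ((1 - \<tau> / 2) - 1) * exp (- (R * t) * v))))"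
  have H: "integrable lborel H"
  proof -
    have "integrable lborel (\<lambda>v. q * (indicator {0<..} v * (v powr ((1 - \<tau> / 2) - 1) * exp (- (R * t) * v) * max 0 (1 - v) powr (c - 1)))
       + (R * t) * (indicator {0<..} v * (v powr ((1 - \<tau> / 2) - 1) * exp (- (R * t) * v) * max 0 (1 - v) powr ((c + 1) - 1))))"
      using \<tau> c R t by (intro Bochner_Integration.integrable_add integrable_mult_right integrable_beta_exp) auto
    then show ?thesis unfolding H_def by (rule Bochner_Integration.integrable_cong[THEN iffD1, rotated -1]) (auto simp: algebra_simps)
  qed
  have H0: "H v \<ge> 0" for v using q R t by (simp add: H_def)
  have Bn: "(\<integral>\<^sup>+v. ennreal (indicator {0<..} v * (v powr ((1 - \<tau> / 2) - 1) * exp (- (R * t) * v))) \<partial>lborel) = ennreal (Gamma (1 - \<tau> / 2) * (R * t) powr (- (1 - \<tau> / 2)))"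
    using nn_integral_powr_exp[of "1 - \<tau> / 2" "R * t"] \<tau> R t by simp
  have "has_bochner_integral lborel (\<lambda>v. indicator {0<..} v * (v powr ((1 - \<tau> / 2) - 1) * exp (- (R * t) * v))) (Gamma (1 - \<tau> / 2) * (R * t) powr (- (1 - \<tau> / 2)))"
    by (rule has_bochner_integral_nn_integral[OF _ _ _ Bn]) (use g in auto)
  then have B': "has_bochner_integral lborel B ((R * t) * (Gamma (1 - \<tau> / 2) * (R * t) powr (- (1 - \<tau> / 2))))"
    unfolding B_def by (rule has_bochner_integral_mult_right)
  have B: "has_bochner_integral lborel B (Gamma (1 - \<tau> / 2) * (R * t) powr (\<tau> / 2))"
  proof -
    have "R * t * (R * t) powr (- (1 - \<tau> / 2)) = (R * t) powr (\<tau> / 2)"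
      using R t by (subst powr_mult_base) auto
    then show ?thesis using B' by (simp only: mult.left_commute[of "R * t"])
  qed
  have "(\<integral>\<^sup>+z. ennreal (norm z powr \<tau> * exp (- t * (norm (z - x))\<^sup>2)) \<partial>lborel) = ennreal (K * integral\<^sup>L lborel H)"
    unfolding ennreal_mult'[OF K] nn_integral_eq_integral[OF H AE_I2[OF H0], symmetric]
    unfolding K_def H_def q_def R_def c_def by (rule nn_integral_gaussian_powr_beta[OF \<tau> t])
  then have 1: "has_bochner_integral lborel (\<lambda>z. norm z powr \<tau> * exp (- t * (norm (z - x))\<^sup>2)) (K * integral\<^sup>L lborel H)"
    by (intro has_bochner_integral_nn_integral) (use K H0 in \<open>auto intro!: mult_nonneg_nonneg integral_nonneg\<close>)
  have "has_bochner_integral lborel (\<lambda>z. exp (- t * (norm (z - x))\<^sup>2)) ((pi / t) powr q)"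
    unfolding q_def by (rule has_bochner_integral_nn_integral[OF _ _ _ nn_integral_gaussian(1)[OF t]]) auto
  then have "has_bochner_integral lborel (\<lambda>z. norm x powr \<tau> * exp (- t * (norm (z - x))\<^sup>2)) (norm x powr \<tau> * (pi / t) powr q)"
    by (rule has_bochner_integral_mult_right)
  moreover have "norm x powr \<tau> * (pi / t) powr q = K * integral\<^sup>L lborel B"
  proof -
    have "R powr (\<tau> / 2) = norm x powr \<tau>"
      using x by (simp add: R_def powr_powr flip: powr_numeral)
    moreover have "- c + \<tau> / 2 = - q" by (simp add: c_def q_def field_simps)
    then have "t powr (- c) * t powr (\<tau> / 2) = t powr (- q)"
      by (simp only: powr_add[symmetric])
    moreover have "K * integral\<^sup>L lborel B = pi powr q * R powr (\<tau> / 2) * (t powr (- c) * t powr (\<tau> / 2))"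
      unfolding has_bochner_integral_integral_eq[OF B] K_def using R t g by (simp add: powr_mult)
    ultimately show ?thesis using t by (simp add: powr_divide powr_minus field_simps)
  qed
  ultimately have 2: "has_bochner_integral lborel (\<lambda>z. norm x powr \<tau> * exp (- t * (norm (z - x))\<^sup>2)) (K * integral\<^sup>L lborel B)"
    by simp
  have "has_bochner_integral lborel (\<lambda>z. norm z powr \<tau> * exp (- t * (norm (z - x))\<^sup>2) - norm x powr \<tau> * exp (- t * (norm (z - x))\<^sup>2)) (K * integral\<^sup>L lborel H - K * integral\<^sup>L lborel B)"
    by (rule has_bochner_integral_diff[OF 1 2])
  also have "K * integral\<^sup>L lborel H - K * integral\<^sup>L lborel B = K * (\<integral>v. H v - B v \<partial>lborel)"
    using H B by (simp add: has_bochner_integral_iff right_diff_distrib)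
  also have "(\<lambda>v. H v - B v) = (\<lambda>v. (indicator {0<..} v * (v powr (- \<tau> / 2) * exp (- (R * t) * v) * q * max 0 (1 - v) powr (c - 1)))
         - (indicator {0<..} v * (v powr (- \<tau> / 2) * exp (- (R * t) * v) * (R * t) * (1 - max 0 (1 - v) powr c))))"
    by (auto simp: H_def B_def algebra_simps fun_eq_iff)
  finally show ?thesis by (simp add: K_def left_diff_distrib)
qed

lemma tonelli_has_bochner_integral:
  fixes f :: "real \<Rightarrow> real \<Rightarrow> real" and g :: "real \<Rightarrow> real"
  assumes [measurable]: "case_prod f \<in> borel_measurable (lborel \<Otimes>\<^sub>M lborel)"
    and f: "\<And>t v. 0 \<le> f t v" and g: "\<And>v. 0 \<le> g v"
    and 1: "\<And>v. (\<integral>\<^sup>+t. ennreal (f t v) \<partial>lborel) = ennreal (g v)"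
    and 2: "(\<integral>\<^sup>+v. ennreal (g v) \<partial>lborel) = ennreal I" and I: "0 \<le> I"
  shows "integrable (lborel \<Otimes>\<^sub>M lborel) (case_prod f)"
    and "(\<integral>p. case_prod f p \<partial>(lborel \<Otimes>\<^sub>M lborel)) = I"
proof -
  have "(\<integral>\<^sup>+p. ennreal (case_prod f p) \<partial>(lborel \<Otimes>\<^sub>M lborel)) = (\<integral>\<^sup>+v. \<integral>\<^sup>+t. ennreal (f t v) \<partial>lborel \<partial>lborel)"
    by (subst lborel_pair.nn_integral_snd[symmetric]) auto
  also have "\<dots> = ennreal I"
    unfolding 1 2 ..
  finally have 3: "(\<integral>\<^sup>+p. ennreal (case_prod f p) \<partial>(lborel \<Otimes>\<^sub>M lborel)) = ennreal I" .
  have "has_bochner_integral (lborel \<Otimes>\<^sub>M lborel) (case_prod f) I"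
    by (rule has_bochner_integral_nn_integral[OF _ _ _ 3]) (use f I in auto)
  then show "integrable (lborel \<Otimes>\<^sub>M lborel) (case_prod f)"
    and "(\<integral>p. case_prod f p \<partial>(lborel \<Otimes>\<^sub>M lborel)) = I"
    by (auto simp: has_bochner_integral_iff)
qed

text \<open>Integrating over t first leaves Beta integrals in v. The kernel v^(-s-1) is singular at 0, so the two
  parts of the difference must be grouped as here for each of them to converge.\<close>

lemma double_integral_difference:
  fixes s \<tau> R q c :: real
  assumes s: "0 < s" "s < 1" and \<tau>: "\<tau> < 2 * s" and R: "R > 0" and q: "q \<ge> 0" and c: "c > 0"
  shows "(\<integral>t. indicator {0<..} t * (t powr (s - 1 - \<tau> / 2) * (\<integral>v. (indicator {0<..} v * (v powr (- \<tau> / 2) * exp (- (R * t) * v) * q * max 0 (1 - v) powr (c - 1)))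
         - (indicator {0<..} v * (v powr (- \<tau> / 2) * exp (- (R * t) * v) * (R * t) * (1 - max 0 (1 - v) powr c))) \<partial>lborel)) \<partial>lborel)
    = Gamma (s - \<tau> / 2) * R powr (\<tau> / 2 - s) * Beta (1 - s) c * (q - (s - \<tau> / 2) * c / s)"
proof -
  define A where "A = (\<lambda>t v::real. indicator {0<..} v * (q * v powr (- \<tau> / 2) * max 0 (1 - v) powr (c - 1)) * (indicator {0<..} t * (t powr ((s - \<tau> / 2) - 1) * exp (- (R * v) * t))))"
  \<comment> \<open>The factor t of \<open>R * t\<close> is moved into the power of t, which raises
    the Gamma exponent to s + 1 - \<tau> / 2. The t-integral therefore leaves v^(-s-1), the weight
    of the regularised Beta integral.\<close>
  define B where "B = (\<lambda>t v::real. indicator {0<..} v * (R * v powr (- \<tau> / 2) * (1 - max 0 (1 - v) powr c)) * (indicator {0<..} t * (t powr ((s + 1 - \<tau> / 2) - 1) * exp (- (R * v) * t))))"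
  define ga where "ga = (\<lambda>v::real. (q * Gamma (s - \<tau> / 2) * R powr (\<tau> / 2 - s)) * (indicator {0<..} v * (v powr ((1 - s) - 1) * max 0 (1 - v) powr (c - 1))))"
  define gb where "gb = (\<lambda>v::real. (Gamma (s + 1 - \<tau> / 2) * R powr (\<tau> / 2 - s)) * (indicator {0<..} v * (v powr (- s - 1) * (1 - max 0 (1 - v) powr c))))"
  have G: "Gamma (s - \<tau> / 2) > 0" "Gamma (s + 1 - \<tau> / 2) > 0"
    using \<tau> by (auto intro!: Gamma_real_pos)
  have w: "max 0 (1 - v) powr c \<le> 1" if "v > 0" for v :: real
    using that c powr_mono2[of c "max 0 (1 - v)" 1] by simp
  have w': "0 \<le> indicator {0<..} v * (v powr a * (1 - max 0 (1 - v) powr c))" for v a :: real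
    using w[of v] by (auto simp: indicator_def)
  have w'': "0 \<le> indicator {0<..} v * (R * v powr a * (1 - max 0 (1 - v) powr c))" for v a :: real
    using w[of v] R by (auto simp: indicator_def)
  have nn1: "(\<integral>\<^sup>+t. ennreal (indicator {0<..} v * d * (indicator {0<..} t * (t powr (a - 1) * exp (- (R * v) * t)))) \<partial>lborel)
    = ennreal (indicator {0<..} v * d * (Gamma a * (R * v) powr (- a)))" if d: "0 \<le> indicator {0<..} v * d" and a: "a > 0" for v d a :: real
  proof (cases "v > 0")
    case True
    have "(\<integral>\<^sup>+t. ennreal (indicator {0<..} v * d * (indicator {0<..} t * (t powr (a - 1) * exp (- (R * v) * t)))) \<partial>lborel)
      = (\<integral>\<^sup>+t. ennreal (indicator {0<..} v * d) * ennreal (indicator {0<..} t * (t powr (a - 1) * exp (- (R * v) * t))) \<partial>lborel)"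
      using d by (intro nn_integral_cong ennreal_mult') auto
    also have "\<dots> = ennreal (indicator {0<..} v * d) * (\<integral>\<^sup>+t. ennreal (indicator {0<..} t * (t powr (a - 1) * exp (- (R * v) * t))) \<partial>lborel)"
      by (rule nn_integral_cmult) measurable
    also have "\<dots> = ennreal (indicator {0<..} v * d) * ennreal (Gamma a * (R * v) powr (- a))"
      using nn_integral_powr_exp[OF a, of "R * v"] R True by simp
    finally show ?thesis using d by (simp add: ennreal_mult')
  qed simp
  have A1: "(\<integral>\<^sup>+t. ennreal (A t v) \<partial>lborel) = ennreal (ga v)" for v
  proof -
    have "indicator {0<..} v * (q * v powr (- \<tau> / 2) * max 0 (1 - v) powr (c - 1)) * (Gamma (s - \<tau> / 2) * (R * v) powr (- (s - \<tau> / 2))) = ga v"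
    proof (cases "v > 0")
      case True
      have "v powr (- \<tau> / 2) * v powr (- (s - \<tau> / 2)) = v powr ((1 - s) - 1)"
        by (simp add: powr_add[symmetric])
      moreover have "(R * v) powr (- (s - \<tau> / 2)) = R powr (\<tau> / 2 - s) * v powr (- (s - \<tau> / 2))"
        using True R by (simp add: powr_mult)
      ultimately show ?thesis unfolding ga_def by simp
    qed (simp add: ga_def)
    moreover have "0 \<le> indicator {0<..} v * (q * v powr (- \<tau> / 2) * max 0 (1 - v) powr (c - 1))"
      using q by simp
    ultimately show ?thesis unfolding A_def using nn1 \<tau> by simp
  qed
  have B1: "(\<integral>\<^sup>+t. ennreal (B t v) \<partial>lborel) = ennreal (gb v)" for v
  proof -
    have "indicator {0<..} v * (R * v powr (- \<tau> / 2) * (1 - max 0 (1 - v) powr c)) * (Gamma (s + 1 - \<tau> / 2) * (R * v) powr (- (s + 1 - \<tau> / 2))) = gb v"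
    proof (cases "v > 0")
      case True
      have "v powr (- \<tau> / 2) * v powr (- (s + 1 - \<tau> / 2)) = v powr (- s - 1)"
        by (simp add: powr_add[symmetric])
      moreover have "R * R powr (- (s + 1 - \<tau> / 2)) = R powr (\<tau> / 2 - s)"
        using R by (subst powr_mult_base) auto
      moreover have "(R * v) powr (- (s + 1 - \<tau> / 2)) = R powr (- (s + 1 - \<tau> / 2)) * v powr (- (s + 1 - \<tau> / 2))"
        by (rule powr_mult)
      ultimately show ?thesis unfolding gb_def
        by (smt (verit) mult.assoc mult.commute mult.left_commute)
    qed (simp add: gb_def)
    then show ?thesis unfolding B_def using nn1[OF w''[of v "- \<tau> / 2"], of "s + 1 - \<tau> / 2"] \<tau> by simp
  qed
  have A2: "(\<integral>\<^sup>+v. ennreal (ga v) \<partial>lborel) = ennreal (q * Gamma (s - \<tau> / 2) * R powr (\<tau> / 2 - s) * Beta (1 - s) c)"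
  proof -
    have "(\<integral>\<^sup>+v. ennreal (ga v) \<partial>lborel) = ennreal (q * Gamma (s - \<tau> / 2) * R powr (\<tau> / 2 - s)) * (\<integral>\<^sup>+v. ennreal (indicator {0<..} v * (v powr ((1 - s) - 1) * max 0 (1 - v) powr (c - 1))) \<partial>lborel)"
      unfolding ga_def using q G by (subst nn_integral_cmult[symmetric]) (auto intro!: nn_integral_cong ennreal_mult')
    then show ?thesis
      using s c nn_integral_beta[of "1 - s" c] q G by (simp add: ennreal_mult')
  qed
  have B2: "(\<integral>\<^sup>+v. ennreal (gb v) \<partial>lborel) = ennreal (Gamma (s + 1 - \<tau> / 2) * R powr (\<tau> / 2 - s) * (c / s * Beta (1 - s) c))"
  proof -
    have "(\<integral>\<^sup>+v. ennreal (gb v) \<partial>lborel) = ennreal (Gamma (s + 1 - \<tau> / 2) * R powr (\<tau> / 2 - s)) * (\<integral>\<^sup>+v. ennreal (indicator {0<..} v * (v powr (- s - 1) * (1 - max 0 (1 - v) powr c))) \<partial>lborel)"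
      unfolding gb_def using G by (subst nn_integral_cmult[symmetric]) (auto intro!: nn_integral_cong ennreal_mult')
    then show ?thesis
      unfolding nn_integral_beta_regularised[OF s c] using G by (subst ennreal_mult') auto
  qed
  have Bpos: "Beta (1 - s) c \<ge> 0"
    using s c by (auto simp: Beta_def intro!: divide_nonneg_pos mult_nonneg_nonneg less_imp_le Gamma_real_pos)
  have mA: "case_prod A \<in> borel_measurable (lborel \<Otimes>\<^sub>M lborel)" and mB: "case_prod B \<in> borel_measurable (lborel \<Otimes>\<^sub>M lborel)"
    unfolding A_def B_def by measurable
  have A: "integrable (lborel \<Otimes>\<^sub>M lborel) (case_prod A)" "(\<integral>p. case_prod A p \<partial>(lborel \<Otimes>\<^sub>M lborel)) = q * Gamma (s - \<tau> / 2) * R powr (\<tau> / 2 - s) * Beta (1 - s) c"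
  proof -
    have n: "0 \<le> A t v" "0 \<le> ga v" for t v
      unfolding A_def ga_def using q G by auto
    have I: "0 \<le> q * Gamma (s - \<tau> / 2) * R powr (\<tau> / 2 - s) * Beta (1 - s) c"
      using q G Bpos by simp
    show "integrable (lborel \<Otimes>\<^sub>M lborel) (case_prod A)" "(\<integral>p. case_prod A p \<partial>(lborel \<Otimes>\<^sub>M lborel)) = q * Gamma (s - \<tau> / 2) * R powr (\<tau> / 2 - s) * Beta (1 - s) c"
      by (rule tonelli_has_bochner_integral[OF mA n A1 A2 I])+
  qed
  have B: "integrable (lborel \<Otimes>\<^sub>M lborel) (case_prod B)" "(\<integral>p. case_prod B p \<partial>(lborel \<Otimes>\<^sub>M lborel)) = Gamma (s + 1 - \<tau> / 2) * R powr (\<tau> / 2 - s) * (c / s * Beta (1 - s) c)"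
  proof -
    have n: "0 \<le> B t v" "0 \<le> gb v" for t v
      unfolding B_def gb_def using w'' w' G by (auto intro!: mult_nonneg_nonneg)
    have I: "0 \<le> Gamma (s + 1 - \<tau> / 2) * R powr (\<tau> / 2 - s) * (c / s * Beta (1 - s) c)"
      using G Bpos s c by simp
    show "integrable (lborel \<Otimes>\<^sub>M lborel) (case_prod B)" "(\<integral>p. case_prod B p \<partial>(lborel \<Otimes>\<^sub>M lborel)) = Gamma (s + 1 - \<tau> / 2) * R powr (\<tau> / 2 - s) * (c / s * Beta (1 - s) c)"
      by (rule tonelli_has_bochner_integral[OF mB n B1 B2 I])+
  qed
  have "(\<integral>t. (\<integral>v. A t v - B t v \<partial>lborel) \<partial>lborel) = (\<integral>p. case_prod A p - case_prod B p \<partial>(lborel \<Otimes>\<^sub>M lborel))"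
    using lborel_pair.integral_fst'[OF Bochner_Integration.integrable_diff[OF A(1) B(1)]] by simp
  also have "\<dots> = q * Gamma (s - \<tau> / 2) * R powr (\<tau> / 2 - s) * Beta (1 - s) c - Gamma (s + 1 - \<tau> / 2) * R powr (\<tau> / 2 - s) * (c / s * Beta (1 - s) c)"
    by (simp only: Bochner_Integration.integral_diff[OF A(1) B(1)] A(2) B(2))
  also have "Gamma (s + 1 - \<tau> / 2) = (s - \<tau> / 2) * Gamma (s - \<tau> / 2)"
  proof -
    have "s - \<tau> / 2 \<notin> \<int>\<^sub>\<le>\<^sub>0" using \<tau> by (auto dest: nonpos_Ints_nonpos)
    then show ?thesis using Gamma_plus1[of "s - \<tau> / 2"] by (simp add: add.commute add_diff_eq)
  qed
  also have "q * Gamma (s - \<tau> / 2) * R powr (\<tau> / 2 - s) * Beta (1 - s) c - (s - \<tau> / 2) * Gamma (s - \<tau> / 2) * R powr (\<tau> / 2 - s) * (c / s * Beta (1 - s) c)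
    = Gamma (s - \<tau> / 2) * R powr (\<tau> / 2 - s) * Beta (1 - s) c * (q - (s - \<tau> / 2) * c / s)"
    using s by (simp add: field_simps)
  also have "(\<integral>t. (\<integral>v. A t v - B t v \<partial>lborel) \<partial>lborel)
    = (\<integral>t. indicator {0<..} t * (t powr (s - 1 - \<tau> / 2) * (\<integral>v. (indicator {0<..} v * (v powr (- \<tau> / 2) * exp (- (R * t) * v) * q * max 0 (1 - v) powr (c - 1)))
         - (indicator {0<..} v * (v powr (- \<tau> / 2) * exp (- (R * t) * v) * (R * t) * (1 - max 0 (1 - v) powr c))) \<partial>lborel)) \<partial>lborel)"
  proof (rule Bochner_Integration.integral_cong[OF refl])
    fix t :: real
    show "(\<integral>v. A t v - B t v \<partial>lborel) = indicator {0<..} t * (t powr (s - 1 - \<tau> / 2) * (\<integral>v. (indicator {0<..} v * (v powr (- \<tau> / 2) * exp (- (R * t) * v) * q * max 0 (1 - v) powr (c - 1)))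
         - (indicator {0<..} v * (v powr (- \<tau> / 2) * exp (- (R * t) * v) * (R * t) * (1 - max 0 (1 - v) powr c))) \<partial>lborel))"
    proof (cases "t > 0")
      case True
      have 1: "t powr ((s - \<tau> / 2) - 1) = t powr (s - 1 - \<tau> / 2)" by (simp add: algebra_simps)
      have 2: "t powr ((s + 1 - \<tau> / 2) - 1) = t * t powr (s - 1 - \<tau> / 2)"
        using True by (subst powr_mult_base) (auto simp: algebra_simps)
      show ?thesis
        unfolding integral_mult_right_zero[symmetric] A_def B_def 1 2
        by (intro Bochner_Integration.integral_cong refl) (use True in \<open>simp add: algebra_simps\<close>)
    qed (simp add: A_def B_def)
  qed
  finally show ?thesis .
qed

section \<open>Second differences of a power\<close>

lemma lborel_has_bochner_integral_plus:
  fixes f :: "'a::euclidean_space \<Rightarrow> real"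
  assumes "f \<in> borel_measurable borel"
  shows "has_bochner_integral lborel (\<lambda>y. f (x + y)) I \<longleftrightarrow> has_bochner_integral lborel f I"
proof -
  have "has_bochner_integral (distr lborel borel ((+) x)) f I \<longleftrightarrow> has_bochner_integral lborel (\<lambda>y. f (x + y)) I"
    using assms by (simp add: has_bochner_integral_iff integrable_distr_eq integral_distr)
  then show ?thesis by (simp add: lborel_distr_plus)
qed

lemma lborel_has_bochner_integral_minus:
  fixes f :: "'a::euclidean_space \<Rightarrow> real"
  assumes "f \<in> borel_measurable borel"
  shows "has_bochner_integral lborel (\<lambda>y. f (x - y)) I \<longleftrightarrow> has_bochner_integral lborel f I"
proof -
  have d: "distr lborel borel (\<lambda>y. x - y) = lborel"
    using lborel_affine[of "-1" x] by (simp add: density_1)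
  have "has_bochner_integral (distr lborel borel (\<lambda>y. x - y)) f I \<longleftrightarrow> has_bochner_integral lborel (\<lambda>y. f (x - y)) I"
    using assms by (simp add: has_bochner_integral_iff integrable_distr_eq integral_distr)
  then show ?thesis by (simp add: d)
qed

text \<open>For \<open>1 + \<xi> = (|x + y| / |x|)^2\<close> with |y| \<le> |x| / 2 the range of 1 + \<xi> is [1/4, 9/4].\<close>

lemma powr_second_order_bound:
  fixes q :: real
  obtains C where "C \<ge> 0" "\<And>\<xi>. 1/4 \<le> 1 + \<xi> \<Longrightarrow> 1 + \<xi> \<le> 9/4 \<Longrightarrow> \<bar>(1 + \<xi>) powr q - 1 - q * \<xi>\<bar> \<le> C * \<xi>\<^sup>2"
proof -
  define f where "f = (\<lambda>i::nat. \<lambda>v::real. if i = 0 then v powr q else if i = 1 then q * v powr (q - 1) else q * (q - 1) * v powr (q - 2))"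
  define B where "B = \<bar>q * (q - 1)\<bar> * ((1/4) powr (q - 2) + (9/4) powr (q - 2))"
  have B: "B \<ge> 0" by (simp add: B_def)
  have "\<bar>(1 + \<xi>) powr q - 1 - q * \<xi>\<bar> \<le> B * \<xi>\<^sup>2" if "1/4 \<le> 1 + \<xi>" "1 + \<xi> \<le> 9/4" for \<xi>
  proof -
    have "norm (f 0 (1 + \<xi>) - (\<Sum>i\<le>1. f i 1 * ((1 + \<xi>) - 1) ^ i / fact i)) \<le> B * norm ((1 + \<xi>) - 1) ^ (Suc 1) / fact 1"
    proof (rule field_Taylor)
      show "convex {1/4..9/4::real}" by (rule convex_real_interval)
      show "(f i has_field_derivative f (Suc i) x) (at x within {1/4..9/4})" if x: "x \<in> {1/4..9/4}" and i: "i \<le> 1" for i x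
      proof -
        consider "i = 0" | "i = 1" using i by linarith
        then show ?thesis
        proof cases
          case 1
          then show ?thesis using x by (auto simp: f_def fun_eq_iff intro!: derivative_eq_intros)
        next
          case 2
          have "((\<lambda>v. q * v powr (q - 1)) has_field_derivative q * ((q - 1) * x powr (q - 1 - 1))) (at x within {1/4..9/4})"
            using x by (intro DERIV_cmult has_real_derivative_powr[THEN has_field_derivative_at_within]) auto
          then show ?thesis using 2 by (simp add: f_def mult.assoc)
        qed
      qed
      show "norm (f (Suc 1) x) \<le> B" if "x \<in> {1/4..9/4}" for x
      proof -
        have "x powr (q - 2) \<le> (1/4) powr (q - 2) + (9/4) powr (q - 2)"
        proof (cases "q - 2 \<ge> 0")
          case True
          then have "x powr (q - 2) \<le> (9/4) powr (q - 2)" using that by (intro powr_mono2) auto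
          then show ?thesis by (simp add: add_increasing)
        next
          case False
          then have "x powr (q - 2) \<le> (1/4) powr (q - 2)" using that by (intro powr_mono2') auto
          then show ?thesis by (simp add: add_increasing2)
        qed
        then show ?thesis by (simp add: f_def B_def abs_mult mult_left_mono)
      qed
    qed (use that in auto)
    then show ?thesis by (simp add: f_def power2_eq_square algebra_simps)
  qed
  then show thesis using B that by blast
qed

text \<open>|x + y|^2 = R (1 + \<xi>) with \<xi> = (2 x.y + |y|^2) / R, and likewise for -y. In the
  sum the terms linear in x.y cancel; what is left is of order |y|^2, since |\<xi>| \<le> (5/2) |x|
  |y| / R makes the Taylor remainder quadratic in |y|.\<close>

lemma norm_powr_second_difference:
  fixes x :: "'a::euclidean_space" and \<tau> :: real
  assumes x: "x \<noteq> 0"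
  obtains C where "C \<ge> 0" "\<And>y. norm y \<le> norm x / 2 \<Longrightarrow> \<bar>norm (x + y) powr \<tau> + norm (x - y) powr \<tau> - 2 * norm x powr \<tau>\<bar> \<le> C * (norm y)\<^sup>2"
proof -
  define R where "R = (norm x)\<^sup>2"
  define q where "q = \<tau> / 2"
  have R: "R > 0" using x by (simp add: R_def)
  obtain C where C: "C \<ge> 0" "\<And>\<xi>. 1/4 \<le> 1 + \<xi> \<Longrightarrow> 1 + \<xi> \<le> 9/4 \<Longrightarrow> \<bar>(1 + \<xi>) powr q - 1 - q * \<xi>\<bar> \<le> C * \<xi>\<^sup>2"
    using powr_second_order_bound by blast
  have one: "\<bar>norm (x + y) powr \<tau> - R powr q * (1 + q * ((2 * (x \<bullet> y) + (norm y)\<^sup>2) / R))\<bar> \<le> R powr q * (C * (25 / 4 / R)) * (norm y)\<^sup>2"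
    if y: "norm y \<le> norm x / 2" for y
  proof -
    define \<xi> where "\<xi> = (2 * (x \<bullet> y) + (norm y)\<^sup>2) / R"
    have n: "(norm (x + y))\<^sup>2 = R * (1 + \<xi>)"
      using R unfolding \<xi>_def R_def power2_norm_eq_inner by (simp add: inner_add_left inner_add_right inner_commute field_simps)
    have lo: "norm x / 2 \<le> norm (x + y)"
      using norm_diff_ineq[of x y] y by linarith
    have hi: "norm (x + y) \<le> 3 / 2 * norm x"
      using norm_triangle_ineq[of x y] y by linarith
    have "R * (1/4) \<le> R * (1 + \<xi>)" "R * (1 + \<xi>) \<le> R * (9/4)"
    proof -
      have "(norm x / 2)\<^sup>2 = R * (1/4)" "(3 / 2 * norm x)\<^sup>2 = R * (9/4)"
        by (simp_all add: R_def power2_eq_square)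
      then show "R * (1/4) \<le> R * (1 + \<xi>)" "R * (1 + \<xi>) \<le> R * (9/4)"
        using power_mono[OF lo, of 2] power_mono[OF hi, of 2] n by simp_all
    qed
    then have \<xi>: "1/4 \<le> 1 + \<xi>" "1 + \<xi> \<le> 9/4" using R by (simp_all only: mult_le_cancel_left_pos)
    have "norm (x + y) powr \<tau> = ((norm (x + y))\<^sup>2) powr q"
      using lo x by (auto simp: q_def powr_powr simp flip: powr_numeral)
    also have "\<dots> = R powr q * (1 + \<xi>) powr q"
      unfolding n by (rule powr_mult)
    finally have e: "norm (x + y) powr \<tau> - R powr q * (1 + q * \<xi>) = R powr q * ((1 + \<xi>) powr q - 1 - q * \<xi>)"
      by (simp add: algebra_simps)
    have "\<bar>2 * (x \<bullet> y) + (norm y)\<^sup>2\<bar> \<le> 2 * (norm x * norm y) + norm y * norm y"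
      using Cauchy_Schwarz_ineq2[of x y] zero_le_square[of "norm y"] unfolding power2_eq_square by linarith
    also have "\<dots> \<le> 2 * (norm x * norm y) + norm x / 2 * norm y"
      using y by (intro add_left_mono mult_right_mono) auto
    also have "\<dots> = 5 / 2 * (norm x * norm y)" by simp
    finally have "(2 * (x \<bullet> y) + (norm y)\<^sup>2)\<^sup>2 \<le> (5 / 2 * (norm x * norm y))\<^sup>2"
      by (intro abs_le_square_iff[THEN iffD1]) simp
    then have "\<xi>\<^sup>2 \<le> 25 / 4 * R * (norm y)\<^sup>2 / R\<^sup>2"
      unfolding \<xi>_def power_divide by (intro divide_right_mono) (simp_all add: R_def power_mult_distrib power2_eq_square mult_ac)
    also have "\<dots> = 25 / 4 / R * (norm y)\<^sup>2" using R by (simp add: power2_eq_square)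
    finally have "C * \<xi>\<^sup>2 \<le> C * (25 / 4 / R * (norm y)\<^sup>2)" using C by (intro mult_left_mono) auto
    with C(2)[OF \<xi>] have "\<bar>(1 + \<xi>) powr q - 1 - q * \<xi>\<bar> \<le> C * (25 / 4 / R) * (norm y)\<^sup>2" by simp
    then have "R powr q * \<bar>(1 + \<xi>) powr q - 1 - q * \<xi>\<bar> \<le> R powr q * (C * (25 / 4 / R) * (norm y)\<^sup>2)"
      by (intro mult_left_mono) auto
    then show ?thesis unfolding \<xi>_def[symmetric] e by (simp add: abs_mult mult.assoc)
  qed
  have Rq: "R powr q = norm x powr \<tau>"
    using x by (simp add: R_def q_def powr_powr flip: powr_numeral)
  define K where "K = R powr q * (2 * (C * (25 / 4 / R)) + 2 * \<bar>q\<bar> / R)"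
  show thesis
  proof (rule that)
    show "K \<ge> 0" using C R by (simp add: K_def)
    fix y :: 'a assume y: "norm y \<le> norm x / 2"
    define a where "a = norm (x + y) powr \<tau> - R powr q * (1 + q * ((2 * (x \<bullet> y) + (norm y)\<^sup>2) / R))"
    define b where "b = norm (x - y) powr \<tau> - R powr q * (1 + q * ((2 * (x \<bullet> - y) + (norm y)\<^sup>2) / R))"
    have a: "\<bar>a\<bar> \<le> R powr q * (C * (25 / 4 / R)) * (norm y)\<^sup>2" unfolding a_def by (rule one[OF y])
    have b: "\<bar>b\<bar> \<le> R powr q * (C * (25 / 4 / R)) * (norm y)\<^sup>2" unfolding b_def using one[of "- y"] y by simp
    have "norm (x + y) powr \<tau> + norm (x - y) powr \<tau> - 2 * norm x powr \<tau> = a + b + R powr q * (2 * q / R) * (norm y)\<^sup>2"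
      unfolding a_def b_def Rq[symmetric] using R by (simp add: field_simps)
    also have "\<bar>\<dots>\<bar> \<le> \<bar>a\<bar> + \<bar>b\<bar> + \<bar>R powr q * (2 * q / R) * (norm y)\<^sup>2\<bar>" by (intro order_trans[OF abs_triangle_ineq] add_right_mono abs_triangle_ineq)
    also have "\<bar>R powr q * (2 * q / R) * (norm y)\<^sup>2\<bar> = R powr q * (2 * \<bar>q\<bar> / R) * (norm y)\<^sup>2"
      using R by (simp add: abs_mult)
    finally show "\<bar>norm (x + y) powr \<tau> + norm (x - y) powr \<tau> - 2 * norm x powr \<tau>\<bar> \<le> K * (norm y)\<^sup>2"
      using a b by (simp add: K_def algebra_simps)
  qed
qed

text \<open>For |y| < |x| / 2 the quadratic bound compensates the kernel because s < 1. For larger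
  |y| the translates by y and -y are separately integrable: each is the tail of a function in
  \<open>L1s\<close>, seen from x.\<close>

lemma integrable_second_difference:
  fixes x :: "'a::euclidean_space" and s \<tau> :: real
  assumes s: "0 < s" "s < 1" and \<tau>: "- real DIM('a) < \<tau>" "\<tau> < 2 * s" and x: "x \<noteq> 0"
  shows "integrable lborel (\<lambda>y. (norm (x + y) powr \<tau> + norm (x - y) powr \<tau> - 2 * norm x powr \<tau>) * norm y powr (- (DIM('a) + 2 * s)))"
proof -
  let ?p = "real DIM('a) + 2 * s"
  define r where "r = norm x / 2"
  have r: "r > 0" using x by (simp add: r_def)
  obtain C where C: "C \<ge> 0" "\<And>y. norm y \<le> r \<Longrightarrow> \<bar>norm (x + y) powr \<tau> + norm (x - y) powr \<tau> - 2 * norm x powr \<tau>\<bar> \<le> C * (norm y)\<^sup>2"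
    using norm_powr_second_difference[OF x] unfolding r_def by blast
  \<comment> \<open>The maximum with 1 makes C |y|^2 \<le> K min 1 (|y|^2) hold on |y| < r even when
    r exceeds 1.\<close>
  define K where "K = C * max 1 (r\<^sup>2)"
  have K: "K \<ge> 0" using C by (simp add: K_def)
  define T where "T = (\<lambda>z. indicator (- ball x r) z * (norm z powr \<tau> / norm (x - z) powr ?p))"
  have "integrable lebesgue T"
    using L1s_set_integrable_tail[OF powr_L1s[OF \<tau> s(1)] s(1) r, of x] by (simp add: T_def set_integrable_def)
  then have "integrable lborel T" by (subst (asm) integrable_completion) (auto simp: T_def)
  then obtain I where I: "has_bochner_integral lborel T I" by (auto simp: has_bochner_integral_iff)
  have mT: "T \<in> borel_measurable borel" by (auto simp: T_def)
  have 1: "integrable lborel (\<lambda>y. T (x + y))" "integrable lborel (\<lambda>y. T (x - y))"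
    using I lborel_has_bochner_integral_plus[OF mT, of x] lborel_has_bochner_integral_minus[OF mT, of x]
    by (auto simp: has_bochner_integral_iff)
  show ?thesis
  proof (rule Bochner_Integration.integrable_bound)
    show "integrable lborel (\<lambda>y. K * (min 1 ((norm y)\<^sup>2) * norm y powr (- ?p))
      + (T (x + y) + T (x - y) + 2 * norm x powr \<tau> * (indicator {y. r \<le> norm y} y * norm y powr (- ?p))))"
      by (intro Bochner_Integration.integrable_add integrable_mult_right integrable_truncated_kernel integrable_kernel_tail 1 s r)
    show "AE y in lborel. norm ((norm (x + y) powr \<tau> + norm (x - y) powr \<tau> - 2 * norm x powr \<tau>) * norm y powr (- ?p))
      \<le> norm (K * (min 1 ((norm y)\<^sup>2) * norm y powr (- ?p))
      + (T (x + y) + T (x - y) + 2 * norm x powr \<tau> * (indicator {y. r \<le> norm y} y * norm y powr (- ?p))))"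
    proof (rule AE_I2)
      fix y :: 'a
      define D where "D = norm (x + y) powr \<tau> + norm (x - y) powr \<tau> - 2 * norm x powr \<tau>"
      have T0: "T z \<ge> 0" for z by (simp add: T_def)
      have tail0: "0 \<le> T (x + y) + T (x - y) + 2 * norm x powr \<tau> * (indicator {y. r \<le> norm y} y * norm y powr (- ?p))"
        using T0 by simp
      have near0: "0 \<le> K * (min 1 ((norm y)\<^sup>2) * norm y powr (- ?p))" using K by simp
      have "\<bar>D\<bar> * norm y powr (- ?p) \<le> K * (min 1 ((norm y)\<^sup>2) * norm y powr (- ?p))
      + (T (x + y) + T (x - y) + 2 * norm x powr \<tau> * (indicator {y. r \<le> norm y} y * norm y powr (- ?p)))"
      proof (cases "norm y < r")
        case True
        have "(norm y)\<^sup>2 \<le> max 1 (r\<^sup>2) * min 1 ((norm y)\<^sup>2)"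
        proof (cases "(norm y)\<^sup>2 \<le> 1")
          case True
          then show ?thesis using mult_right_mono[of 1 "max 1 (r\<^sup>2)" "(norm y)\<^sup>2"] by (simp add: min_def)
        next
          case False
          have "(norm y)\<^sup>2 \<le> r\<^sup>2" using \<open>norm y < r\<close> by (intro power_mono) auto
          then show ?thesis using False by (simp add: min_def)
        qed
        then have "C * (norm y)\<^sup>2 \<le> K * min 1 ((norm y)\<^sup>2)"
          unfolding K_def mult.assoc using C by (intro mult_left_mono) auto
        moreover have "\<bar>D\<bar> \<le> C * (norm y)\<^sup>2" unfolding D_def using C(2) True by simp
        ultimately have "\<bar>D\<bar> * norm y powr (- ?p) \<le> (K * min 1 ((norm y)\<^sup>2)) * norm y powr (- ?p)"
          by (intro mult_right_mono) auto
        then show ?thesis using tail0 by simp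
      next
        case False
        have "T (x + y) = norm (x + y) powr \<tau> * norm y powr (- ?p)" "T (x - y) = norm (x - y) powr \<tau> * norm y powr (- ?p)"
          using False by (simp_all add: T_def dist_norm divide_powr_uminus)
        moreover have "\<bar>D\<bar> * norm y powr (- ?p) \<le> (norm (x + y) powr \<tau> + norm (x - y) powr \<tau> + 2 * norm x powr \<tau>) * norm y powr (- ?p)"
        proof (intro mult_right_mono)
          have "0 \<le> norm (x + y) powr \<tau>" "0 \<le> norm (x - y) powr \<tau>" "0 \<le> norm x powr \<tau>" by simp_all
          then show "\<bar>D\<bar> \<le> norm (x + y) powr \<tau> + norm (x - y) powr \<tau> + 2 * norm x powr \<tau>"
            unfolding D_def by linarith
        qed simp
        ultimately show ?thesis using False near0 by (simp add: algebra_simps)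
      qed
      then show "norm ((norm (x + y) powr \<tau> + norm (x - y) powr \<tau> - 2 * norm x powr \<tau>) * norm y powr (- ?p))
      \<le> norm (K * (min 1 ((norm y)\<^sup>2) * norm y powr (- ?p))
      + (T (x + y) + T (x - y) + 2 * norm x powr \<tau> * (indicator {y. r \<le> norm y} y * norm y powr (- ?p))))"
        unfolding D_def[symmetric] using near0 tail0 by (simp add: abs_mult)
    qed
  qed measurable
qed

text \<open>The kernel is |y|^(-2h) with h = N/2 + s, again a superposition of Gaussians in y.
  Absolute integrability of the second difference justifies Fubini. For fixed t, translation and
  reflection turn the y-integral into twice the one of \<open>gaussian_powr_difference\<close>, and
  the remaining double integral is \<open>double_integral_difference\<close>.\<close>

lemma integral_second_difference:
  fixes x :: "'a::euclidean_space" and s \<tau> :: real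
  assumes s: "0 < s" "s < 1" and \<tau>: "- real DIM('a) < \<tau>" "\<tau> < 2 * s" and x: "x \<noteq> 0"
  defines "q \<equiv> real DIM('a) / 2" and "R \<equiv> (norm x)\<^sup>2" and "c \<equiv> (real DIM('a) + \<tau>) / 2"
  shows "(\<integral>y. (norm (x + y) powr \<tau> + norm (x - y) powr \<tau> - 2 * norm x powr \<tau>) * norm y powr (- (DIM('a) + 2 * s)) \<partial>lborel)
    = 2 * (pi powr q / Gamma (1 - \<tau> / 2)) * (Gamma (s - \<tau> / 2) * R powr (\<tau> / 2 - s) * Beta (1 - s) c * (q - (s - \<tau> / 2) * c / s)) / Gamma (q + s)"
proof -
  define D where "D = (\<lambda>y. norm (x + y) powr \<tau> + norm (x - y) powr \<tau> - 2 * norm x powr \<tau>)"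
  define h where "h = q + s"
  have h: "h > 0" "- 2 * h = - (real DIM('a) + 2 * s)" using s by (auto simp: h_def q_def add_nonneg_pos)
  have g: "Gamma h > 0" using h by (intro Gamma_real_pos)
  have R: "R > 0" using x by (simp add: R_def)
  have c: "c > 0" and q: "q \<ge> 0" using \<tau> by (simp_all add: c_def q_def)
  have [measurable]: "D \<in> borel_measurable borel" by (simp add: D_def)
  have intD: "integrable lborel (\<lambda>y. D y * norm y powr (- 2 * h))"
    unfolding D_def h(2) by (rule integrable_second_difference[OF s \<tau> x])
  define F where "F = (\<lambda>(t::real) y. indicator {0<..} t * (t powr (h - 1) * exp (- t * (norm y)\<^sup>2)) * D y)"
  have mF: "case_prod F \<in> borel_measurable (lborel \<Otimes>\<^sub>M lborel)"
    unfolding F_def by measurable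
  have absF: "(\<integral>\<^sup>+t. ennreal (norm (F t y)) \<partial>lborel) = ennreal (Gamma h) * ennreal (norm (D y * norm y powr (- 2 * h)))" if y: "y \<noteq> 0" for y
  proof -
    have "(\<integral>\<^sup>+t. ennreal (norm (F t y)) \<partial>lborel) = (\<integral>\<^sup>+t. ennreal (norm (D y)) * ennreal (indicator {0<..} t * (t powr (h - 1) * exp (- t * (norm y)\<^sup>2))) \<partial>lborel)"
      by (intro nn_integral_cong) (simp add: F_def abs_mult ennreal_mult'[symmetric] mult_ac)
    also have "\<dots> = ennreal (norm (D y)) * (\<integral>\<^sup>+t. ennreal (indicator {0<..} t * (t powr (h - 1) * exp (- t * (norm y)\<^sup>2))) \<partial>lborel)"
      by (rule nn_integral_cmult) measurable
    also have "\<dots> = ennreal (norm (D y)) * ennreal (Gamma h * norm y powr (- 2 * h))"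
      unfolding nn_integral_gaussian_kernel[OF h(1) y] ..
    finally show ?thesis using g by (simp add: ennreal_mult'[symmetric] abs_mult mult_ac)
  qed
  have "integrable (lborel \<Otimes>\<^sub>M lborel) (case_prod F)"
  proof (rule integrableI_bounded[OF mF])
    have "(\<integral>\<^sup>+p. ennreal (norm (case_prod F p)) \<partial>(lborel \<Otimes>\<^sub>M lborel)) = (\<integral>\<^sup>+y. \<integral>\<^sup>+t. ennreal (norm (F t y)) \<partial>lborel \<partial>lborel)"
      using mF by (subst lborel_pair.nn_integral_snd[symmetric]) auto
    also have "\<dots> = (\<integral>\<^sup>+y. ennreal (Gamma h) * ennreal (norm (D y * norm y powr (- 2 * h))) \<partial>lborel)"
    proof (rule nn_integral_cong_AE)
      show "AE y in lborel. (\<integral>\<^sup>+t. ennreal (norm (F t y)) \<partial>lborel) = ennreal (Gamma h) * ennreal (norm (D y * norm y powr (- 2 * h)))"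
        using AE_lborel_singleton[of "0::'a"] by eventually_elim (rule absF)
    qed
    also have "\<dots> = ennreal (Gamma h) * (\<integral>\<^sup>+y. ennreal (norm (D y * norm y powr (- 2 * h))) \<partial>lborel)"
      by (rule nn_integral_cmult) measurable
    also have "\<dots> < \<infinity>"
      using intD by (simp add: integrable_iff_bounded ennreal_mult_less_top)
    finally show "(\<integral>\<^sup>+p. ennreal (norm (case_prod F p)) \<partial>(lborel \<Otimes>\<^sub>M lborel)) < \<infinity>" .
  qed
  then have "(\<integral>y. (\<integral>t. F t y \<partial>lborel) \<partial>lborel) = (\<integral>t. (\<integral>y. F t y \<partial>lborel) \<partial>lborel)"
    by (rule lborel_pair.Fubini_integral)
  also have "(\<integral>y. (\<integral>t. F t y \<partial>lborel) \<partial>lborel) = (\<integral>y. Gamma h * (D y * norm y powr (- 2 * h)) \<partial>lborel)"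
  proof (rule Bochner_Integration.integral_cong[OF refl])
    fix y :: 'a
    show "(\<integral>t. F t y \<partial>lborel) = Gamma h * (D y * norm y powr (- 2 * h))"
    proof (cases "y = 0")
      case False
      have "has_bochner_integral lborel (\<lambda>t. indicator {0<..} t * (t powr (h - 1) * exp (- t * (norm y)\<^sup>2))) (Gamma h * norm y powr (- 2 * h))"
        by (rule has_bochner_integral_nn_integral[OF _ _ _ nn_integral_gaussian_kernel[OF h(1) False]]) (use g in auto)
      then have "(\<integral>t. indicator {0<..} t * (t powr (h - 1) * exp (- t * (norm y)\<^sup>2)) \<partial>lborel) = Gamma h * norm y powr (- 2 * h)"
        by (rule has_bochner_integral_integral_eq)
      then show ?thesis by (simp add: F_def)
    qed (simp add: F_def D_def)
  qed
  also have "\<dots> = Gamma h * (\<integral>y. D y * norm y powr (- 2 * h) \<partial>lborel)"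
    by (rule integral_mult_right_zero)
  finally have 1: "Gamma h * (\<integral>y. D y * norm y powr (- 2 * h) \<partial>lborel) = (\<integral>t. (\<integral>y. F t y \<partial>lborel) \<partial>lborel)" .
  define K where "K = pi powr q / Gamma (1 - \<tau> / 2)"
  define J where "J = (\<lambda>t. (\<integral>v. (indicator {0<..} v * (v powr (- \<tau> / 2) * exp (- (R * t) * v) * q * max 0 (1 - v) powr (c - 1)))
         - (indicator {0<..} v * (v powr (- \<tau> / 2) * exp (- (R * t) * v) * (R * t) * (1 - max 0 (1 - v) powr c))) \<partial>lborel))"
  have inner: "(\<integral>y. F t y \<partial>lborel) = (2 * K) * (indicator {0<..} t * (t powr (s - 1 - \<tau> / 2) * J t))" for t
  proof (cases "t > 0")
    case True
    define f where "f = (\<lambda>z. (norm z powr \<tau> - norm x powr \<tau>) * exp (- t * (norm (z - x))\<^sup>2))"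
    have mf: "f \<in> borel_measurable borel" by (simp add: f_def)
    have I: "has_bochner_integral lborel f (K * t powr (- c) * J t)"
      using gaussian_powr_difference[of \<tau> t x] \<tau> s True x
      unfolding f_def K_def J_def q_def R_def c_def by simp
    have "has_bochner_integral lborel (\<lambda>y. f (x + y) + f (x - y)) (K * t powr (- c) * J t + K * t powr (- c) * J t)"
      by (intro has_bochner_integral_add) (simp_all only: lborel_has_bochner_integral_plus[OF mf] lborel_has_bochner_integral_minus[OF mf] I)
    moreover have "f (x + y) + f (x - y) = exp (- t * (norm y)\<^sup>2) * D y" for y
      by (simp add: f_def D_def algebra_simps)
    ultimately have "(\<integral>y. exp (- t * (norm y)\<^sup>2) * D y \<partial>lborel) = 2 * (K * t powr (- c) * J t)"
      by (simp add: has_bochner_integral_iff)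
    moreover have "(\<integral>y. F t y \<partial>lborel) = t powr (h - 1) * (\<integral>y. exp (- t * (norm y)\<^sup>2) * D y \<partial>lborel)"
      using True by (simp add: F_def mult.assoc)
    moreover have "t powr (h - 1) * t powr (- c) = t powr (s - 1 - \<tau> / 2)"
    proof -
      have "h - 1 + - c = s - 1 - \<tau> / 2" by (simp add: h_def c_def q_def field_simps)
      then show ?thesis by (simp only: powr_add[symmetric])
    qed
    ultimately show ?thesis using True by (simp add: mult_ac)
  qed (simp add: F_def)
  have "(\<integral>t. (\<integral>y. F t y \<partial>lborel) \<partial>lborel) = (2 * K) * (Gamma (s - \<tau> / 2) * R powr (\<tau> / 2 - s) * Beta (1 - s) c * (q - (s - \<tau> / 2) * c / s))"
    unfolding inner double_integral_difference[OF s \<tau>(2) R q c, symmetric] J_def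
    by (rule integral_mult_right_zero)
  with 1 g show ?thesis
    unfolding D_def h(2) K_def h_def[symmetric] by (simp only: eq_divide_eq mult.commute[of "Gamma h"] split: if_split) simp
qed

section \<open>Identification of the constant and passage to the principal value\<close>

text \<open>With c = (N + \<tau>) / 2 the bracket times s equals (\<tau> / 2) (c - s). By the
  functional equation of \<open>rGamma\<close>, -\<tau>/2 and c - s are exactly the factors that
  shift 1 / Gamma at 1 - \<tau>/2 and 1 - s + c to the two reciprocal Gamma factors of
  \<open>c_s\<close>. The factor -1/2 comes from symmetrising; P stands for the power of
  |x|.\<close>

lemma frac_const_mult_eq_c_s:
  fixes s \<tau> :: real and N :: nat
  assumes s: "0 < s" "s < 1" and \<tau>: "- real N < \<tau>" "\<tau> < 2 * s" and N: "N > 0"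
  shows "frac_const N s * (- (1/2) * (2 * (pi powr (real N / 2) / Gamma (1 - \<tau> / 2)) * (Gamma (s - \<tau> / 2) * P * Beta (1 - s) ((real N + \<tau>) / 2)
      * (real N / 2 - (s - \<tau> / 2) * ((real N + \<tau>) / 2) / s)) / Gamma (real N / 2 + s))) = c_s N s \<tau> * P"
proof -
  define c where "c = (real N + \<tau>) / 2"
  have c: "c > 0" using \<tau> by (simp add: c_def)
  have G: "Gamma (1 - \<tau> / 2) > 0" "Gamma (1 - s) > 0" "Gamma (real N / 2 + s) > 0" "Gamma (1 - s + c) > 0"
    using s \<tau> c by (auto intro!: Gamma_real_pos add_nonneg_pos)
  have r1: "rGamma (- \<tau> / 2) = (- \<tau> / 2) / Gamma (1 - \<tau> / 2)"
  proof -
    have "- \<tau> / 2 + 1 = 1 - \<tau> / 2" by simp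
    then show ?thesis using rGamma_plus1[of "- \<tau> / 2"] by (simp only: rGamma_inverse_Gamma divide_inverse)
  qed
  have r2: "rGamma ((real N - 2 * s + \<tau>) / 2) = (c - s) / Gamma (1 - s + c)"
  proof -
    have e: "(real N - 2 * s + \<tau>) / 2 = c - s" by (simp add: c_def field_simps)
    have e2: "1 - s + c = c - s + 1" by simp
    show ?thesis unfolding e e2 using rGamma_plus1[of "c - s"] by (simp only: rGamma_inverse_Gamma divide_inverse)
  qed
  have pp: "pi powr (- real N / 2) * pi powr (real N / 2) = 1"
    by (simp add: powr_add[symmetric])
  have e: "s * (real N / 2 - (s - \<tau> / 2) * c / s) = \<tau> / 2 * (c - s)"
    using s by (simp add: c_def field_simps)
  have a: "(real N + 2 * s) / 2 = real N / 2 + s" "(2 * s - \<tau>) / 2 = s - \<tau> / 2" by (simp_all add: field_simps)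
  have "frac_const N s * (- (1/2) * (2 * (pi powr (real N / 2) / Gamma (1 - \<tau> / 2)) * (Gamma (s - \<tau> / 2) * P * Beta (1 - s) c
      * (real N / 2 - (s - \<tau> / 2) * c / s)) / Gamma (real N / 2 + s)))
    = - (2 powr (2 * s) * (pi powr (- real N / 2) * pi powr (real N / 2)) * Gamma (s - \<tau> / 2) * P * Gamma c / (Gamma (1 - \<tau> / 2) * Gamma (1 - s + c))
       * (s * (real N / 2 - (s - \<tau> / 2) * c / s)))"
  proof -
    have "A * B * s * (g3 / g2) * (- (1/2) * (2 * (C / g1) * (g4 * P * (g2 * gc / g5) * E) / g3))
      = - (A * (B * C) * g4 * P * gc / (g1 * g5) * (s * E))"
      if "g1 > 0" "g2 > 0" "g3 > 0" "g5 > 0" for A B C E g1 g2 g3 g4 g5 gc :: real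
      using that by (simp add: field_simps)
    from this[OF G] show ?thesis unfolding frac_const_def a Beta_def .
  qed
  also have "\<dots> = c_s N s \<tau> * P"
    unfolding pp e c_s_def r1 r2 a c_def[symmetric] by (simp add: mult_ac)
  finally show ?thesis unfolding c_def .
qed

text \<open>The truncated domain is symmetric about x, so for each \<epsilon> the integral is -1/2
  times that of the second difference over |y| \<ge> \<epsilon>. The full second difference is
  integrable, and dominated convergence removes the truncation.\<close>

theorem truncated_frac_laplacian_powr_tendsto:
  fixes x :: "'a::euclidean_space" and s \<tau> :: real
  assumes s: "0 < s" "s < 1" and \<tau>: "- real DIM('a) < \<tau>" "\<tau> < 2 * s" and x: "x \<noteq> 0"
  shows "(truncated_frac_laplacian s (\<lambda>z. norm z powr \<tau>) x \<longlongrightarrow> c_s DIM('a) s \<tau> * norm x powr (\<tau> - 2 * s)) (at_right 0)"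
proof -
  let ?p = "real DIM('a) + 2 * s"
  define D where "D = (\<lambda>y. norm (x + y) powr \<tau> + norm (x - y) powr \<tau> - 2 * norm x powr \<tau>)"
  have [measurable]: "D \<in> borel_measurable borel" by (simp add: D_def)
  have intD: "integrable lborel (\<lambda>y. D y * norm y powr (- ?p))"
    unfolding D_def by (rule integrable_second_difference[OF s \<tau> x])
  have trunc: "truncated_frac_laplacian s (\<lambda>z. norm z powr \<tau>) x \<epsilon>
    = frac_const DIM('a) s * (- (1/2) * (\<integral>y. indicator (- ball 0 \<epsilon>) y * (D y * norm y powr (- ?p)) \<partial>lborel))" if e: "\<epsilon> > 0" for \<epsilon>
  proof -
    define T where "T = (\<lambda>z. indicator (- ball x \<epsilon>) z * ((norm x powr \<tau> - norm z powr \<tau>) / norm (x - z) powr ?p))"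
    have mT: "T \<in> borel_measurable borel" by (auto simp: T_def)
    have "integrable lebesgue T"
      using set_integrable_frac_quotient[OF powr_L1s[OF \<tau> s(1)] s(1) e, of x "norm x powr \<tau>"] by (simp add: T_def set_integrable_def)
    then have "integrable lborel T" using mT by (subst (asm) integrable_completion) auto
    then obtain I where I: "has_bochner_integral lborel T I" by (auto simp: has_bochner_integral_iff)
    have "has_bochner_integral lborel (\<lambda>y. T (x + y) + T (x - y)) (I + I)"
      by (intro has_bochner_integral_add) (simp_all only: lborel_has_bochner_integral_plus[OF mT] lborel_has_bochner_integral_minus[OF mT] I)
    moreover have "T (x + y) + T (x - y) = - (indicator (- ball 0 \<epsilon>) y * (D y * norm y powr (- ?p)))" for y
    proof (cases "norm y < \<epsilon>")
      case False
      have "T (x + y) = (norm x powr \<tau> - norm (x + y) powr \<tau>) * norm y powr (- ?p)" "T (x - y) = (norm x powr \<tau> - norm (x - y) powr \<tau>) * norm y powr (- ?p)"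
        using False by (simp_all add: T_def dist_norm divide_powr_uminus)
      then show ?thesis using False by (simp add: D_def algebra_simps)
    qed (simp add: T_def dist_norm)
    ultimately have "I + I = - (\<integral>y. indicator (- ball 0 \<epsilon>) y * (D y * norm y powr (- ?p)) \<partial>lborel)"
      by (simp add: has_bochner_integral_iff)
    then have "I = - (1/2) * (\<integral>y. indicator (- ball 0 \<epsilon>) y * (D y * norm y powr (- ?p)) \<partial>lborel)"
      by simp
    moreover have "(LINT z:- ball x \<epsilon>|lebesgue. (norm x powr \<tau> - norm z powr \<tau>) / norm (x - z) powr ?p) = I"
      unfolding set_lebesgue_integral_def using I mT integral_completion[of T lborel]
      by (simp add: T_def has_bochner_integral_iff)
    ultimately show ?thesis unfolding truncated_frac_laplacian_def by (simp only:)
  qed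
  have lim: "((\<lambda>\<epsilon>. (\<integral>y. indicator (- ball 0 \<epsilon>) y * (D y * norm y powr (- ?p)) \<partial>lborel)) \<longlongrightarrow> (\<integral>y. D y * norm y powr (- ?p) \<partial>lborel)) (at_right 0)"
  proof (rule tendsto_at_right_sequentially[of 0 1])
    fix S :: "nat \<Rightarrow> real" assume S: "\<And>n. 0 < S n" "S \<longlonglongrightarrow> 0"
    show "(\<lambda>n. \<integral>y. indicator (- ball 0 (S n)) y * (D y * norm y powr (- ?p)) \<partial>lborel) \<longlonglongrightarrow> (\<integral>y. D y * norm y powr (- ?p) \<partial>lborel)"
    proof (rule integral_dominated_convergence)
      show "integrable lborel (\<lambda>y. \<bar>D y * norm y powr (- ?p)\<bar>)" using intD by (rule integrable_abs)
      show "AE y in lborel. (\<lambda>n. indicator (- ball 0 (S n)) y * (D y * norm y powr (- ?p))) \<longlonglongrightarrow> D y * norm y powr (- ?p)"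
      proof (rule AE_I2)
        fix y :: 'a
        show "(\<lambda>n. indicator (- ball 0 (S n)) y * (D y * norm y powr (- ?p))) \<longlonglongrightarrow> D y * norm y powr (- ?p)"
        proof (cases "y = 0")
          case False
          then have "\<forall>\<^sub>F n in sequentially. S n < norm y" using S(2) by (intro order_tendstoD) auto
          then have "\<forall>\<^sub>F n in sequentially. indicator (- ball 0 (S n)) y * (D y * norm y powr (- ?p)) = D y * norm y powr (- ?p)"
            by eventually_elim simp
          then show ?thesis by (rule tendsto_eventually)
        qed simp
      qed
    qed (auto simp: indicator_def)
  qed simp
  have "((\<lambda>\<epsilon>. frac_const DIM('a) s * (- (1/2) * (\<integral>y. indicator (- ball 0 \<epsilon>) y * (D y * norm y powr (- ?p)) \<partial>lborel)))
    \<longlongrightarrow> frac_const DIM('a) s * (- (1/2) * (\<integral>y. D y * norm y powr (- ?p) \<partial>lborel))) (at_right 0)"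
    by (intro tendsto_mult tendsto_const lim)
  also have "frac_const DIM('a) s * (- (1/2) * (\<integral>y. D y * norm y powr (- ?p) \<partial>lborel)) = c_s DIM('a) s \<tau> * norm x powr (\<tau> - 2 * s)"
  proof -
    have "((norm x)\<^sup>2) powr (\<tau> / 2 - s) = norm x powr (\<tau> - 2 * s)"
      using x by (simp add: powr_powr algebra_simps flip: powr_numeral)
    then show ?thesis
      unfolding D_def integral_second_difference[OF s \<tau> x]
      using frac_const_mult_eq_c_s[OF s \<tau>, of "norm x powr (\<tau> - 2 * s)"] by simp
  qed
  finally show ?thesis
  proof (rule Lim_transform_eventually)
    show "\<forall>\<^sub>F \<epsilon> in at_right 0. frac_const DIM('a) s * (- (1/2) * (\<integral>y. indicator (- ball 0 \<epsilon>) y * (D y * norm y powr (- ?p)) \<partial>lborel)) = truncated_frac_laplacian s (\<lambda>z. norm z powr \<tau>) x \<epsilon>"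
      using eventually_at_right_less[of "0::real"] by eventually_elim (simp only: trunc)
  qed
qed

section \<open>The exponent \<open>\<tau>_+\<close>\<close>

lemma c_s_symmetric: "c_s N s (2 * s - real N - \<tau>) = c_s N s \<tau>"
proof -
  have "(real N + (2 * s - real N - \<tau>)) / 2 = (2 * s - \<tau>) / 2" "(2 * s - (2 * s - real N - \<tau>)) / 2 = (real N + \<tau>) / 2"
    "- (2 * s - real N - \<tau>) / 2 = (real N - 2 * s + \<tau>) / 2" "(real N - 2 * s + (2 * s - real N - \<tau>)) / 2 = - \<tau> / 2"
    by (simp_all add: field_simps)
  then show ?thesis unfolding c_s_def by (simp only: mult_ac)
qed

lemma rGamma_minus_neg:
  fixes y :: real
  assumes "0 < y" "y < 1"
  shows "rGamma (- y) < 0"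
proof -
  have "rGamma (- y) = - y * rGamma (- y + 1)" by (rule rGamma_plus1[symmetric])
  moreover have "rGamma (- y + 1) > 0"
    using assms by (simp add: rGamma_inverse_Gamma Gamma_real_pos)
  ultimately show ?thesis using assms by (simp add: mult_less_0_iff)
qed

text \<open>Among the factors only 1 / Gamma(-\<tau>/2) is negative on this range. It excludes
  positive zeros when \<mu> = 0, which forces \<tau>_+ = 0 there.\<close>

lemma c_s_neg:
  fixes s \<tau> :: real
  assumes "0 < s" "s < 1" "N \<ge> 2" "0 < \<tau>" "\<tau> < 2 * s"
  shows "c_s N s \<tau> < 0"
proof -
  have N: "real N \<ge> 2" using assms by simp
  have "rGamma (- (\<tau> / 2)) < 0" using assms by (intro rGamma_minus_neg) auto
  moreover have "rGamma ((real N - 2 * s + \<tau>) / 2) > 0" "Gamma ((real N + \<tau>) / 2) > 0" "Gamma ((2 * s - \<tau>) / 2) > 0"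
    using assms N by (auto simp: rGamma_inverse_Gamma intro!: Gamma_real_pos)
  ultimately show ?thesis unfolding c_s_def
    by (intro mult_neg_pos mult_pos_neg mult_pos_pos) simp_all
qed

text \<open>\<open>c_s\<close> has a pole at 2s. Multiplying by (2s - \<tau>) / 2 absorbs it into
  the Gamma function and gives a function h that is continuous on [0, 2s], with h 0 = \<mu> s \<ge>
  0 and h (2s) < 0. Its zero set there is compact and nonempty, so a greatest zero exists and
  \<open>GREATEST\<close> is well defined; beyond it a nonnegative value of h would force a further
  zero by the intermediate value theorem.\<close>

lemma tau_plus_properties:
  fixes s \<mu> :: real
  assumes s: "0 < s" "s < 1" and N: "N \<ge> 2" and \<mu>: "\<mu> \<ge> 0"
  shows "0 \<le> tau_plus N s \<mu>" "tau_plus N s \<mu> < 2 * s"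
    "\<And>\<tau>. tau_plus N s \<mu> < \<tau> \<Longrightarrow> \<tau> < 2 * s \<Longrightarrow> c_s N s \<tau> + \<mu> < 0"
    "\<mu> = 0 \<Longrightarrow> tau_plus N s \<mu> = 0" "\<mu> > 0 \<Longrightarrow> tau_plus N s \<mu> > 0"
proof -
  have N': "real N \<ge> 2" using N by simp
  define h where "h = (\<lambda>\<tau>. 2 powr (2 * s) * Gamma ((real N + \<tau>) / 2) * Gamma ((2 * s - \<tau>) / 2 + 1)
       * rGamma (- \<tau> / 2) * rGamma ((real N - 2 * s + \<tau>) / 2) + \<mu> * ((2 * s - \<tau>) / 2))"
  have hc: "h \<tau> = (c_s N s \<tau> + \<mu>) * ((2 * s - \<tau>) / 2)" if "\<tau> < 2 * s" for \<tau>
  proof -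
    have "(2 * s - \<tau>) / 2 \<notin> \<int>\<^sub>\<le>\<^sub>0" using that by (auto dest: nonpos_Ints_nonpos)
    then have g: "Gamma ((2 * s - \<tau>) / 2 + 1) = (2 * s - \<tau>) / 2 * Gamma ((2 * s - \<tau>) / 2)"
      by (rule Gamma_plus1)
    have "A * B * (D * G) * E * F + \<mu> * D = (A * B * G * E * F + \<mu>) * D" for A B D E F G :: real
      by (simp add: algebra_simps)
    then show ?thesis unfolding h_def c_s_def g .
  qed
  have cont: "continuous_on {0..2 * s} h"
  proof (rule continuous_at_imp_continuous_on, rule ballI)
    fix \<tau> assume "\<tau> \<in> {0..2 * s}"
    then have "0 < (real N + \<tau>) / 2" "0 < (2 * s - \<tau>) / 2 + 1" using N' by (auto simp: field_simps)
    then have "(real N + \<tau>) / 2 \<notin> \<int>\<^sub>\<le>\<^sub>0" "(2 * s - \<tau>) / 2 + 1 \<notin> \<int>\<^sub>\<le>\<^sub>0"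
      by (auto dest!: nonpos_Ints_nonpos)
    then show "isCont h \<tau>" unfolding h_def by (intro continuous_intros) auto
  qed
  have h2s: "h (2 * s) < 0"
  proof -
    have "rGamma (- s) < 0" using s by (intro rGamma_minus_neg) auto
    moreover have "rGamma (real N / 2) > 0" "Gamma ((real N + 2 * s) / 2) > 0"
      using s N' by (auto simp: rGamma_inverse_Gamma intro!: Gamma_real_pos)
    ultimately have "2 powr (2 * s) * Gamma ((real N + 2 * s) / 2) * 1 * rGamma (- s) * rGamma (real N / 2) < 0"
      by (intro mult_neg_pos mult_pos_neg mult_pos_pos) simp_all
    then show ?thesis unfolding h_def by simp
  qed
  have h0: "h 0 = \<mu> * s" by (simp add: h_def)
  have ivt: "\<exists>z. \<tau> \<le> z \<and> z \<le> 2 * s \<and> h z = 0" if "0 \<le> \<tau>" "\<tau> \<le> 2 * s" "h \<tau> \<ge> 0" for \<tau>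
  proof -
    have "continuous_on {\<tau>..2 * s} h" by (rule continuous_on_subset[OF cont]) (use that in simp)
    then have "\<exists>z\<ge>\<tau>. z \<le> 2 * s \<and> h z = 0"
      by (rule IVT2'[rotated 3]) (use that h2s in simp_all)
    then show ?thesis by blast
  qed
  define Z where "Z = {\<tau> \<in> {0..2 * s}. h \<tau> = 0}"
  have "closed Z" unfolding Z_def by (rule continuous_closed_preimage_constant[OF cont]) simp
  moreover have "bounded Z" by (rule bounded_subset[of "{0..2 * s}"]) (auto simp: Z_def)
  ultimately have cZ: "compact Z" by (simp add: compact_eq_bounded_closed)
  have "Z \<noteq> {}"
  proof -
    have "h 0 \<ge> 0" unfolding h0 using s \<mu> by simp
    then obtain y where "0 \<le> y" "y \<le> 2 * s" "h y = 0" using ivt[of 0] s by auto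
    then have "y \<in> Z" by (simp add: Z_def)
    then show ?thesis by blast
  qed
  then obtain z where z: "z \<in> Z" "\<And>y. y \<in> Z \<Longrightarrow> y \<le> z"
    using compact_attains_sup[OF cZ] by metis
  have z0: "0 \<le> z" "z < 2 * s" "h z = 0"
  proof -
    show "0 \<le> z" and hz: "h z = 0" using z(1) by (simp_all add: Z_def)
    have "z \<noteq> 2 * s" using hz h2s by (metis less_irrefl)
    then show "z < 2 * s" using z(1) by (simp add: Z_def)
  qed
  have h_zero: "h \<tau> = 0 \<longleftrightarrow> c_s N s \<tau> + \<mu> = 0" if "\<tau> < 2 * s" for \<tau>
    unfolding hc[OF that] using that by simp
  have cz: "c_s N s z + \<mu> = 0" using h_zero[of z] z0 by simp
  have t: "tau_plus N s \<mu> = z"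
    unfolding tau_plus_def
  proof (rule Greatest_equality)
    have "- real N < z" using z0(1) N' by linarith
    then show "z \<in> {- real N<..<2 * s} \<and> c_s N s z + \<mu> = 0"
      using z0(2) cz by simp
    fix y assume y: "y \<in> {- real N<..<2 * s} \<and> c_s N s y + \<mu> = 0"
    show "y \<le> z"
    proof (cases "y \<ge> 0")
      case True
      then have "y \<in> Z" using y h_zero[of y] by (simp add: Z_def)
      then show ?thesis by (rule z(2))
    next
      case False
      then show ?thesis using z0(1) by linarith
    qed
  qed
  show "0 \<le> tau_plus N s \<mu>" "tau_plus N s \<mu> < 2 * s" unfolding t using z0 by simp_all
  show "c_s N s \<tau> + \<mu> < 0" if \<tau>: "tau_plus N s \<mu> < \<tau>" "\<tau> < 2 * s" for \<tau>
  proof (rule ccontr)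
    assume "\<not> c_s N s \<tau> + \<mu> < 0"
    then have "0 \<le> (c_s N s \<tau> + \<mu>) * ((2 * s - \<tau>) / 2)" using \<tau>(2) by (intro mult_nonneg_nonneg) auto
    then have "h \<tau> \<ge> 0" using hc[OF \<tau>(2)] by simp
    moreover have "0 \<le> \<tau>" "z < \<tau>" using \<tau>(1) z0(1) unfolding t by linarith+
    ultimately obtain y where y: "\<tau> \<le> y" "y \<le> 2 * s" "h y = 0" using ivt[of \<tau>] \<tau>(2) by auto
    then have "y \<in> Z" using \<open>0 \<le> \<tau>\<close> by (simp add: Z_def)
    then show False using z(2)[of y] y(1) \<open>z < \<tau>\<close> by linarith
  qed
  show "tau_plus N s \<mu> = 0" if "\<mu> = 0"
  proof (rule ccontr)
    assume "tau_plus N s \<mu> \<noteq> 0"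
    then have "0 < z" using z0(1) t by linarith
    then have "c_s N s z < 0" using z0(2) by (rule c_s_neg[OF s N])
    then show False using cz that by linarith
  qed
  show "tau_plus N s \<mu> > 0" if "\<mu> > 0"
  proof -
    have "h 0 \<noteq> 0" unfolding h0 using that s by simp
    then have "z \<noteq> 0" using z0(3) by (intro notI) simp
    then show ?thesis using z0(1) t by linarith
  qed
qed

section \<open>Comparison principles\<close>

lemma frac_laplacian_le:
  fixes u :: "'a::euclidean_space \<Rightarrow> real" and s :: real
  assumes "frac_laplacian_exists s u x" and "(T \<longlongrightarrow> L) (at_right 0)"
    and "\<And>\<epsilon>. \<epsilon> > 0 \<Longrightarrow> \<epsilon> < \<epsilon>0 \<Longrightarrow> truncated_frac_laplacian s u x \<epsilon> \<le> T \<epsilon>" and "\<epsilon>0 > 0"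
  shows "frac_laplacian s u x \<le> L"
proof -
  obtain M where M: "(truncated_frac_laplacian s u x \<longlongrightarrow> M) (at_right 0)"
    using assms(1) by (auto simp: frac_laplacian_exists_def)
  then have "frac_laplacian s u x = M"
    unfolding frac_laplacian_def by (intro tendsto_Lim) auto
  moreover have "M \<le> L"
  proof (rule tendsto_le[OF _ assms(2) M])
    show "\<forall>\<^sub>F \<epsilon> in at_right 0. truncated_frac_laplacian s u x \<epsilon> \<le> T \<epsilon>"
      using eventually_at_right_less[of "0::real"] eventually_at_right_real[OF assms(4)]
      by eventually_elim (use assms(3) in auto)
  qed simp
  ultimately show ?thesis by simp
qed

text \<open>Two powers and a constant cover every barrier used below. The constant has fractional
  Laplacian 0 and is felt only through the potential, as d \<mu> |x|^(-2s).\<close>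

lemma hardy_operator_touching:
  fixes u :: "'a::euclidean_space \<Rightarrow> real" and s \<mu> \<alpha> \<gamma> a b d :: real
  assumes s: "0 < s" "s < 1" and \<alpha>: "- real DIM('a) < \<alpha>" "\<alpha> < 2 * s" and \<gamma>: "- real DIM('a) < \<gamma>" "\<gamma> < 2 * s"
    and x: "x \<noteq> 0" and u: "u \<in> L1s s" and ex: "frac_laplacian_exists s u x"
    and le: "\<And>z. z \<noteq> 0 \<Longrightarrow> a * norm z powr \<alpha> + b * norm z powr \<gamma> + d \<le> u z"
    and eq: "a * norm x powr \<alpha> + b * norm x powr \<gamma> + d = u x"
  shows "hardy_operator s \<mu> u x \<le> a * (c_s DIM('a) s \<alpha> + \<mu>) * norm x powr (\<alpha> - 2 * s)
     + b * (c_s DIM('a) s \<gamma> + \<mu>) * norm x powr (\<gamma> - 2 * s) + d * \<mu> * norm x powr (- 2 * s)"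
proof -
  let ?f = "\<lambda>z::'a. norm z powr \<alpha>" and ?g = "\<lambda>z::'a. norm z powr \<gamma>"
  define \<phi> where "\<phi> = (\<lambda>z::'a. a * ?f z + b * ?g z + d)"
  have f: "?f \<in> L1s s" and g: "?g \<in> L1s s" using powr_L1s \<alpha> \<gamma> s by auto
  have "(\<lambda>z. (a * ?f z + b * ?g z) + d) \<in> L1s s"
    by (intro L1s_add L1s_cmult f g const_L1s s)
  then have \<phi>: "\<phi> \<in> L1s s" by (simp add: \<phi>_def)
  have "AE z::'a in lebesgue. z \<noteq> 0" using AE_lborel_singleton by (rule AE_completion)
  then have ae: "AE z in lebesgue. \<phi> z \<le> u z" by eventually_elim (use le in \<open>simp add: \<phi>_def\<close>)
  have "frac_laplacian s u x \<le> a * (c_s DIM('a) s \<alpha> * norm x powr (\<alpha> - 2 * s)) + b * (c_s DIM('a) s \<gamma> * norm x powr (\<gamma> - 2 * s))"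
  proof (rule frac_laplacian_le[OF ex])
    show "((\<lambda>\<epsilon>. a * truncated_frac_laplacian s ?f x \<epsilon> + b * truncated_frac_laplacian s ?g x \<epsilon>)
      \<longlongrightarrow> a * (c_s DIM('a) s \<alpha> * norm x powr (\<alpha> - 2 * s)) + b * (c_s DIM('a) s \<gamma> * norm x powr (\<gamma> - 2 * s))) (at_right 0)"
      by (intro tendsto_add tendsto_mult tendsto_const truncated_frac_laplacian_powr_tendsto s \<alpha> \<gamma> x)
    show "truncated_frac_laplacian s u x \<epsilon> \<le> a * truncated_frac_laplacian s ?f x \<epsilon> + b * truncated_frac_laplacian s ?g x \<epsilon>"
      if e: "\<epsilon> > 0" for \<epsilon>
    proof -
      have "truncated_frac_laplacian s u x \<epsilon> \<le> truncated_frac_laplacian s \<phi> x \<epsilon>"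
        using eq by (intro truncated_frac_laplacian_mono[OF s e u \<phi> ae]) (simp add: \<phi>_def)
      also have "\<dots> = a * truncated_frac_laplacian s ?f x \<epsilon> + b * truncated_frac_laplacian s ?g x \<epsilon>"
        unfolding \<phi>_def by (rule truncated_frac_laplacian_linear[OF s(1) e f g])
      finally show ?thesis .
    qed
  qed (rule zero_less_one)
  moreover have "\<mu> / norm x powr (2 * s) * u x = a * (\<mu> * norm x powr (\<alpha> - 2 * s)) + b * (\<mu> * norm x powr (\<gamma> - 2 * s)) + d * \<mu> * norm x powr (- 2 * s)"
    unfolding eq[symmetric] using x by (simp add: powr_diff powr_minus field_simps)
  ultimately show ?thesis unfolding hardy_operator_def by (simp add: algebra_simps)
qed

text \<open>If the barrier exceeds u somewhere, u minus the barrier has a negative minimum m over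
  the compact annulus, and the barrier shifted by m touches u from below. As \<mu> \<ge> 0, the
  shift only decreases the potential term, so the strict subsolution inequality contradicts the
  supersolution property. The operator is nonlocal, hence the order is demanded on the whole
  complement of the annulus; the subsolution inequality is demanded only where u lies below the
  barrier, which a later barrier exploits.\<close>

lemma annulus_comparison:
  fixes u :: "'a::euclidean_space \<Rightarrow> real" and s \<mu> \<alpha> \<gamma> a b d \<delta> \<rho> :: real
  assumes s: "0 < s" "s < 1" and \<alpha>: "- real DIM('a) < \<alpha>" "\<alpha> < 2 * s" and \<gamma>: "- real DIM('a) < \<gamma>" "\<gamma> < 2 * s"
    and \<mu>: "\<mu> \<ge> 0" and \<delta>: "\<delta> > 0" and u: "u \<in> L1s s"
    and super: "\<And>x. \<delta> \<le> norm x \<Longrightarrow> norm x \<le> \<rho> \<Longrightarrow> frac_laplacian_exists s u x \<and> 0 \<le> hardy_operator s \<mu> u x"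
    and cont: "continuous_on {x. \<delta> \<le> norm x \<and> norm x \<le> \<rho>} u"
    and out: "\<And>z. z \<noteq> 0 \<Longrightarrow> norm z < \<delta> \<or> \<rho> < norm z \<Longrightarrow> a * norm z powr \<alpha> + b * norm z powr \<gamma> + d \<le> u z"
    and sub: "\<And>x. \<delta> \<le> norm x \<Longrightarrow> norm x \<le> \<rho> \<Longrightarrow> u x < a * norm x powr \<alpha> + b * norm x powr \<gamma> + d \<Longrightarrow>
      a * (c_s DIM('a) s \<alpha> + \<mu>) * norm x powr (\<alpha> - 2 * s) + b * (c_s DIM('a) s \<gamma> + \<mu>) * norm x powr (\<gamma> - 2 * s) + d * \<mu> * norm x powr (- 2 * s) < 0"
    and x: "x \<noteq> 0"
  shows "a * norm x powr \<alpha> + b * norm x powr \<gamma> + d \<le> u x"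
proof (rule ccontr)
  define A where "A = {x::'a. \<delta> \<le> norm x \<and> norm x \<le> \<rho>}"
  define \<phi> where "\<phi> = (\<lambda>z::'a. a * norm z powr \<alpha> + b * norm z powr \<gamma> + d)"
  assume "\<not> a * norm x powr \<alpha> + b * norm x powr \<gamma> + d \<le> u x"
  then have neg: "u x < \<phi> x" by (simp add: \<phi>_def)
  then have xA: "x \<in> A" using out[OF x] by (force simp: A_def \<phi>_def)
  have "A = cball 0 \<rho> - ball 0 \<delta>" by (auto simp: A_def)
  then have "compact A" by (simp add: compact_diff)
  moreover have "continuous_on A (\<lambda>z. u z - \<phi> z)"
    unfolding \<phi>_def using cont \<delta> by (auto simp: A_def intro!: continuous_intros)
  ultimately obtain y where y: "y \<in> A" "\<And>z. z \<in> A \<Longrightarrow> u y - \<phi> y \<le> u z - \<phi> z"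
    using continuous_attains_inf[of A "\<lambda>z. u z - \<phi> z"] xA by blast
  define m where "m = u y - \<phi> y"
  have m: "m < 0" using y(2)[OF xA] neg by (simp add: m_def)
  have yn: "\<delta> \<le> norm y" "norm y \<le> \<rho>" "y \<noteq> 0" using y(1) \<delta> by (auto simp: A_def)
  have "hardy_operator s \<mu> u y \<le> a * (c_s DIM('a) s \<alpha> + \<mu>) * norm y powr (\<alpha> - 2 * s)
     + b * (c_s DIM('a) s \<gamma> + \<mu>) * norm y powr (\<gamma> - 2 * s) + (d + m) * \<mu> * norm y powr (- 2 * s)"
  proof (rule hardy_operator_touching[OF s \<alpha> \<gamma> yn(3) u])
    show "frac_laplacian_exists s u y" using super yn by blast
    show "a * norm z powr \<alpha> + b * norm z powr \<gamma> + (d + m) \<le> u z" if "z \<noteq> 0" for z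
    proof (cases "z \<in> A")
      case True
      then show ?thesis using y(2)[OF True] by (simp add: m_def \<phi>_def)
    next
      case False
      then show ?thesis using out[OF that] m by (force simp: A_def)
    qed
  qed (simp add: m_def \<phi>_def)
  also have "\<dots> \<le> a * (c_s DIM('a) s \<alpha> + \<mu>) * norm y powr (\<alpha> - 2 * s)
     + b * (c_s DIM('a) s \<gamma> + \<mu>) * norm y powr (\<gamma> - 2 * s) + d * \<mu> * norm y powr (- 2 * s)"
    using m \<mu> by (intro add_left_mono mult_right_mono) auto
  also have "\<dots> < 0"
    using m by (intro sub yn) (simp add: m_def \<phi>_def)
  finally show False using super[OF yn(1,2)] by simp
qed

section \<open>Estimates at a minimum point, and strict positivity\<close>

text \<open>Substituting r y for y produces r^N r^(-N-2s) = r^(-2s). This makes the constant of the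
  next lemma independent of the radius.\<close>

lemma integral_truncated_kernel_scale:
  fixes r s :: real
  assumes r: "r > 0" and s: "0 < s" "s < 1"
  shows "has_bochner_integral lborel (\<lambda>y::'a::euclidean_space. min 1 ((norm y)\<^sup>2 / r\<^sup>2) * norm y powr (- (DIM('a) + 2 * s)))
    (r powr (- 2 * s) * (\<integral>y. min 1 ((norm (y::'a))\<^sup>2) * norm y powr (- (DIM('a) + 2 * s)) \<partial>lborel))"
proof -
  let ?p = "real DIM('a) + 2 * s"
  define f where "f = (\<lambda>y::'a. min 1 ((norm y)\<^sup>2 / r\<^sup>2) * norm y powr (- ?p))"
  define k where "k = (\<lambda>y::'a. min 1 ((norm y)\<^sup>2) * norm y powr (- ?p))"
  have [measurable]: "f \<in> borel_measurable borel" by (simp add: f_def)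
  have fk: "f (r *\<^sub>R y) = r powr (- ?p) * k y" for y
    using r by (simp add: f_def k_def powr_mult power_mult_distrib)
  have k: "integrable lborel k" unfolding k_def by (rule integrable_truncated_kernel[OF s])
  have L: "lborel = density (distr lborel borel (\<lambda>y::'a. r *\<^sub>R y)) (\<lambda>_. ennreal (r ^ DIM('a)))"
    using lborel_affine[of r "0::'a"] r by simp
  have "has_bochner_integral lborel (\<lambda>y. r ^ DIM('a) * (r powr (- ?p) * k y)) (r ^ DIM('a) * (r powr (- ?p) * integral\<^sup>L lborel k))"
    using k by (intro has_bochner_integral_mult_right has_bochner_integral_integrable)
  then have "has_bochner_integral (distr lborel borel (\<lambda>y::'a. r *\<^sub>R y)) (\<lambda>y. r ^ DIM('a) * f y) (r ^ DIM('a) * (r powr (- ?p) * integral\<^sup>L lborel k))"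
    by (simp add: has_bochner_integral_iff integrable_distr_eq integral_distr fk)
  then have "has_bochner_integral (density (distr lborel borel (\<lambda>y::'a. r *\<^sub>R y)) (\<lambda>_. ennreal (r ^ DIM('a)))) f (r ^ DIM('a) * (r powr (- ?p) * integral\<^sup>L lborel k))"
    using r by (intro has_bochner_integral_density) auto
  then have "has_bochner_integral lborel f (r ^ DIM('a) * (r powr (- ?p) * integral\<^sup>L lborel k))"
    using L by simp
  moreover have "r ^ DIM('a) * r powr (- ?p) = r powr (- 2 * s)"
    using r by (simp add: powr_realpow[symmetric] powr_add[symmetric])
  ultimately show ?thesis by (simp add: f_def k_def mult.assoc[symmetric])
qed

text \<open>At a minimum point x of \<open>z \<mapsto> u z + u x0 * |z - x0|^2 / r^2\<close> over the ball, the paraboloid touching \<open>u\<close> from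
  below at x is nonpositive outside the ball, so it stays below \<open>u\<close> everywhere.\<close>

lemma frac_laplacian_near_minimum:
  fixes s :: real
  assumes s: "0 < s" "s < 1"
  obtains C where "C \<ge> 0" "\<And>(u :: 'a::euclidean_space \<Rightarrow> real) x0 r. r > 0 \<Longrightarrow> u \<in> L1s s \<Longrightarrow> continuous_on (cball x0 r) u \<Longrightarrow> 0 \<notin> cball x0 r \<Longrightarrow>
      (\<And>z. z \<noteq> 0 \<Longrightarrow> u z \<ge> 0) \<Longrightarrow> (\<And>x. x \<in> cball x0 r \<Longrightarrow> frac_laplacian_exists s u x) \<Longrightarrow>
      \<exists>x\<in>cball x0 r. u x \<le> u x0 \<and> frac_laplacian s u x \<le> C * r powr (- 2 * s) * u x0"
proof -
  let ?p = "real DIM('a) + 2 * s"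
  define k where "k = (\<integral>y. min 1 ((norm (y::'a))\<^sup>2) * norm y powr (- ?p) \<partial>lborel)"
  define C where "C = frac_const DIM('a) s * k"
  have fc: "frac_const DIM('a) s > 0" by (rule frac_const_pos[OF s])
  have k: "k \<ge> 0" unfolding k_def by (intro Bochner_Integration.integral_nonneg) simp
  have "\<exists>x\<in>cball x0 r. u x \<le> u x0 \<and> frac_laplacian s u x \<le> C * r powr (- 2 * s) * u x0"
    if r: "r > 0" and u: "u \<in> L1s s" and cont: "continuous_on (cball x0 r) u" and 0: "0 \<notin> cball x0 r"
      and nn: "\<And>z. z \<noteq> 0 \<Longrightarrow> u z \<ge> 0" and ex: "\<And>x. x \<in> cball x0 r \<Longrightarrow> frac_laplacian_exists s u x"
    for u :: "'a \<Rightarrow> real" and x0 r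
  proof -
    define M where "M = u x0"
    have "x0 \<noteq> 0" using 0 r by auto
    then have M: "M \<ge> 0" using nn by (simp add: M_def)
    define g where "g = (\<lambda>z. u z + M * (norm (z - x0))\<^sup>2 / r\<^sup>2)"
    have "continuous_on (cball x0 r) g" unfolding g_def using cont r by (intro continuous_intros) auto
    then obtain x where x: "x \<in> cball x0 r" "\<And>z. z \<in> cball x0 r \<Longrightarrow> g x \<le> g z"
      using continuous_attains_inf[of "cball x0 r" g] r by auto
    have gx: "g x \<le> M" using x(2)[of x0] r by (simp add: g_def M_def)
    have ux: "u x \<le> g x" using M by (simp add: g_def)
    have gz: "g x \<le> g z" if "z \<noteq> 0" for z
    proof (cases "z \<in> cball x0 r")
      case False
      then have "r\<^sup>2 \<le> (norm (z - x0))\<^sup>2" using r by (intro power_mono) (auto simp: dist_norm norm_minus_commute)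
      then have "M * 1 \<le> M * ((norm (z - x0))\<^sup>2 / r\<^sup>2)" using r M by (intro mult_left_mono) auto
      then show ?thesis using gx nn[OF that] by (simp add: g_def)
    qed (rule x(2))
    define e where "e = x - x0"
    \<comment> \<open>The increment of the paraboloid about x splits into an even part
      \<open>mi\<close> and a linear, hence odd, part \<open>od\<close>. The linear part is cut off
      at radius r, which keeps it integrable off a ball, and its integral vanishes by symmetry.
      Capping the even part at 1 matches the trivial bound u x - u z \<le> M at distance at least
      r.\<close>
    define od where "od = (\<lambda>y. if norm y < r then 2 * (e \<bullet> y) / r\<^sup>2 else 0)"
    define mi where "mi = (\<lambda>y::'a. min 1 ((norm y)\<^sup>2 / r\<^sup>2))"
    have key: "u x - u z \<le> M * (mi (z - x) + od (z - x))" if "z \<noteq> 0" for z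
    proof (cases "norm (z - x) < r")
      case True
      then have "(norm (z - x))\<^sup>2 \<le> r\<^sup>2" by (intro power_mono) auto
      then have mi: "mi (z - x) = (norm (z - x))\<^sup>2 / r\<^sup>2" using r by (simp add: mi_def min_def)
      have "(norm (z - x0))\<^sup>2 - (norm (x - x0))\<^sup>2 = 2 * (e \<bullet> (z - x)) + (norm (z - x))\<^sup>2"
        unfolding e_def power2_norm_eq_inner by (simp add: inner_diff_left inner_diff_right inner_commute)
      then have "M * ((norm (z - x0))\<^sup>2 - (norm (x - x0))\<^sup>2) / r\<^sup>2 = M * (mi (z - x) + od (z - x))"
        using True unfolding mi by (simp add: od_def add_divide_distrib[symmetric] add.commute)
      then show ?thesis using gz[OF that] by (simp add: g_def right_diff_distrib diff_divide_distrib)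
    next
      case False
      then have "r\<^sup>2 \<le> (norm (z - x))\<^sup>2" using r by (intro power_mono) auto
      then have "mi (z - x) = 1" "od (z - x) = 0" using r False by (auto simp: mi_def od_def)
      then show ?thesis using nn[OF that] gx ux by simp
    qed
    have trunc: "truncated_frac_laplacian s u x \<epsilon> \<le> C * r powr (- 2 * s) * M" if \<epsilon>: "\<epsilon> > 0" for \<epsilon>
    proof -
      let ?i = "indicator (- ball 0 \<epsilon>) :: 'a \<Rightarrow> real"
      define K1 where "K1 = (\<lambda>y::'a. ?i y * (mi y * norm y powr (- ?p)))"
      define K2 where "K2 = (\<lambda>y::'a. ?i y * (od y * norm y powr (- ?p)))"
      have m: "has_bochner_integral lborel (\<lambda>y. mi y * norm y powr (- ?p)) (r powr (- 2 * s) * k)"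
        unfolding mi_def k_def by (rule integral_truncated_kernel_scale[OF r s])
      have mK[measurable]: "mi \<in> borel_measurable borel" "od \<in> borel_measurable borel" "K1 \<in> borel_measurable borel" "K2 \<in> borel_measurable borel"
        unfolding mi_def od_def K1_def K2_def by measurable
      have K1: "integrable lborel K1"
        using m by (intro Bochner_Integration.integrable_bound[of lborel "\<lambda>y. mi y * norm y powr (- ?p)" K1])
          (auto simp: has_bochner_integral_iff K1_def indicator_def)
      have K1le: "integral\<^sup>L lborel K1 \<le> r powr (- 2 * s) * k"
      proof -
        have "integral\<^sup>L lborel K1 \<le> integral\<^sup>L lborel (\<lambda>y. mi y * norm y powr (- ?p))"
          using m K1 by (intro integral_mono) (auto simp: has_bochner_integral_iff K1_def indicator_def mi_def)
        then show ?thesis using m by (simp add: has_bochner_integral_iff)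
      qed
      have K2: "integrable lborel K2"
      proof (rule Bochner_Integration.integrable_bound)
        show "integrable lborel (\<lambda>y::'a. (2 * norm e / r) * (indicator {y. \<epsilon> \<le> norm y} y * norm y powr (- ?p)))"
          by (intro integrable_mult_right integrable_kernel_tail s \<epsilon>)
        have od: "\<bar>od y\<bar> \<le> 2 * norm e / r" for y
        proof (cases "norm y < r")
          case True
          have "\<bar>e \<bullet> y\<bar> \<le> norm e * norm y" by (rule Cauchy_Schwarz_ineq2)
          also have "\<dots> \<le> norm e * r" using True by (intro mult_left_mono) auto
          finally have "2 * \<bar>e \<bullet> y\<bar> / r\<^sup>2 \<le> 2 * (norm e * r) / r\<^sup>2" using r by (intro divide_right_mono) auto
          also have "\<dots> = 2 * norm e / r" using r by (simp add: power2_eq_square)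
          finally show ?thesis using True by (simp add: od_def abs_mult)
        qed (use r in \<open>simp add: od_def\<close>)
        show "AE y::'a in lborel. norm (K2 y) \<le> norm ((2 * norm e / r) * (indicator {y. \<epsilon> \<le> norm y} y * norm y powr (- ?p)))"
        proof (rule AE_I2)
          fix y :: 'a
          show "norm (K2 y) \<le> norm ((2 * norm e / r) * (indicator {y. \<epsilon> \<le> norm y} y * norm y powr (- ?p)))"
          proof (cases "\<epsilon> \<le> norm y")
            case True
            have "\<bar>od y\<bar> * norm y powr (- ?p) \<le> (2 * norm e / r) * norm y powr (- ?p)"
              by (intro mult_right_mono od) simp
            then show ?thesis using True r by (simp add: K2_def abs_mult)
          qed (simp add: K2_def)
        qed
      qed measurable
      have K2z: "integral\<^sup>L lborel K2 = 0"
      proof -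
        have "has_bochner_integral lborel K2 (integral\<^sup>L lborel K2)" using K2 by (rule has_bochner_integral_integrable)
        then have "has_bochner_integral lborel (\<lambda>y. K2 (0 - y)) (integral\<^sup>L lborel K2)"
          using lborel_has_bochner_integral_minus[OF mK(4)] by blast
        moreover have "K2 (0 - y) = - K2 y" for y by (simp add: K2_def od_def indicator_def)
        ultimately have "integral\<^sup>L lborel (\<lambda>y. - K2 y) = integral\<^sup>L lborel K2" by (simp add: has_bochner_integral_iff)
        then show ?thesis by simp
      qed
      define B where "B = (\<lambda>z. M * (K1 (z - x) + K2 (z - x)))"
      have mB: "B \<in> borel_measurable borel" unfolding B_def by measurable
      have "has_bochner_integral lborel (\<lambda>y. B (x + y)) (M * (integral\<^sup>L lborel K1 + integral\<^sup>L lborel K2))"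
        unfolding B_def using K1 K2 by (intro has_bochner_integral_mult_right has_bochner_integral_add) (simp_all add: has_bochner_integral_iff)
      then have B: "has_bochner_integral lborel B (M * integral\<^sup>L lborel K1)"
        using lborel_has_bochner_integral_plus[OF mB] by (simp add: K2z)
      have "(LINT z:- ball x \<epsilon>|lebesgue. (u x - u z) / norm (x - z) powr ?p) \<le> integral\<^sup>L lebesgue B"
        unfolding set_lebesgue_integral_def
      proof (rule integral_mono_AE)
        show "integrable lebesgue (\<lambda>z. indicator (- ball x \<epsilon>) z *\<^sub>R ((u x - u z) / norm (x - z) powr ?p))"
          using set_integrable_frac_quotient[OF u s(1) \<epsilon>] by (simp add: set_integrable_def)
        show "integrable lebesgue B" using B mB by (subst integrable_completion) (auto simp: has_bochner_integral_iff)
        have "AE z::'a in lebesgue. z \<noteq> 0" using AE_lborel_singleton by (rule AE_completion)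
        then show "AE z in lebesgue. indicator (- ball x \<epsilon>) z *\<^sub>R ((u x - u z) / norm (x - z) powr ?p) \<le> B z"
        proof eventually_elim
          fix z :: 'a assume z: "z \<noteq> 0"
          show "indicator (- ball x \<epsilon>) z *\<^sub>R ((u x - u z) / norm (x - z) powr ?p) \<le> B z"
          proof (cases "z \<in> ball x \<epsilon>")
            case True
            then show ?thesis by (simp add: B_def K1_def K2_def dist_norm norm_minus_commute)
          next
            case False
            have "(u x - u z) / norm (x - z) powr ?p \<le> M * (mi (z - x) + od (z - x)) / norm (x - z) powr ?p"
              by (intro divide_right_mono key z) simp
            also have "\<dots> = B z"
              using False by (simp add: B_def K1_def K2_def dist_norm norm_minus_commute[of x z] divide_powr_uminus distrib_right)
            finally show ?thesis using False by simp
          qed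
        qed
      qed
      also have "\<dots> = M * integral\<^sup>L lborel K1"
        using B mB by (subst integral_completion) (auto simp: has_bochner_integral_iff)
      also have "\<dots> \<le> M * (r powr (- 2 * s) * k)" using M K1le by (intro mult_left_mono)
      finally have "truncated_frac_laplacian s u x \<epsilon> \<le> frac_const DIM('a) s * (M * (r powr (- 2 * s) * k))"
        unfolding truncated_frac_laplacian_def using fc by (intro mult_left_mono) auto
      then show ?thesis by (simp add: C_def mult_ac)
    qed
    have "frac_laplacian s u x \<le> C * r powr (- 2 * s) * M"
      by (rule frac_laplacian_le[OF ex[OF x(1)] tendsto_const trunc zero_less_one])
    then show ?thesis using x(1) ux gx by (intro bexI[of _ x]) (auto simp: M_def)
  qed
  note main = this
  have "C \<ge> 0" using fc k by (simp add: C_def)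
  then show thesis by (rule that) (rule main; blast)
qed

text \<open>A strong maximum principle: at a zero x of u the potential term is 0, while the
  fractional Laplacian is at most minus the kernel-weighted mass of u near the origin, which is
  positive since u > 0 almost everywhere in \<Omega>. The ball about the origin has radius at most
  |x| / 2, so it lies outside every small ball removed around x.\<close>

lemma supersolution_positive:
  fixes u :: "'a::euclidean_space \<Rightarrow> real" and s \<mu> :: real
  assumes s: "0 < s" "s < 1" and u: "u \<in> L1s s" and nn: "\<And>z. z \<noteq> 0 \<Longrightarrow> u z \<ge> 0"
    and \<Omega>: "open \<Omega>" "0 \<in> \<Omega>" and pos: "AE z in lebesgue. z \<in> \<Omega> - {0} \<longrightarrow> u z > 0"
    and x: "x \<noteq> 0" and ex: "frac_laplacian_exists s u x" and super: "0 \<le> hardy_operator s \<mu> u x"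
  shows "u x > 0"
proof (rule ccontr)
  let ?p = "real DIM('a) + 2 * s"
  assume "\<not> u x > 0"
  then have ux: "u x = 0" using nn[OF x] by simp
  have fc: "frac_const DIM('a) s > 0" by (rule frac_const_pos[OF s])
  obtain r0 where r0: "r0 > 0" "ball 0 r0 \<subseteq> \<Omega>" using \<Omega> openE by blast
  define r where "r = min r0 (norm x / 2)"
  have r: "r > 0" "ball 0 r \<subseteq> \<Omega>" "r \<le> norm x / 2" using r0 x by (auto simp: r_def)
  define G where "G = (\<lambda>z. indicator (ball 0 r) z * (u z / norm (x - z) powr ?p))"
  have sub: "ball 0 r \<subseteq> - ball x r"
  proof
    fix z :: 'a assume "z \<in> ball 0 r"
    then have "norm z < r" by simp
    moreover have "norm x \<le> norm z + norm (x - z)" by (metis add.commute norm_triangle_sub)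
    ultimately show "z \<in> - ball x r" using r(3) by (simp add: dist_norm)
  qed
  have ae0: "AE z::'a in lebesgue. z \<noteq> 0" using AE_lborel_singleton by (rule AE_completion)
  have "set_integrable lebesgue (ball 0 r) (\<lambda>z. u z / norm (x - z) powr ?p)"
    by (rule set_integrable_subset[OF L1s_set_integrable_tail[OF u s(1) r(1)] _ sub]) simp
  then have G: "integrable lebesgue G" by (simp add: G_def set_integrable_def)
  have G0: "AE z in lebesgue. 0 \<le> G z" using ae0 by eventually_elim (use nn in \<open>simp add: G_def\<close>)
  have "integral\<^sup>L lebesgue G \<noteq> 0"
  proof
    assume "integral\<^sup>L lebesgue G = 0"
    then have "AE z in lebesgue. G z = 0" using integral_nonneg_eq_0_iff_AE[OF G G0] by simp
    with pos ae0 have "AE z in lebesgue. z \<notin> ball (0::'a) r"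
    proof eventually_elim
      fix z :: 'a assume "z \<in> \<Omega> - {0} \<longrightarrow> 0 < u z" "z \<noteq> 0" "G z = 0"
      then show "z \<notin> ball 0 r"
        using r(2) sub r(1) by (auto simp: G_def indicator_def split: if_splits)
    qed
    then have "ball (0::'a) r \<in> null_sets lebesgue"
      by (subst (asm) AE_iff_null_sets[symmetric]) auto
    then have "negligible (ball (0::'a) r)" by (simp add: negligible_iff_null_sets)
    then show False using open_not_negligible[of "ball (0::'a) r"] r(1) by simp
  qed
  moreover have "integral\<^sup>L lebesgue G \<ge> 0" using G0 by (rule integral_nonneg_AE)
  ultimately have Gpos: "integral\<^sup>L lebesgue G > 0" by simp
  have "frac_laplacian s u x \<le> - (frac_const DIM('a) s * integral\<^sup>L lebesgue G)"
  proof (rule frac_laplacian_le[OF ex tendsto_const _ r(1)])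
    fix \<epsilon> :: real assume e: "\<epsilon> > 0" "\<epsilon> < r"
    have "(LINT z:- ball x \<epsilon>|lebesgue. (u x - u z) / norm (x - z) powr ?p) \<le> integral\<^sup>L lebesgue (\<lambda>z. - G z)"
      unfolding set_lebesgue_integral_def
    proof (rule integral_mono_AE)
      show "integrable lebesgue (\<lambda>z. indicator (- ball x \<epsilon>) z *\<^sub>R ((u x - u z) / norm (x - z) powr ?p))"
        using set_integrable_frac_quotient[OF u s(1) e(1)] by (simp add: set_integrable_def)
      show "AE z in lebesgue. indicator (- ball x \<epsilon>) z *\<^sub>R ((u x - u z) / norm (x - z) powr ?p) \<le> - G z"
        using ae0
      proof eventually_elim
        fix z :: 'a assume "z \<noteq> 0"
        then have "u z \<ge> 0" by (rule nn)
        moreover have "z \<in> ball 0 r \<Longrightarrow> z \<notin> ball x \<epsilon>" using sub e by auto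
        ultimately show "indicator (- ball x \<epsilon>) z *\<^sub>R ((u x - u z) / norm (x - z) powr ?p) \<le> - G z"
          by (auto simp: G_def ux indicator_def)
      qed
    qed (use G in simp)
    then show "truncated_frac_laplacian s u x \<epsilon> \<le> - (frac_const DIM('a) s * integral\<^sup>L lebesgue G)"
      unfolding truncated_frac_laplacian_def using mult_left_mono[of _ _ "frac_const DIM('a) s"] fc by fastforce
  qed
  also have "\<dots> < 0" using fc Gpos by simp
  finally show False using super by (simp add: hardy_operator_def ux)
qed

section \<open>Nonexistence\<close>

lemma powr_le_powr_scaled:
  fixes t e r :: real
  assumes "r > 0" "r / 2 \<le> t" "t \<le> 3 / 2 * r"
  shows "min ((1/2) powr e) ((3/2) powr e) * r powr e \<le> t powr e"
proof (cases "e \<ge> 0")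
  case True
  have "min ((1/2) powr e) ((3/2) powr e) * r powr e \<le> (1/2) powr e * r powr e"
    by (intro mult_right_mono) auto
  also have "\<dots> = (1/2 * r) powr e" by (rule powr_mult[symmetric])
  also have "\<dots> \<le> t powr e" using assms True by (intro powr_mono2) auto
  finally show ?thesis .
next
  case False
  have "min ((1/2) powr e) ((3/2) powr e) * r powr e \<le> (3/2) powr e * r powr e"
    by (intro mult_right_mono) auto
  also have "\<dots> = (3/2 * r) powr e" by (rule powr_mult[symmetric])
  also have "\<dots> \<le> t powr e" using assms False by (intro powr_mono2') auto
  finally show ?thesis .
qed

lemma nonneg_if_AE_pos:
  fixes u :: "'a::euclidean_space \<Rightarrow> real"
  assumes S: "open S" and cont: "continuous_on S u" and pos: "AE z in lebesgue. z \<in> S \<longrightarrow> u z > 0" and x: "x \<in> S"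
  shows "u x \<ge> 0"
proof (rule ccontr)
  assume neg: "\<not> u x \<ge> 0"
  define V where "V = S \<inter> u -` {..<0}"
  have V: "open V" unfolding V_def by (rule continuous_open_preimage[OF cont S]) simp
  have "AE z in lebesgue. z \<notin> V" using pos by eventually_elim (auto simp: V_def)
  then have "V \<in> null_sets lebesgue"
    using V by (subst (asm) AE_iff_null_sets[symmetric]) auto
  then have "negligible V" by (simp add: negligible_iff_null_sets)
  moreover have "V \<noteq> {}" using x neg by (auto simp: V_def)
  ultimately show False using open_not_negligible[OF V] by simp
qed

section \<open>Powers that a supersolution dominates near the origin\<close>

text \<open>Only the homogeneous inequality is assumed; the source term enters in the improvement
  step alone. \<open>\<rho> \<le> 1\<close> makes |x|^\<sigma> decreasing in \<sigma>, so that
  dominating one power implies dominating all larger exponents.\<close>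

locale hardy_supersolution =
  fixes u :: "'a::euclidean_space \<Rightarrow> real" and s \<mu> \<rho> :: real
  assumes dim: "DIM('a) \<ge> 2"
    and s: "0 < s" "s < 1" and \<mu>: "\<mu> \<ge> 0" and \<rho>: "0 < \<rho>" "\<rho> \<le> 1"
    and L1s: "u \<in> L1s s" and nonneg: "\<And>z. z \<noteq> 0 \<Longrightarrow> u z \<ge> 0"
    and continuous: "continuous_on (cball 0 \<rho> - {0}) u"
    and exists: "\<And>x. x \<noteq> 0 \<Longrightarrow> norm x \<le> \<rho> \<Longrightarrow> frac_laplacian_exists s u x"
    and super: "\<And>x. x \<noteq> 0 \<Longrightarrow> norm x \<le> \<rho> \<Longrightarrow> 0 \<le> hardy_operator s \<mu> u x"
    and pos: "\<And>x. x \<noteq> 0 \<Longrightarrow> norm x \<le> \<rho> \<Longrightarrow> u x > 0"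
begin

text \<open>Constant and radius are existential because each improvement may worsen both; the
  iteration tracks the exponent only.\<close>

definition dominates_powr :: "real \<Rightarrow> bool" where
  "dominates_powr \<sigma> \<longleftrightarrow> (\<exists>c>0. \<exists>r>0. r \<le> \<rho> \<and> (\<forall>z. z \<noteq> 0 \<longrightarrow> norm z \<le> r \<longrightarrow> c * norm z powr \<sigma> \<le> u z))"

lemma dim_real: "real DIM('a) \<ge> 2"
  using dim by simp

lemmas tau_plus_facts = tau_plus_properties[OF s dim \<mu>]

lemma dominates_powr_mono:
  assumes "dominates_powr \<sigma>" "\<sigma> \<le> \<sigma>'"
  shows "dominates_powr \<sigma>'"
proof -
  obtain c r where c: "c > 0" "r > 0" "r \<le> \<rho>" "\<And>z. z \<noteq> 0 \<Longrightarrow> norm z \<le> r \<Longrightarrow> c * norm z powr \<sigma> \<le> u z"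
    using assms(1) unfolding dominates_powr_def by blast
  have "c * norm z powr \<sigma>' \<le> u z" if z: "z \<noteq> 0" "norm z \<le> r" for z
  proof -
    have "c * norm z powr \<sigma>' \<le> c * norm z powr \<sigma>"
      using c z \<rho> assms(2) by (intro mult_left_mono powr_mono') auto
    then show ?thesis using c(4)[OF z] by linarith
  qed
  then show ?thesis unfolding dominates_powr_def using c(1-3) by blast
qed

lemma comparison:
  fixes \<alpha> \<gamma> a b d \<delta> r :: real
  assumes \<alpha>: "- real DIM('a) < \<alpha>" "\<alpha> < 2 * s" and \<gamma>: "- real DIM('a) < \<gamma>" "\<gamma> < 2 * s"
    and \<delta>: "\<delta> > 0" and r: "r \<le> \<rho>"
    and out: "\<And>z. z \<noteq> 0 \<Longrightarrow> norm z < \<delta> \<or> r < norm z \<Longrightarrow> a * norm z powr \<alpha> + b * norm z powr \<gamma> + d \<le> u z"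
    and sub: "\<And>x. \<delta> \<le> norm x \<Longrightarrow> norm x \<le> r \<Longrightarrow> u x < a * norm x powr \<alpha> + b * norm x powr \<gamma> + d \<Longrightarrow>
      a * (c_s DIM('a) s \<alpha> + \<mu>) * norm x powr (\<alpha> - 2 * s) + b * (c_s DIM('a) s \<gamma> + \<mu>) * norm x powr (\<gamma> - 2 * s) + d * \<mu> * norm x powr (- 2 * s) < 0"
    and x: "x \<noteq> 0"
  shows "a * norm x powr \<alpha> + b * norm x powr \<gamma> + d \<le> u x"
proof (rule annulus_comparison[OF s \<alpha> \<gamma> \<mu> \<delta> L1s _ _ out sub x])
  show "frac_laplacian_exists s u x \<and> 0 \<le> hardy_operator s \<mu> u x" if "\<delta> \<le> norm x" "norm x \<le> r" for x
  proof -
    have "x \<noteq> 0" using that(1) \<delta> by auto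
    then show ?thesis using exists[of x] super[of x] that r by simp
  qed
  show "continuous_on {x. \<delta> \<le> norm x \<and> norm x \<le> r} u"
    by (rule continuous_on_subset[OF continuous]) (use \<delta> r in auto)
qed

text \<open>The barrier is \<open>|x|^\<sigma> - \<rho>^(\<sigma> - \<sigma>') |x|^\<sigma>' - \<delta>^\<sigma>\<close> with \<open>\<sigma> < \<sigma>' < 2s\<close>: it is nonpositive off the annulus
  \<open>\<delta> \<le> |x| \<le> \<rho>\<close>, and a strict subsolution near the origin since both exponents exceed \<open>\<tau>_+\<close>.\<close>

lemma dominates_powr_above_tau_plus:
  assumes \<sigma>: "tau_plus DIM('a) s \<mu> < \<sigma>" "\<sigma> < 2 * s"
  shows "dominates_powr \<sigma>"
proof -
  let ?N = "real DIM('a)"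
  obtain \<sigma>' where \<sigma>': "\<sigma> < \<sigma>'" "\<sigma>' < 2 * s" using dense[OF \<sigma>(2)] by blast
  define e where "e = \<sigma>' - \<sigma>"
  have e: "e > 0" using \<sigma>' by (simp add: e_def)
  have \<sigma>0: "\<sigma> > 0" using \<sigma>(1) tau_plus_facts(1) by linarith
  define \<kappa> where "\<kappa> = - (c_s DIM('a) s \<sigma> + \<mu>)"
  define \<kappa>' where "\<kappa>' = - (c_s DIM('a) s \<sigma>' + \<mu>)"
  have \<kappa>: "\<kappa> > 0" "\<kappa>' > 0"
    using tau_plus_facts(3)[of \<sigma>] tau_plus_facts(3)[of \<sigma>'] \<sigma> \<sigma>' by (auto simp: \<kappa>_def \<kappa>'_def)
  \<comment> \<open>Below this radius \<open>\<rho> powr (- e) * \<kappa>' * norm x powr e\<close>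
    stays under \<kappa>, so the positive contribution of the second power cannot outweigh the
    negative one of the first. The bound \<rho> / 2 keeps \<open>r1\<close> strictly below
    \<rho>.\<close>
  define r1 where "r1 = min (\<rho> / 2) (\<rho> * (\<kappa> / \<kappa>') powr (1 / e))"
  have r1: "0 < r1" "r1 < \<rho>" using \<rho> \<kappa> by (auto simp: r1_def)
  have near: "\<rho> powr (- e) * \<kappa>' * norm x powr e < \<kappa>" if "norm x < r1" for x :: 'a
  proof -
    have "norm x powr e < (\<rho> * (\<kappa> / \<kappa>') powr (1 / e)) powr e"
      using that e by (intro powr_less_mono2) (auto simp: r1_def)
    also have "\<dots> = \<rho> powr e * (\<kappa> / \<kappa>')"
      using e \<kappa> by (simp add: powr_mult powr_powr)
    finally have "(\<rho> powr (- e) * \<kappa>') * norm x powr e < (\<rho> powr (- e) * \<kappa>') * (\<rho> powr e * (\<kappa> / \<kappa>'))"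
      using \<rho> \<kappa> by (intro mult_strict_left_mono) auto
    also have "\<dots> = (\<rho> powr (- e) * \<rho> powr e) * \<kappa>" using \<kappa> by simp
    also have "\<dots> = \<kappa>" using \<rho> by (simp add: powr_add[symmetric])
    finally show ?thesis .
  qed
  define A where "A = {x::'a. r1 \<le> norm x \<and> norm x \<le> \<rho>}"
  have "A = cball 0 \<rho> - ball 0 r1" by (auto simp: A_def)
  then have cA: "compact A" by (simp add: compact_diff)
  have "continuous_on A u" by (rule continuous_on_subset[OF continuous]) (use r1 in \<open>auto simp: A_def\<close>)
  moreover obtain y0 :: 'a where "norm y0 = \<rho>" using vector_choose_size[of \<rho>] \<rho> by auto
  then have "y0 \<in> A" using r1 by (simp add: A_def)
  then have "A \<noteq> {}" by blast
  ultimately obtain y where y: "y \<in> A" "\<And>z. z \<in> A \<Longrightarrow> u y \<le> u z"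
    using continuous_attains_inf[OF cA] by blast
  have uy: "u y > 0" using y(1) r1 by (intro pos) (auto simp: A_def)
  \<comment> \<open>k \<rho>^\<sigma> is the minimum of u over r1 \<le> |x| \<le> \<rho>. There the
    barrier cannot exceed u, so its subsolution inequality is needed only for |x| < r1.\<close>
  define k where "k = u y / \<rho> powr \<sigma>"
  have k: "k > 0" using uy \<rho> by (simp add: k_def)
  have e_split: "norm z powr \<sigma>' = norm z powr \<sigma> * norm z powr e" for z :: 'a
    by (simp add: e_def powr_add[symmetric])
  have e_split2: "norm z powr (\<sigma>' - 2 * s) = norm z powr (\<sigma> - 2 * s) * norm z powr e" for z :: 'a
    by (simp add: e_def powr_add[symmetric])
  have low: "k * norm x powr \<sigma> + (- k * \<rho> powr (- e)) * norm x powr \<sigma>' + (- k * \<delta> powr \<sigma>) \<le> u x"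
    if x: "x \<noteq> 0" and \<delta>: "\<delta> > 0" for x \<delta>
  proof (rule comparison[OF _ \<sigma>(2) _ \<sigma>'(2) \<delta> order_refl _ _ x])
    show "- ?N < \<sigma>" "- ?N < \<sigma>'" using \<sigma>0 \<sigma>' dim_real by linarith+
    show "k * norm z powr \<sigma> + (- k * \<rho> powr (- e)) * norm z powr \<sigma>' + (- k * \<delta> powr \<sigma>) \<le> u z"
      if z: "z \<noteq> 0" "norm z < \<delta> \<or> \<rho> < norm z" for z
    proof -
      have "k * norm z powr \<sigma> + (- k * \<rho> powr (- e)) * norm z powr \<sigma>' + (- k * \<delta> powr \<sigma>)
        = k * (norm z powr \<sigma> * (1 - \<rho> powr (- e) * norm z powr e) - \<delta> powr \<sigma>)"
        by (simp add: e_split algebra_simps)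
      also have "\<dots> \<le> k * 0"
      proof (intro mult_left_mono)
        show "norm z powr \<sigma> * (1 - \<rho> powr (- e) * norm z powr e) - \<delta> powr \<sigma> \<le> 0"
        proof (cases "\<rho> < norm z")
          case True
          have "1 = \<rho> powr (- e) * \<rho> powr e" using \<rho> by (simp add: powr_add[symmetric])
          also have "\<dots> \<le> \<rho> powr (- e) * norm z powr e" using True \<rho> e by (intro mult_left_mono powr_mono2) auto
          finally have "norm z powr \<sigma> * (1 - \<rho> powr (- e) * norm z powr e) \<le> 0" by (intro mult_nonneg_nonpos) auto
          then show ?thesis using powr_ge_zero[of \<delta> \<sigma>] by linarith
        next
          case False
          have "norm z powr \<sigma> * (1 - \<rho> powr (- e) * norm z powr e) \<le> norm z powr \<sigma> * 1" by (intro mult_left_mono) auto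
          also have "norm z powr \<sigma> \<le> \<delta> powr \<sigma>" using False z(2) \<sigma>0 by (intro powr_mono2) auto
          finally show ?thesis by simp
        qed
      qed (use k in simp)
      finally show ?thesis using nonneg[OF z(1)] by simp
    qed
    show "k * (c_s DIM('a) s \<sigma> + \<mu>) * norm x powr (\<sigma> - 2 * s) + (- k * \<rho> powr (- e)) * (c_s DIM('a) s \<sigma>' + \<mu>) * norm x powr (\<sigma>' - 2 * s)
      + (- k * \<delta> powr \<sigma>) * \<mu> * norm x powr (- 2 * s) < 0"
      if x: "\<delta> \<le> norm x" "norm x \<le> \<rho>" "u x < k * norm x powr \<sigma> + (- k * \<rho> powr (- e)) * norm x powr \<sigma>' + (- k * \<delta> powr \<sigma>)" for x
    proof -
      have "norm x < r1"
      proof (rule ccontr)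
        assume "\<not> norm x < r1"
        then have "u y \<le> u x" using x by (intro y(2)) (auto simp: A_def)
        moreover have "k * norm x powr \<sigma> \<le> k * \<rho> powr \<sigma>" using k x \<sigma>0 by (intro mult_left_mono powr_mono2) auto
        moreover have "k * \<rho> powr \<sigma> = u y" using \<rho> by (simp add: k_def)
        moreover have "0 \<le> k * \<rho> powr (- e) * norm x powr \<sigma>'" "0 \<le> k * \<delta> powr \<sigma>" using k by simp_all
        ultimately show False using x(3) by linarith
      qed
      have "k * (c_s DIM('a) s \<sigma> + \<mu>) * norm x powr (\<sigma> - 2 * s) + (- k * \<rho> powr (- e)) * (c_s DIM('a) s \<sigma>' + \<mu>) * norm x powr (\<sigma>' - 2 * s)
        = (k * norm x powr (\<sigma> - 2 * s)) * (\<rho> powr (- e) * \<kappa>' * norm x powr e - \<kappa>)"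
        unfolding e_split2 \<kappa>_def \<kappa>'_def by (simp add: algebra_simps)
      also have "\<dots> < 0"
      proof (rule mult_pos_neg)
        have "x \<noteq> 0" using x(1) \<delta> by auto
        then show "0 < k * norm x powr (\<sigma> - 2 * s)" using k by simp
      qed (use near[OF \<open>norm x < r1\<close>] in simp)
      finally have "k * (c_s DIM('a) s \<sigma> + \<mu>) * norm x powr (\<sigma> - 2 * s) + (- k * \<rho> powr (- e)) * (c_s DIM('a) s \<sigma>' + \<mu>) * norm x powr (\<sigma>' - 2 * s) < 0" .
      moreover have "0 \<le> k * \<delta> powr \<sigma> * \<mu> * norm x powr (- 2 * s)" using k \<mu> by simp
      ultimately show ?thesis by simp
    qed
  qed
  define r2 where "r2 = \<rho> * (1/2) powr (1 / e)"
  have "(1/2) powr (1 / e) \<le> (1/2::real) powr 0" using e by (intro powr_mono') auto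
  then have r2: "0 < r2" "r2 \<le> \<rho>" using \<rho> by (auto simp: r2_def mult_left_le)
  have "k / 4 * norm x powr \<sigma> \<le> u x" if x: "x \<noteq> 0" "norm x \<le> r2" for x
  proof -
    \<comment> \<open>The lower bound holds with the same k for every inner radius, so \<delta> may
      depend on x. For |x| \<le> \<open>r2\<close> the second power costs at most half of k
      |x|^\<sigma> and the constant a quarter, which leaves a quarter.\<close>
    define \<delta> where "\<delta> = norm x * (1/4) powr (1 / \<sigma>)"
    have \<delta>: "\<delta> > 0" "\<delta> powr \<sigma> = norm x powr \<sigma> * (1/4)"
      using x \<sigma>0 by (simp_all add: \<delta>_def powr_mult powr_powr)
    have "\<rho> powr (- e) * norm x powr e \<le> \<rho> powr (- e) * r2 powr e"
      using x e by (intro mult_left_mono powr_mono2) auto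
    also have "\<dots> = (\<rho> powr (- e) * \<rho> powr e) * (1/2)"
      using e by (simp add: r2_def powr_mult powr_powr)
    also have "\<dots> = 1/2" using \<rho> by (simp add: powr_add[symmetric])
    finally have "(k * norm x powr \<sigma>) * (\<rho> powr (- e) * norm x powr e) \<le> (k * norm x powr \<sigma>) * (1/2)"
      using k by (intro mult_left_mono) auto
    moreover have "k * norm x powr \<sigma> - (k * norm x powr \<sigma>) * (\<rho> powr (- e) * norm x powr e) - k * (norm x powr \<sigma> * (1/4)) \<le> u x"
      using low[OF x(1) \<delta>(1)] unfolding \<delta>(2) e_split by (simp add: algebra_simps)
    ultimately show ?thesis by (simp add: algebra_simps)
  qed
  then show ?thesis unfolding dominates_powr_def using k r2 by (intro exI[of _ "k / 4"] conjI exI[of _ r2]) auto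
qed

text \<open>The multiple k is free here because \<sigma> < \<alpha>: in a ball whose radius shrinks
  as k grows, c |z|^\<sigma> already exceeds k |z|^\<alpha>. Beyond radius r the barrier is
  nonpositive as \<alpha> < 0, and in between it is a strict subsolution by the symmetry of
  \<open>c_s\<close>.\<close>

lemma not_dominates_powr_below_tau_minus:
  assumes \<sigma>: "\<sigma> < (2 * s - real DIM('a) - tau_plus DIM('a) s \<mu>)"
  shows "\<not> dominates_powr \<sigma>"
proof
  let ?N = "real DIM('a)"
  assume "dominates_powr \<sigma>"
  then obtain c r where c: "c > 0" "r > 0" "r \<le> \<rho>" "\<And>z. z \<noteq> 0 \<Longrightarrow> norm z \<le> r \<Longrightarrow> c * norm z powr \<sigma> \<le> u z"
    unfolding dominates_powr_def by blast
  \<comment> \<open>\<alpha> has to stay above -N for |x|^\<alpha> to be admissible; the room for it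
    is \<tau>_- > -N, that is \<tau>_+ < 2s.\<close>
  have "max \<sigma> (- ?N) < (2 * s - real DIM('a) - tau_plus DIM('a) s \<mu>)" using \<sigma> tau_plus_facts(2) by simp
  then obtain \<alpha> where \<alpha>: "max \<sigma> (- ?N) < \<alpha>" "\<alpha> < (2 * s - real DIM('a) - tau_plus DIM('a) s \<mu>)" using dense by blast
  have \<alpha>': "\<sigma> < \<alpha>" "- ?N < \<alpha>" "\<alpha> < 0" "\<alpha> < 2 * s" using \<alpha> tau_plus_facts(1) s dim_real by auto
  have sub: "c_s DIM('a) s \<alpha> + \<mu> < 0"
    using tau_plus_facts(3)[of "2 * s - ?N - \<alpha>"] \<alpha> \<alpha>' by (simp add: c_s_symmetric)
  \<comment> \<open>The second power is a placeholder with coefficient 0 and the admissible exponent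
    0.\<close>
  have low: "k * norm x powr \<alpha> + 0 * norm x powr 0 + (- k * r powr \<alpha>) \<le> u x" if k: "k > 0" and x: "x \<noteq> 0" for k x
  proof -
    \<comment> \<open>The second entry is the radius at which k |z|^\<alpha> = c |z|^\<sigma>; the
      first keeps z where the lower bound on u is known.\<close>
    define \<delta> where "\<delta> = min r ((c / k) powr (1 / (\<alpha> - \<sigma>)))"
    have \<delta>: "\<delta> > 0" using c k by (simp add: \<delta>_def)
    show ?thesis
    proof (rule comparison[OF \<alpha>'(2,4) _ _ \<delta> c(3) _ _ x])
      show "k * norm z powr \<alpha> + 0 * norm z powr 0 + - k * r powr \<alpha> \<le> u z"
        if z: "z \<noteq> 0" "norm z < \<delta> \<or> r < norm z" for z
      proof (cases "r < norm z")
        case True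
        have "norm z powr \<alpha> \<le> r powr \<alpha>" using True c \<alpha>' by (intro powr_mono2') auto
        then have "k * norm z powr \<alpha> \<le> k * r powr \<alpha>" using k by (intro mult_left_mono) auto
        then show ?thesis using nonneg[OF z(1)] by simp
      next
        case False
        then have n: "norm z < r" "norm z < (c / k) powr (1 / (\<alpha> - \<sigma>))" using z(2) by (auto simp: \<delta>_def)
        have "norm z powr (\<alpha> - \<sigma>) \<le> ((c / k) powr (1 / (\<alpha> - \<sigma>))) powr (\<alpha> - \<sigma>)"
          using n \<alpha>' by (intro powr_mono2) auto
        also have "\<dots> = c / k" using \<alpha>' c k by (simp add: powr_powr)
        finally have "k * (norm z powr (\<alpha> - \<sigma>) * norm z powr \<sigma>) \<le> k * (c / k * norm z powr \<sigma>)"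
          using k by (intro mult_left_mono mult_right_mono) auto
        then have "k * norm z powr \<alpha> \<le> c * norm z powr \<sigma>"
          using k by (simp add: powr_add[symmetric])
        also have "\<dots> \<le> u z" using n by (intro c(4) z(1)) simp
        finally have "k * norm z powr \<alpha> \<le> u z" .
        moreover have "0 \<le> k * r powr \<alpha>" using k by simp
        ultimately show ?thesis by simp
      qed
      show "k * (c_s DIM('a) s \<alpha> + \<mu>) * norm x powr (\<alpha> - 2 * s) + 0 * (c_s DIM('a) s 0 + \<mu>) * norm x powr (0 - 2 * s) + - k * r powr \<alpha> * \<mu> * norm x powr (- 2 * s) < 0"
        if x: "\<delta> \<le> norm x" for x
      proof -
        have "norm x powr (\<alpha> - 2 * s) > 0" using x \<delta> by auto
        then have "k * (c_s DIM('a) s \<alpha> + \<mu>) * norm x powr (\<alpha> - 2 * s) < 0"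
          using k sub by (intro mult_neg_pos mult_pos_neg)
        moreover have "0 \<le> k * r powr \<alpha> * \<mu> * norm x powr (- 2 * s)" using k \<mu> by simp
        ultimately show ?thesis by simp
      qed
    qed (use s dim_real in auto)
  qed
  obtain x :: 'a where x: "norm x = r / 2" using vector_choose_size[of "r / 2"] c by auto
  then have x0: "x \<noteq> 0" using c by auto
  define D where "D = norm x powr \<alpha> - r powr \<alpha>"
  have D: "D > 0" unfolding D_def x using c \<alpha>' by (simp add: powr_less_mono2_neg)
  \<comment> \<open>With this multiple the barrier at x equals u x + 1.\<close>
  have "(u x + 1) / D > 0" using D nonneg[OF x0] by (simp add: add_nonneg_pos)
  from low[OF this x0] have "(u x + 1) / D * D \<le> u x" by (simp add: D_def right_diff_distrib)
  then show False using D by simp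
qed

text \<open>Within distance |z| / 2 of z all norms are comparable with |z|. At the point x supplied
  by \<open>frac_laplacian_near_minimum\<close> the source is at least a multiple of |z|^(\<theta> +
  p \<sigma>), while the whole operator is at most a multiple of |z|^(-2s) u z because u x \<le> u
  z. Comparing powers gives the new exponent.\<close>

lemma dominates_powr_step:
  fixes p \<theta> c0 :: real
  assumes p: "p > 0" and c0: "c0 > 0"
    and source: "\<And>x. x \<noteq> 0 \<Longrightarrow> norm x \<le> \<rho> \<Longrightarrow> c0 * norm x powr \<theta> * u x powr p \<le> hardy_operator s \<mu> u x"
    and \<sigma>: "dominates_powr \<sigma>"
  shows "dominates_powr (p * \<sigma> + \<theta> + 2 * s)"
proof -
  obtain c r where c: "c > 0" "r > 0" "r \<le> \<rho>" "\<And>z. z \<noteq> 0 \<Longrightarrow> norm z \<le> r \<Longrightarrow> c * norm z powr \<sigma> \<le> u z"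
    using \<sigma> unfolding dominates_powr_def by blast
  obtain C where C: "C \<ge> 0" "\<And>(u :: 'a \<Rightarrow> real) x0 r. r > 0 \<Longrightarrow> u \<in> L1s s \<Longrightarrow> continuous_on (cball x0 r) u \<Longrightarrow> 0 \<notin> cball x0 r \<Longrightarrow>
      (\<And>z. z \<noteq> 0 \<Longrightarrow> u z \<ge> 0) \<Longrightarrow> (\<And>x. x \<in> cball x0 r \<Longrightarrow> frac_laplacian_exists s u x) \<Longrightarrow>
      \<exists>x\<in>cball x0 r. u x \<le> u x0 \<and> frac_laplacian s u x \<le> C * r powr (- 2 * s) * u x0"
    using frac_laplacian_near_minimum[OF s, where ?'a = 'a] by blast
  define e where "e = \<theta> + \<sigma> * p"
  define m where "m = min ((1/2) powr e) ((3/2::real) powr e)"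
  have m: "m > 0" by (simp add: m_def)
  \<comment> \<open>The summand 1 keeps \<open>B\<close> positive even when C and \<mu> vanish; the
    power of 1/2 converts the radius |z| / 2 of the ball into |z|.\<close>
  define B where "B = (C + \<mu> + 1) * (1/2) powr (- 2 * s)"
  have B: "B > 0" using C(1) \<mu> by (simp add: B_def add_nonneg_pos)
  define k where "k = c0 * c powr p * m / B"
  have k: "k > 0" using c0 c m B by (simp add: k_def)
  have "k * norm z powr (p * \<sigma> + \<theta> + 2 * s) \<le> u z" if z: "z \<noteq> 0" "norm z \<le> r / 2" for z
  proof -
    define q where "q = norm z / 2"
    have q: "q > 0" using z by (simp add: q_def)
    have bd: "norm z / 2 \<le> norm x" "norm x \<le> 3 / 2 * norm z" if "x \<in> cball z q" for x
    proof -
      have d: "norm (z - x) \<le> norm z / 2" using that by (simp add: dist_norm q_def)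
      show "norm z / 2 \<le> norm x" using norm_triangle_ineq2[of z x] d by linarith
      show "norm x \<le> 3 / 2 * norm z" using norm_triangle_ineq2[of x z] d norm_minus_commute[of x z] by linarith
    qed
    have in_ball: "x \<noteq> 0" "norm x \<le> r" "norm x \<le> \<rho>" if "x \<in> cball z q" for x
      using bd[OF that] z q c(3) by (auto simp: q_def)
    have uz: "u z \<ge> 0" using nonneg z by simp
    have "\<exists>x\<in>cball z q. u x \<le> u z \<and> frac_laplacian s u x \<le> C * q powr (- 2 * s) * u z"
    proof (rule C(2)[OF q L1s _ _ nonneg])
      show "continuous_on (cball z q) u"
        by (rule continuous_on_subset[OF continuous], rule subsetI) (simp add: in_ball)
      show "0 \<notin> cball z q" using in_ball(1)[of 0] by auto
      show "frac_laplacian_exists s u x" if "x \<in> cball z q" for x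
        using exists in_ball that by blast
    qed
    then obtain x where x: "x \<in> cball z q" "u x \<le> u z" "frac_laplacian s u x \<le> C * q powr (- 2 * s) * u z"
      by blast
    note xb = in_ball[OF x(1)]
    have "c0 * c powr p * (m * norm z powr e) \<le> c0 * c powr p * norm x powr e"
      unfolding m_def using c0 z bd[OF x(1)] by (intro mult_left_mono powr_le_powr_scaled) auto
    also have "\<dots> = c0 * norm x powr \<theta> * (c * norm x powr \<sigma>) powr p"
      by (simp add: e_def powr_mult powr_powr powr_add)
    also have "\<dots> \<le> c0 * norm x powr \<theta> * u x powr p"
      using c0 c p xb by (intro mult_left_mono powr_mono2) auto
    also have "\<dots> \<le> hardy_operator s \<mu> u x" by (rule source[OF xb(1,3)])
    also have "\<dots> = frac_laplacian s u x + \<mu> * norm x powr (- 2 * s) * u x"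
      by (simp add: hardy_operator_def powr_minus_divide)
    also have "\<dots> \<le> C * q powr (- 2 * s) * u z + \<mu> * q powr (- 2 * s) * u z"
    proof (intro add_mono x(3) mult_mono mult_left_mono powr_mono2')
      show "q \<le> norm x" using bd(1)[OF x(1)] by (simp add: q_def)
      show "0 \<le> u x" using nonneg xb by simp
    qed (use s q \<mu> x(2) in auto)
    also have "\<dots> \<le> (C + \<mu> + 1) * q powr (- 2 * s) * u z"
      using uz by (simp add: algebra_simps)
    also have "\<dots> = B * norm z powr (- 2 * s) * u z"
      unfolding q_def B_def using powr_mult[of "1/2" "norm z" "- 2 * s"] by simp
    finally have "c0 * c powr p * (m * norm z powr e) \<le> B * norm z powr (- 2 * s) * u z" .
    then have "norm z powr (2 * s) * (c0 * c powr p * (m * norm z powr e)) \<le> norm z powr (2 * s) * (B * norm z powr (- 2 * s) * u z)"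
      by (intro mult_left_mono) auto
    also have "\<dots> = (norm z powr (2 * s) * norm z powr (- 2 * s)) * (B * u z)" by (simp add: mult_ac)
    also have "\<dots> = B * u z" using z by (simp add: powr_add[symmetric])
    finally have "c0 * c powr p * m * (norm z powr e * norm z powr (2 * s)) \<le> u z * B" by (simp add: mult_ac)
    then have "k * (norm z powr e * norm z powr (2 * s)) \<le> u z"
      using B by (simp add: k_def pos_divide_le_eq)
    then show ?thesis by (simp add: e_def powr_add[symmetric] algebra_simps)
  qed
  then show ?thesis unfolding dominates_powr_def using k c(2,3) by (intro exI[of _ k] conjI exI[of _ "r / 2"]) auto
qed

theorem no_singular_source:
  fixes p \<theta> c0 :: real
  assumes p: "p > 0" and c0: "c0 > 0"
    and source: "\<And>x. x \<noteq> 0 \<Longrightarrow> norm x \<le> \<rho> \<Longrightarrow> c0 * norm x powr \<theta> * u x powr p \<le> hardy_operator s \<mu> u x"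
    and \<theta>: "\<theta> < - tau_plus DIM('a) s \<mu> - real DIM('a)" and crit: "(p + 1) * tau_plus DIM('a) s \<mu> \<le> - (real DIM('a) + \<theta>)"
  shows False
proof -
  let ?N = "real DIM('a)"
  \<comment> \<open>The loss of exponent in one step is affine in \<sigma> with slope 1 - p, so a
    bound on an interval follows from the value at one end, chosen by the sign of 1 - p. At \<tau>_+
    it is the bound on p together with N > 2s that gives positivity, at \<tau>_- the bound on
    \<theta>.\<close>
  define gap where "gap = (\<lambda>\<sigma>. \<sigma> - (p * \<sigma> + \<theta> + 2 * s))"
  have gap_p: "gap (tau_plus DIM('a) s \<mu>) > 0"
    using crit s tau_plus_facts(1) dim_real by (simp add: gap_def algebra_simps)
  have gap_m: "gap (2 * s - real DIM('a) - tau_plus DIM('a) s \<mu>) > 0"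
  proof -
    have "(2 * s - real DIM('a) - tau_plus DIM('a) s \<mu>) < 0" using s tau_plus_facts(1) dim_real by linarith
    then have "p * (2 * s - real DIM('a) - tau_plus DIM('a) s \<mu>) < 0" using p by (simp add: mult_pos_neg)
    then show ?thesis using \<theta> unfolding gap_def by linarith
  qed
  \<comment> \<open>\<open>g\<close> is half the smaller end value and \<eta> is so small that
    enlarging the interval by \<eta> at both ends costs at most the other half. The enlargement lets
    the iteration start strictly above \<tau>_+ and finish strictly below \<tau>_-; the summand 1
    covers p = 1.\<close>
  define g where "g = min (gap (tau_plus DIM('a) s \<mu>)) (gap (2 * s - real DIM('a) - tau_plus DIM('a) s \<mu>)) / 2"
  define \<eta> where "\<eta> = min ((2 * s - tau_plus DIM('a) s \<mu>) / 2) (g / (\<bar>1 - p\<bar> + 1))"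
  have g: "g > 0" using gap_p gap_m by (simp add: g_def)
  have \<eta>: "\<eta> > 0" "tau_plus DIM('a) s \<mu> + \<eta> < 2 * s" "\<bar>1 - p\<bar> * \<eta> \<le> g"
  proof -
    show "\<eta> > 0" using tau_plus_facts(2) g by (simp add: \<eta>_def)
    have "\<eta> \<le> (2 * s - tau_plus DIM('a) s \<mu>) / 2" unfolding \<eta>_def by (rule min.cobounded1)
    then have "2 * \<eta> \<le> 2 * s - tau_plus DIM('a) s \<mu>" by (simp add: field_simps)
    then show "tau_plus DIM('a) s \<mu> + \<eta> < 2 * s" using tau_plus_facts(2) by simp
    have "\<eta> \<le> g / (\<bar>1 - p\<bar> + 1)" unfolding \<eta>_def by (rule min.cobounded2)
    then have "\<eta> * (\<bar>1 - p\<bar> + 1) \<le> g" by (simp add: pos_le_divide_eq)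
    then show "\<bar>1 - p\<bar> * \<eta> \<le> g" using \<open>\<eta> > 0\<close> by (simp add: algebra_simps)
  qed
  have gap_ge: "gap \<sigma> \<ge> g" if \<sigma>: "(2 * s - real DIM('a) - tau_plus DIM('a) s \<mu>) - \<eta> \<le> \<sigma>" "\<sigma> \<le> tau_plus DIM('a) s \<mu> + \<eta>" for \<sigma>
  proof (cases "1 - p \<ge> 0")
    case True
    have "(1 - p) * ((2 * s - real DIM('a) - tau_plus DIM('a) s \<mu>) - \<eta>) \<le> (1 - p) * \<sigma>" using True \<sigma>(1) by (intro mult_left_mono)
    then have "gap (2 * s - real DIM('a) - tau_plus DIM('a) s \<mu>) - \<bar>1 - p\<bar> * \<eta> \<le> gap \<sigma>" using True by (simp add: gap_def algebra_simps)
    then show ?thesis using \<eta>(3) by (simp add: g_def min_def split: if_splits)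
  next
    case False
    have "(p - 1) * \<sigma> \<le> (p - 1) * (tau_plus DIM('a) s \<mu> + \<eta>)" using False \<sigma>(2) by (intro mult_left_mono) auto
    then have "gap (tau_plus DIM('a) s \<mu>) - \<bar>1 - p\<bar> * \<eta> \<le> gap \<sigma>" using False by (simp add: gap_def algebra_simps)
    then show ?thesis using \<eta>(3) by (simp add: g_def min_def split: if_splits)
  qed
  have order: "(2 * s - real DIM('a) - tau_plus DIM('a) s \<mu>) - \<eta> \<le> tau_plus DIM('a) s \<mu> + \<eta>" using \<eta>(1) tau_plus_facts(1) s dim_real by linarith
  \<comment> \<open>Each step loses at least \<open>g\<close> in the exponent. The maximum halts the
    descent at \<tau>_- - \<eta>, so that every exponent stays in the interval where the loss is
    controlled.\<close>
  have iter: "dominates_powr (max ((2 * s - real DIM('a) - tau_plus DIM('a) s \<mu>) - \<eta>) (tau_plus DIM('a) s \<mu> + \<eta> - real n * g))" for n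
  proof (induction n)
    case 0
    have "dominates_powr (tau_plus DIM('a) s \<mu> + \<eta>)" using \<eta> by (intro dominates_powr_above_tau_plus) auto
    then show ?case by (rule dominates_powr_mono) simp
  next
    case (Suc n)
    define \<sigma> where "\<sigma> = max ((2 * s - real DIM('a) - tau_plus DIM('a) s \<mu>) - \<eta>) (tau_plus DIM('a) s \<mu> + \<eta> - real n * g)"
    have "dominates_powr (p * \<sigma> + \<theta> + 2 * s)"
      unfolding \<sigma>_def by (rule dominates_powr_step[OF p c0 source Suc.IH])
    moreover have "0 \<le> real n * g" using g by simp
    then have "(2 * s - real DIM('a) - tau_plus DIM('a) s \<mu>) - \<eta> \<le> \<sigma>" "\<sigma> \<le> tau_plus DIM('a) s \<mu> + \<eta>" using order by (auto simp: \<sigma>_def)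
    then have "gap \<sigma> \<ge> g" by (rule gap_ge)
    then have "p * \<sigma> + \<theta> + 2 * s \<le> \<sigma> - g" by (simp add: gap_def)
    moreover have "\<sigma> - g \<le> max ((2 * s - real DIM('a) - tau_plus DIM('a) s \<mu>) - \<eta>) (tau_plus DIM('a) s \<mu> + \<eta> - real (Suc n) * g)"
      using g by (auto simp: \<sigma>_def max_def algebra_simps)
    ultimately show ?case by (auto intro: dominates_powr_mono)
  qed
  obtain n :: nat where "(tau_plus DIM('a) s \<mu> + \<eta> - ((2 * s - real DIM('a) - tau_plus DIM('a) s \<mu>) - \<eta>)) / g < real n" using reals_Archimedean2 by blast
  then have "tau_plus DIM('a) s \<mu> + \<eta> - ((2 * s - real DIM('a) - tau_plus DIM('a) s \<mu>) - \<eta>) < real n * g" using g by (simp add: pos_divide_less_eq)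
  then have "max ((2 * s - real DIM('a) - tau_plus DIM('a) s \<mu>) - \<eta>) (tau_plus DIM('a) s \<mu> + \<eta> - real n * g) = (2 * s - real DIM('a) - tau_plus DIM('a) s \<mu>) - \<eta>" by (intro max_absorb1) linarith
  then have "dominates_powr ((2 * s - real DIM('a) - tau_plus DIM('a) s \<mu>) - \<eta>)" using iter[of n] by simp
  then show False using not_dominates_powr_below_tau_minus[of "(2 * s - real DIM('a) - tau_plus DIM('a) s \<mu>) - \<eta>"] \<eta>(1) by simp
qed

end

section \<open>Reduction of the problem in \<Omega> to a punctured ball\<close>

theorem theorem1p3:
  fixes \<Omega> :: "'a::euclidean_space set"
    and Q :: "'a \<Rightarrow> real"
    and s \<mu> \<beta> \<theta> p :: real
  assumes "DIM('a) \<ge> 2"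
    and "0 < s" and "s < 1"
    and "bounded_C2_domain \<Omega>" and "0 \<in> \<Omega>"
    and "\<mu> \<ge> 0"
    and "0 < \<beta>" and "\<beta> < 1"
    and "locally_holder_on (- {0}) \<beta> Q"
    and "\<forall>x. x \<noteq> 0 \<longrightarrow> Q x > 0"
    and "\<theta> < - tau_plus DIM('a) s \<mu> - real DIM('a)"
    and "Liminf (at 0) (\<lambda>x. ereal (Q x * norm x powr (- \<theta>))) > 0"
    and "0 < p" and "ereal p \<le> q_sharp DIM('a) s \<mu> \<theta>"
  shows "\<not> (\<exists>u. positive_solution s \<mu> Q p \<Omega> u)"
proof
  assume "\<exists>u. positive_solution s \<mu> Q p \<Omega> u"
  then obtain u where "positive_solution s \<mu> Q p \<Omega> u" ..
  then have u: "u \<in> L1s s" and cont: "continuous_on (\<Omega> - {0}) u"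
    and sol: "\<And>x. x \<in> \<Omega> - {0} \<Longrightarrow> frac_laplacian_exists s u x \<and> Q x * u x powr p \<le> hardy_operator s \<mu> u x"
    and ext: "\<And>x. x \<notin> \<Omega> \<Longrightarrow> u x \<ge> 0"
    and pos: "AE x in lebesgue. x \<in> \<Omega> - {0} \<longrightarrow> u x > 0"
    by (auto simp: positive_solution_def classical_solution_def)
  have \<Omega>: "open \<Omega>" using assms(4) by (simp add: bounded_C2_domain_def)
  have nonneg: "u z \<ge> 0" if "z \<noteq> 0" for z
  proof (cases "z \<in> \<Omega>")
    case True
    have "open (\<Omega> - {0})" using \<Omega> by (intro open_Diff) auto
    then show ?thesis using nonneg_if_AE_pos[OF _ cont pos] True that by blast
  qed (rule ext)
  have super: "0 \<le> hardy_operator s \<mu> u x" if x: "x \<in> \<Omega> - {0}" for x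
  proof -
    have "0 \<le> Q x * u x powr p" using assms(10) x by (intro mult_nonneg_nonneg) (auto simp: less_imp_le)
    then show ?thesis using sol[OF x] by linarith
  qed
  obtain \<rho>1 where \<rho>1: "\<rho>1 > 0" "ball 0 \<rho>1 \<subseteq> \<Omega>" using \<Omega> assms(5) openE by blast
  obtain c0 where c0: "0 < ereal c0" "ereal c0 < Liminf (at 0) (\<lambda>x. ereal (Q x * norm x powr (- \<theta>)))"
    using ereal_dense2[OF assms(12)] by blast
  have "\<forall>\<^sub>F x in at 0. ereal c0 < ereal (Q x * norm x powr (- \<theta>))"
    using c0(2) by (rule less_LiminfD)
  then obtain \<rho>2 where \<rho>2: "\<rho>2 > 0" "\<And>x. x \<noteq> 0 \<Longrightarrow> norm x < \<rho>2 \<Longrightarrow> c0 < Q x * norm x powr (- \<theta>)"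
    by (auto simp: eventually_at dist_norm)
  \<comment> \<open>Halving lets the closed ball of radius \<rho> fit into both open balls; the
    bound by 1 is the one required by the locale.\<close>
  define \<rho> where "\<rho> = min 1 (min \<rho>1 \<rho>2 / 2)"
  have rho: "0 < \<rho>" "\<rho> \<le> 1" "\<rho> < \<rho>1" "\<rho> < \<rho>2" using \<rho>1 \<rho>2 by (auto simp: \<rho>_def min_def)
  have in_\<Omega>: "x \<in> \<Omega> - {0}" if "x \<noteq> 0" "norm x \<le> \<rho>" for x
    using that rho \<rho>1 by (auto simp: subset_iff)
  interpret hardy_supersolution u s \<mu> \<rho>
  proof
    show "continuous_on (cball 0 \<rho> - {0}) u" by (rule continuous_on_subset[OF cont]) (use in_\<Omega> in auto)
    show "u x > 0" if "x \<noteq> 0" "norm x \<le> \<rho>" for x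
      using supersolution_positive[OF assms(2,3) u nonneg \<Omega> assms(5) pos that(1)] sol super in_\<Omega>[OF that] by blast
  qed (use assms u nonneg rho sol super in_\<Omega> in auto)
  show False
  proof (rule no_singular_source[OF assms(13) _ _ assms(11)])
    show "0 < c0" using c0(1) by simp
    show "c0 * norm x powr \<theta> * u x powr p \<le> hardy_operator s \<mu> u x" if x: "x \<noteq> 0" "norm x \<le> \<rho>" for x
    proof -
      have "c0 * norm x powr \<theta> \<le> (Q x * norm x powr (- \<theta>)) * norm x powr \<theta>"
        using \<rho>2(2)[OF x(1)] x rho by (intro mult_right_mono less_imp_le) simp_all
      also have "\<dots> = Q x" using x by (simp add: mult.assoc powr_add[symmetric])
      finally have "c0 * norm x powr \<theta> * u x powr p \<le> Q x * u x powr p" by (intro mult_right_mono) auto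
      then show ?thesis using sol[OF in_\<Omega>[OF x]] by linarith
    qed
    \<comment> \<open>For \<mu> = 0 the exponent \<tau>_+ is 0 and the inequality reads N + \<theta>
      \<le> 0, which the bound on \<theta> gives for every p. For \<mu> > 0 it is the bound by
      \<open>q_sharp\<close> multiplied by \<tau>_+ > 0.\<close>
    show "(p + 1) * tau_plus DIM('a) s \<mu> \<le> - (real DIM('a) + \<theta>)"
    proof (cases "\<mu> = 0")
      case True
      then show ?thesis using tau_plus_facts(4) assms(11) by simp
    next
      case False
      then have t: "tau_plus DIM('a) s \<mu> > 0" using tau_plus_facts(5) assms(6) by simp
      have "p + 1 \<le> - ((real DIM('a) + \<theta>) / tau_plus DIM('a) s \<mu>)"
        using assms(14) False by (simp add: q_sharp_def)
      then have "(p + 1) * tau_plus DIM('a) s \<mu> \<le> - ((real DIM('a) + \<theta>) / tau_plus DIM('a) s \<mu>) * tau_plus DIM('a) s \<mu>"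
        using t by (intro mult_right_mono) auto
      then show ?thesis using t by simp
    qed
  qed
qed

end
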